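(* Let $-1<B<A\leq 1$, let $c>-1$, let $f\in\mathcal{A}$, and let $F$ be the function given by Bernardi's integral operator $$F(z)=\frac{c+1}{z^{c}}\int_{0}^{z}t^{c-1}f(t)\,dt .$$ For real $\beta,\gamma$ consider the pair of conditions: (C1) both $$\frac{A-B}{(1-B)\big((1-A)\beta+(1-B)\gamma\big)}\geq \frac{1-A}{1-B}+e \quad\text{and}\quad \frac{A-B}{(1+B)\big((1+A)\beta+(1+B)\gamma\big)}\geq -\frac{1+A}{1+B}+e ;$$ (C2) both $\beta(1+A)+\gamma(1+B)>0$ and $\beta(1-A)+\gamma(1-B)>0$. (i) If $f\in\mathcal{S}^*_e$ and (C1), (C2) hold with $\beta=1$ and $\gamma=c$, then $F\in\mathcal{S}^*[A,B]$. (ii) If $f'(z)\prec e^{z}$ and (C1), (C2) hold with $\beta=0$ and $\gamma=c+1$, then $F\in\mathcal{R}[A,B]$.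
   Context: $\mathbb{D}=\{z\in\mathbb{C}:|z|<1\}$. $\mathcal{A}$ is the class of analytic functions $f$ on $\mathbb{D}$ with $f(0)=0$, $f'(0)=1$. For analytic $f,g$ on $\mathbb{D}$, $f\prec g$ means there is an analytic $w:\mathbb{D}\to\mathbb{D}$ with $w(0)=0$ and $f=g\circ w$. $\mathcal{S}^*_e=\{f\in\mathcal{A}: zf'(z)/f(z)\prec e^{z}\}$; $\mathcal{S}^*[A,B]=\{f\in\mathcal{A}: zf'(z)/f(z)\prec(1+Az)/(1+Bz)\}$; $\mathcal{R}[A,B]=\{f\in\mathcal{A}: f'(z)\prec(1+Az)/(1+Bz)\}$. The integral is interpreted as $F(z)=(c+1)\int_0^1 s^{c-1}f(sz)\,ds$. Here $e$ is the base of the natural logarithm. *)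

theory Defs
  imports "HOL-Complex_Analysis.Complex_Analysis"
begin

abbreviation unit_disc :: "complex set" where
  "unit_disc \<equiv> ball 0 1"

definition class_A :: "(complex \<Rightarrow> complex) set" where
  "class_A = {f. f holomorphic_on unit_disc \<and> f 0 = 0 \<and> deriv f 0 = 1}"

definition subordinate :: "(complex \<Rightarrow> complex) \<Rightarrow> (complex \<Rightarrow> complex) \<Rightarrow> bool" where
  "subordinate f g \<longleftrightarrow>
     f holomorphic_on unit_disc \<and> g holomorphic_on unit_disc \<and>
     (\<exists>w. w holomorphic_on unit_disc \<and> w ` unit_disc \<subseteq> unit_disc \<and> w 0 = 0 \<and>
          (\<forall>z\<in>unit_disc. f z = g (w z)))"

text \<open>
  The quotient \<open>z f'(z) / f(z)\<close>.  For \<open>f\<close> in \<open>class_A\<close> it has a removable singularity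
  at the origin, where its limit is \<open>1\<close> (division in HOL would give \<open>0\<close>).  At a zero of
  \<open>f\<close> other than the origin the quotient has a pole, so it is unbounded nearby whatever
  value HOL assigns at the zero itself; the holomorphy demanded by \<open>subordinate\<close>
  therefore rules such zeros out.
\<close>
definition starlike_quotient :: "(complex \<Rightarrow> complex) \<Rightarrow> complex \<Rightarrow> complex" where
  "starlike_quotient f z = (if z = 0 then 1 else z * deriv f z / f z)"

definition janowski :: "real \<Rightarrow> real \<Rightarrow> complex \<Rightarrow> complex" where
  "janowski A B z = (1 + of_real A * z) / (1 + of_real B * z)"

definition starlike_exp :: "(complex \<Rightarrow> complex) set" where
  "starlike_exp = {f \<in> class_A. subordinate (starlike_quotient f) exp}"

definition starlike_janowski :: "real \<Rightarrow> real \<Rightarrow> (complex \<Rightarrow> complex) set" where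
  "starlike_janowski A B = {f \<in> class_A. subordinate (starlike_quotient f) (janowski A B)}"

definition R_janowski :: "real \<Rightarrow> real \<Rightarrow> (complex \<Rightarrow> complex) set" where
  "R_janowski A B = {f \<in> class_A. subordinate (deriv f) (janowski A B)}"

text \<open>
  Bernardi's operator \<open>((c + 1) / z\<^sup>c) \<integral>\<^sub>0\<^sup>z t\<^sup>c\<^sup>-\<^sup>1 f(t) dt\<close> after the substitution
  \<open>t = s z\<close>, which removes the choice of a branch of \<open>z\<^sup>c\<close>.  For \<open>c > -1\<close> and \<open>f\<close> in
  \<open>class_A\<close> the integrand is \<open>O(s\<^sup>c)\<close> as \<open>s\<close> tends to \<open>0\<close>, hence absolutely integrable.
\<close>
definition bernardi :: "real \<Rightarrow> (complex \<Rightarrow> complex) \<Rightarrow> complex \<Rightarrow> complex" where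
  "bernardi c f z =
     of_real (c + 1) * integral {0..1} (\<lambda>s::real. of_real (s powr (c - 1)) * f (of_real s * z))"

definition cond_C1 :: "real \<Rightarrow> real \<Rightarrow> real \<Rightarrow> real \<Rightarrow> bool" where
  "cond_C1 A B \<beta> \<gamma> \<longleftrightarrow>
     (A - B) / ((1 - B) * ((1 - A) * \<beta> + (1 - B) * \<gamma>)) \<ge> (1 - A) / (1 - B) + exp 1 \<and>
     (A - B) / ((1 + B) * ((1 + A) * \<beta> + (1 + B) * \<gamma>)) \<ge> - ((1 + A) / (1 + B)) + exp 1"

definition cond_C2 :: "real \<Rightarrow> real \<Rightarrow> real \<Rightarrow> real \<Rightarrow> bool" where
  "cond_C2 A B \<beta> \<gamma> \<longleftrightarrow>
     \<beta> * (1 + A) + \<gamma> * (1 + B) > 0 \<and> \<beta> * (1 - A) + \<gamma> * (1 - B) > 0"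

end

theory Submission
  imports Defs
begin

text \<open>
  Part (ii) is a direct application of the Miller--Mocanu principle: if \<open>F'\<close> left the Janowski
  disc, then at the first contact point \<open>F'(z) + z F''(z) / (c + 1) = f'(z)\<close> would have modulus at
  least \<open>e\<close>, which is impossible for a value of \<open>e\<^sup>w\<close> with \<open>|w| < 1\<close>.

  In part (i) this direct argument breaks down when \<open>A - B\<close> is small: at a contact with the Janowski
  circle the value of \<open>z f'(z) / f(z)\<close> may lie inside the image of the unit disc under \<open>e\<^sup>z\<close>.  Put
  \<open>a = c + 1\<close>, \<open>f = z g\<close>, \<open>F = z G\<close> and \<open>Q = G / g\<close>.  Then \<open>z Q' = a - a Q - Q (z f' / f - 1)\<close> and
  \<open>z F' / F = 1 + a (1 / Q - 1)\<close>, so the claim says that \<open>1 / Q\<close> stays in a disc with real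
  diameter \<open>(1 - 1 / y1, 1 + 1 / y2)\<close>.  Instead of the disc, \<open>1 / Q\<close> is compared with
  \<open>exp (\<kappa> L)\<close>, where \<open>L(z) = \<integral>\<^sub>0\<^sup>z (e\<^sup>t - 1) / t dt\<close> is the dominant of the limit \<open>a \<rightarrow> 0\<close> and
  \<open>\<kappa>\<close> decreases with \<open>a\<close>; the contact argument for this dominant uses the convexity of the image of
  the unit disc under \<open>e\<^sup>z\<close> and an inequality on the unit circle.  The image of \<open>exp L\<close> lies in
  explicit discs, and a real power \<open>\<kappa> \<le> 1\<close> maps a disc with positive real diameter
  \<open>[p, q]\<close> into the one with diameter \<open>[p\<^sup>\<kappa>, q\<^sup>\<kappa>]\<close>, so that the conditions on \<open>A\<close>, \<open>B\<close>, \<open>c\<close> reduce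
  to inequalities in one real variable.  For \<open>A - B\<close> and \<open>c + 1\<close> near \<open>0\<close> the estimate has less than one
  percent of slack, which is why the numerical parts are carried out with exact integer polynomials.
\<close>

subsection \<open>The Miller--Mocanu principle\<close>

text \<open>Letting a tend to 0 in the equation for \<open>Q\<close> leaves z Q' = - Q (z f' / f -
  1), which exp (- L) solves when z f' / f = e^z; this is the origin of \<open>ell\<close>. For a >
  0 the extra term a (1 - Q) pulls \<open>Q\<close> towards 1, and a smaller exponent \<kappa>
  accounts for it. At a contact, z f' / f would be 1 + a W + m \<kappa> (e^\<zeta> - 1) with W = exp
  (\<kappa> L(\<zeta>)) - 1. The supporting line of the exponential image at e^\<zeta> excludes this
  once Re (conj \<zeta> e^-\<zeta> W) exceeds (1 - \<kappa>) / a times Re (conj \<zeta> (1 -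
  e^-\<zeta>)). The polynomial \<open>rho\<close> bounds the ratio of these two real parts, divided
  by \<kappa>, from below on the whole circle, so \<kappa> is fixed by 1 - \<kappa> = a \<kappa>
  rho(\<kappa>). Given a, the parameters A and B enter only through y1 = a (1 - B) / (A - B) and y2
  = a (1 + B) / (A - B). Condition (C1) becomes two quadratic inequalities in y1 and y2, and the
  target disc shrinks as either grows. The critical case is therefore the point where both
  inequalities are equalities: a curve with parameter a, or equivalently \<kappa>.\<close>

lemma has_real_derivative_norm_power2:
  fixes k :: "real \<Rightarrow> complex"
  assumes "(k has_vector_derivative k') (at t)"
  shows "((\<lambda>t. (norm (k t))\<^sup>2) has_real_derivative 2 * (k t \<bullet> k')) (at t)"
proof -
  have "((\<lambda>t. k t \<bullet> k t) has_derivative (\<lambda>h. k t \<bullet> (h *\<^sub>R k') + (h *\<^sub>R k') \<bullet> k t)) (at t)"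
    using assms unfolding has_vector_derivative_def by (intro has_derivative_inner) auto
  then show ?thesis
    unfolding has_field_derivative_def power2_norm_eq_inner
    by (rule has_derivative_eq_rhs) (simp add: inner_commute fun_eq_iff)
qed

text \<open>Jack's lemma: comparing \<open>w\<close> with the identity along every direction pointing into the
  disc forces the logarithmic derivative at the contact point to be real.\<close>
lemma Jack:
  fixes w :: "complex \<Rightarrow> complex"
  assumes r: "r > 0" and z0: "norm z0 = r"
    and der: "(w has_field_derivative w') (at z0)" and one: "norm (w z0) = 1"
    and le: "\<And>z. norm z < r \<Longrightarrow> norm (w z) \<le> norm z / r"
  obtains m :: real where "m \<ge> 1" "z0 * w' = of_real m * w z0"
proof -
  define l where "l = z0 * w' / w z0"
  have wz: "w z0 \<noteq> 0" using one by auto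
  have dir: "Re ((l - 1) * d) \<ge> 0" if d: "Re d > 0" for d
  proof (rule ccontr)
    assume neg: "\<not> Re ((l - 1) * d) \<ge> 0"
    define k where "k = (\<lambda>t::real. w (z0 * (1 - of_real t * d)))"
    define j where "j = (\<lambda>t::real. 1 - of_real t * d)"
    have j': "(j has_vector_derivative (- d)) (at 0)"
      unfolding j_def by (auto intro!: derivative_eq_intros has_vector_derivative_real_field)
    have "((\<lambda>t. z0 * (1 - t * d)) has_field_derivative (- z0 * d)) (at 0)"
      by (auto intro!: derivative_eq_intros)
    moreover have "(w has_field_derivative w') (at (z0 * (1 - 0 * d)))" using der by simp
    ultimately have "((\<lambda>t. w (z0 * (1 - t * d))) has_field_derivative (w' * (- z0 * d))) (at (of_real 0))"
      using DERIV_chain2[of w w' "\<lambda>t. z0 * (1 - t * d)" 0 "- z0 * d"] by simp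
    then have k': "(k has_vector_derivative (- (w z0 * (l * d)))) (at 0)"
      unfolding k_def using has_vector_derivative_real_field[of "\<lambda>t. w (z0 * (1 - t * d))" _ 0 UNIV]
      by (simp add: l_def wz mult_ac)
    have in1: "k 0 \<bullet> (- (w z0 * (l * d))) = - Re (l * d)"
    proof -
      have "w z0 \<bullet> (w z0 * (l * d)) = (norm (w z0))\<^sup>2 * Re (l * d)"
        unfolding cmod_power2 by (simp add: inner_complex_def algebra_simps power2_eq_square)
      then show ?thesis using one by (simp add: k_def)
    qed
    have in2: "j 0 \<bullet> (- d) = - Re d" by (simp add: j_def inner_complex_def)
    have d1: "((\<lambda>t. (norm (k t))\<^sup>2 - (norm (j t))\<^sup>2) has_real_derivative (- 2 * Re ((l - 1) * d))) (at 0)"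
      using DERIV_diff[OF has_real_derivative_norm_power2[OF k'] has_real_derivative_norm_power2[OF j']]
      unfolding in1 in2 by (simp add: algebra_simps)
    have d2: "((\<lambda>t. (norm (j t))\<^sup>2) has_real_derivative (- 2 * Re d)) (at 0)"
      using has_real_derivative_norm_power2[OF j'] unfolding in2 by simp
    obtain e1 where e1: "e1 > 0" "\<And>h. 0 < h \<Longrightarrow> h < e1 \<Longrightarrow>
        (norm (k 0))\<^sup>2 - (norm (j 0))\<^sup>2 < (norm (k (0 + h)))\<^sup>2 - (norm (j (0 + h)))\<^sup>2"
      using DERIV_pos_inc_right[OF d1] neg by auto
    obtain e2 where e2: "e2 > 0" "\<And>h. 0 < h \<Longrightarrow> h < e2 \<Longrightarrow> (norm (j (0 + h)))\<^sup>2 < (norm (j 0))\<^sup>2"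
      using DERIV_neg_dec_right[OF d2] d by auto
    define h where "h = min e1 e2 / 2"
    have h: "0 < h" "h < e1" "h < e2" using e1(1) e2(1) by (auto simp: h_def)
    have "(norm (j h))\<^sup>2 < 1" using e2(2)[OF h(1,3)] by (simp add: j_def)
    then have jl: "norm (j h) < 1" by (simp add: power2_less_1_iff)
    have "norm (k h) \<le> norm (z0 * j h) / r"
      unfolding k_def j_def
      by (rule le) (use jl r z0 in \<open>simp add: norm_mult j_def\<close>)
    then have "norm (k h) \<le> norm (j h)" using z0 r by (simp add: norm_mult)
    then have "(norm (k h))\<^sup>2 \<le> (norm (j h))\<^sup>2" by (rule power_mono) simp
    moreover have "0 < (norm (k h))\<^sup>2 - (norm (j h))\<^sup>2"
      using e1(2)[OF h(1,2)] one by (simp add: j_def k_def)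
    ultimately show False by linarith
  qed
  have re: "Re l \<ge> 1" using dir[of 1] by simp
  \<comment> \<open>A direction with real part 1 may have any imaginary part;
    \<open>Re l / Im l\<close> is the one that gives \<open>(l - 1) * d\<close> the real part
    -1.\<close>
  have im: "Im l = 0"
  proof (rule ccontr)
    assume "Im l \<noteq> 0"
    then have "Re ((l - 1) * Complex 1 (Re l / Im l)) = -1" by (simp add: field_simps)
    moreover have "Re ((l - 1) * Complex 1 (Re l / Im l)) \<ge> 0" by (rule dir) simp
    ultimately show False by simp
  qed
  have "l = of_real (Re l)" using im by (simp add: complex_eq_iff)
  then have "z0 * w' = of_real (Re l) * w z0" using wz by (simp add: l_def field_simps)
  with re that show thesis by blast
qed

text \<open>If \<open>T\<close> leaves the image of the unit disc, it does so at a point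
  \<open>z0\<close> of least modulus. Since \<phi> is univalent beyond the closed disc, its inverse
  \<psi> is holomorphic near the boundary value \<open>T z0\<close>, and Jack's lemma applies to
  \<psi> composed with \<open>T\<close>; the number \<open>m\<close> in \<open>no_contact\<close> is
  the one it supplies.\<close>

lemma Miller_Mocanu:
  fixes \<phi> T :: "complex \<Rightarrow> complex"
  assumes R: "R > 1" and hol: "\<phi> holomorphic_on ball 0 R" and inj: "inj_on \<phi> (ball 0 R)"
    and T: "T holomorphic_on ball 0 1" and T0: "T 0 = \<phi> 0"
    and no_contact: "\<And>z \<zeta> m. \<lbrakk>norm z < 1; norm \<zeta> = 1; m \<ge> 1; T z = \<phi> \<zeta>;
        z * deriv T z = of_real m * (\<zeta> * deriv \<phi> \<zeta>)\<rbrakk> \<Longrightarrow> False"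
  obtains w where "w holomorphic_on ball 0 1" "w ` ball 0 1 \<subseteq> ball 0 1" "w 0 = 0"
    "\<And>z. z \<in> ball 0 1 \<Longrightarrow> T z = \<phi> (w z)"
proof -
  obtain \<psi> where \<psi>: "\<psi> holomorphic_on (\<phi> ` ball 0 R)" "\<And>z. z \<in> ball 0 R \<Longrightarrow> \<psi> (\<phi> z) = z"
    using holomorphic_has_inverse[OF hol open_ball inj] by metis
  have opR: "open (\<phi> ` ball 0 R)" by (rule open_mapping_thm3[OF hol open_ball inj])
  have op1: "open (\<phi> ` ball 0 1)"
    using open_mapping_thm3[of \<phi> "ball 0 1"] hol inj R
    by (meson holomorphic_on_subset inj_on_subset open_ball subset_ball less_imp_le)
  have sub1: "\<phi> ` ball 0 1 \<subseteq> \<phi> ` ball 0 R" using R by (intro image_mono subset_ball) auto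
  have contT: "continuous_on (ball 0 1) T" using T by (rule holomorphic_on_imp_continuous_on)
  have all: "T z \<in> \<phi> ` ball 0 1" if zin: "norm z < 1" for z
  proof (rule ccontr)
    assume bad: "T z \<notin> \<phi> ` ball 0 1"
    define K where "K = {x \<in> cball 0 (norm z). T x \<in> - (\<phi> ` ball 0 1)}"
    have contc: "continuous_on (cball 0 (norm z)) T"
      using contT by (rule continuous_on_subset) (use zin in auto)
    have K_eq: "K = cball 0 (norm z) \<inter> T -` (- (\<phi> ` ball 0 1))" unfolding K_def by blast
    have "closed K" unfolding K_eq
      by (rule continuous_closed_preimage[OF contc closed_cball]) (use op1 in \<open>simp add: closed_Compl\<close>)
    then have "compact K"
      unfolding compact_eq_bounded_closed K_eq by (metis bounded_Int bounded_cball)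
    moreover have "z \<in> K" using bad by (simp add: K_def)
    ultimately obtain z0 where z0: "z0 \<in> K" "\<And>x. x \<in> K \<Longrightarrow> norm z0 \<le> norm x"
      using continuous_attains_inf[of K norm] by (metis continuous_on_norm_id empty_iff)
    define r where "r = norm z0"
    have r1: "r < 1" using z0(1) zin by (auto simp: K_def r_def)
    have good: "T x \<in> \<phi> ` ball 0 1" if "norm x < r" for x
    proof (rule ccontr)
      assume "T x \<notin> \<phi> ` ball 0 1"
      then have "x \<in> K" using that z0(1) by (auto simp: K_def r_def)
      then show False using z0(2)[of x] that by (simp add: r_def)
    qed
    have "z0 \<noteq> 0" using z0(1) T0 by (auto simp: K_def)
    then have r0: "r > 0" by (simp add: r_def)
    \<comment> \<open>As a limit of values taken at smaller modulus, \<open>T z0\<close> lies in the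
      compact image of the closed disc. It is not in the image of the open disc, so its preimage
      \<zeta> has modulus exactly 1.\<close>
    have "T z0 \<in> \<phi> ` cball 0 1"
    proof -
      have "compact (\<phi> ` cball 0 1)"
        by (intro compact_continuous_image holomorphic_on_imp_continuous_on holomorphic_on_subset[OF hol])
           (use R in auto)
      then have cl: "closed (\<phi> ` cball 0 1)" by (rule compact_imp_closed)
      have "z0 \<in> closure (ball 0 r)" using r0 by (simp add: r_def)
      have "T ` closure (ball 0 r) \<subseteq> \<phi> ` cball 0 1"
      proof (rule image_closure_subset[OF _ cl])
        show "continuous_on (closure (ball 0 r)) T"
          using contT by (rule continuous_on_subset) (use r0 r1 in auto)
        show "T ` ball 0 r \<subseteq> \<phi> ` cball 0 1"
          using good ball_subset_cball by (fastforce simp: image_subset_iff)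
      qed
      then show ?thesis using \<open>z0 \<in> closure (ball 0 r)\<close> by blast
    qed
    then obtain \<zeta> where \<zeta>: "norm \<zeta> \<le> 1" "T z0 = \<phi> \<zeta>" by auto
    have "\<zeta> \<notin> ball 0 1" using \<zeta>(2) z0(1) by (auto simp: K_def)
    with \<zeta>(1) have \<zeta>1: "norm \<zeta> = 1" by simp
    define w where "w = (\<lambda>x. \<psi> (T x))"
    have Tz0: "T z0 \<in> \<phi> ` ball 0 R" using \<zeta> R by auto
    have wz0: "w z0 = \<zeta>" using \<zeta> \<psi>(2)[of \<zeta>] R by (simp add: w_def)
    have dT: "(T has_field_derivative deriv T z0) (at z0)"
      by (rule holomorphic_derivI[OF T open_ball]) (use r1 in \<open>simp add: r_def\<close>)
    have "(\<psi> has_field_derivative deriv \<psi> (T z0)) (at (T z0))"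
      by (rule holomorphic_derivI[OF \<psi>(1) opR Tz0])
    then have dw: "(w has_field_derivative (deriv \<psi> (T z0) * deriv T z0)) (at z0)"
      unfolding w_def using dT by (rule DERIV_chain2)
    have d\<phi>: "(\<phi> has_field_derivative deriv \<phi> \<zeta>) (at (w z0))"
      unfolding wz0 by (rule holomorphic_derivI[OF hol open_ball]) (use \<zeta>1 R in simp)
    have hw: "w holomorphic_on ball 0 r"
      unfolding w_def
    proof (rule holomorphic_on_compose_gen[unfolded o_def, OF _ \<psi>(1)])
      show "T holomorphic_on ball 0 r" by (rule holomorphic_on_subset[OF T]) (use r1 in auto)
      show "T ` ball 0 r \<subseteq> \<phi> ` ball 0 R" using good sub1 by force
    qed
    have wlt: "norm (w x) < 1" if x: "norm x < r" for x
    proof -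
      obtain y where "y \<in> ball 0 1" "T x = \<phi> y" using good[OF x] by auto
      then show ?thesis using \<psi>(2)[of y] R by (simp add: w_def)
    qed
    have w0: "w 0 = 0" using \<psi>(2)[of 0] R by (simp add: w_def T0)
    have le: "norm (w x) \<le> norm x / r" if "norm x < r" for x
    proof -
      have "norm ((\<lambda>u. w (of_real r * u)) (x / of_real r)) \<le> norm (x / of_real r)"
      proof (rule Schwarz_Lemma)
        show "(\<lambda>u. w (of_real r * u)) holomorphic_on ball 0 1"
          by (rule holomorphic_on_compose_gen[unfolded o_def, OF _ hw])
             (use r0 in \<open>auto intro!: holomorphic_intros simp: norm_mult\<close>)
      qed (use wlt w0 r0 that in \<open>auto simp: norm_mult norm_divide\<close>)
      then show ?thesis using r0 by (simp add: norm_divide)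
    qed
    have "norm (w z0) = 1" using \<zeta>1 by (simp add: wz0)
    with Jack[OF r0 _ dw _ le] obtain m :: real where m: "m \<ge> 1"
      "z0 * (deriv \<psi> (T z0) * deriv T z0) = of_real m * w z0"
      by (metis r_def)
    have "((\<lambda>x. \<phi> (w x)) has_field_derivative (deriv \<phi> \<zeta> * (deriv \<psi> (T z0) * deriv T z0))) (at z0)"
      using d\<phi> dw by (rule DERIV_chain2)
    moreover have "((\<lambda>x. \<phi> (w x)) has_field_derivative deriv T z0) (at z0)"
    proof (rule has_field_derivative_transform_within_open[OF dT])
      have "open (ball 0 1 \<inter> T -` (\<phi> ` ball 0 R))"
        by (rule continuous_open_preimage[OF contT open_ball opR])
      then show "open (ball 0 1 \<inter> T -` (\<phi> ` ball 0 R))" .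
      show "z0 \<in> ball 0 1 \<inter> T -` (\<phi> ` ball 0 R)" using Tz0 r1 by (auto simp: r_def)
    qed (use \<psi>(2) in \<open>auto simp: w_def\<close>)
    ultimately have eq: "deriv T z0 = deriv \<phi> \<zeta> * (deriv \<psi> (T z0) * deriv T z0)"
      by (metis DERIV_unique)
    have "z0 * deriv T z0 = deriv \<phi> \<zeta> * (z0 * (deriv \<psi> (T z0) * deriv T z0))"
      by (subst eq) (simp only: mult_ac)
    also have "\<dots> = of_real m * (\<zeta> * deriv \<phi> \<zeta>)"
      unfolding m(2) wz0 by (simp only: mult_ac)
    finally have "z0 * deriv T z0 = of_real m * (\<zeta> * deriv \<phi> \<zeta>)" .
    then show False using no_contact[OF _ \<zeta>1 m(1) \<zeta>(2)] r1 by (simp add: r_def)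
  qed
  define w where "w = (\<lambda>x. \<psi> (T x))"
  have val: "w z \<in> ball 0 1 \<and> T z = \<phi> (w z)" if z: "z \<in> ball 0 1" for z
  proof -
    obtain y where "y \<in> ball 0 1" "T z = \<phi> y" using all[of z] z by auto
    then show ?thesis using \<psi>(2)[of y] R by (simp add: w_def)
  qed
  show thesis
  proof (rule that[of w])
    show "w holomorphic_on ball 0 1"
      unfolding w_def
      by (rule holomorphic_on_compose_gen[unfolded o_def, OF T \<psi>(1)]) (use all sub1 in force)
    show "w 0 = 0" using \<psi>(2)[of 0] R by (simp add: w_def T0)
  qed (use val in auto)
qed

subsection \<open>Bernardi's operator\<close>

text \<open>The operator z G' + \<mu> G multiplies the n-th Taylor coefficient by n + \<mu>, which
  has modulus at least \<mu>, so it can be inverted coefficientwise without losing convergence. This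
  yields holomorphy of the Bernardi transform without differentiating under the integral
  sign.\<close>

lemma euler_ode_solution:
  fixes k :: "complex \<Rightarrow> complex" and \<mu> :: real
  assumes k: "k holomorphic_on ball 0 1" and \<mu>: "\<mu> > 0"
  obtains G where "G holomorphic_on ball 0 1"
    "\<And>z. z \<in> ball 0 1 \<Longrightarrow> z * deriv G z + of_real \<mu> * G z = of_real \<mu> * k z"
proof -
  define b where "b = (\<lambda>n. (deriv ^^ n) k 0 / fact n)"
  define c where "c = (\<lambda>n. of_real \<mu> * b n / (of_nat n + of_real \<mu>))"
  define G where "G = (\<lambda>z. \<Sum>n. c n * z ^ n)"
  have pos: "of_nat n + of_real \<mu> \<noteq> (0::complex)" for n
  proof -
    have "Re (of_nat n + of_real \<mu>) > 0" using \<mu> by simp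
    then show ?thesis by (metis less_irrefl zero_complex.sel(1))
  qed
  have b_sums: "(\<lambda>n. b n * z ^ n) sums k z" if "norm z < 1" for z
    using holomorphic_power_series[OF k, of z] that by (simp add: b_def)
  have "norm (c n) \<le> norm (b n)" for n
  proof -
    have "norm (of_nat n + of_real \<mu> :: complex) = real n + \<mu>"
      using \<mu> by (metis norm_of_real of_real_add of_real_of_nat_eq abs_of_nonneg add_nonneg_nonneg less_imp_le of_nat_0_le_iff)
    then show ?thesis
      using \<mu> by (simp add: c_def norm_divide norm_mult divide_simps) (simp add: algebra_simps)
  qed
  then have c_sum: "summable (\<lambda>n. c n * z ^ n)" if z: "norm z < 1" for z
  proof -
    obtain x :: real where x: "norm z < x" "x < 1" using dense z by blast
    then have nx: "norm (of_real x :: complex) = x" using norm_ge_zero[of z] by (simp del: norm_ge_zero)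
    have "summable (\<lambda>n. norm (b n * z ^ n))"
      by (rule powser_insidea[OF sums_summable[OF b_sums[of "of_real x"]]]) (use x nx in simp_all)
    then show ?thesis
      by (rule summable_comparison_test') 
         (use \<open>\<And>n. norm (c n) \<le> norm (b n)\<close> in \<open>simp add: norm_mult mult_right_mono\<close>)
  qed
  have der: "(G has_field_derivative (\<Sum>n. diffs c n * z ^ n)) (at z)" if "norm z < 1" for z
    unfolding G_def using c_sum that by (rule termdiffs_strong')
  have ode: "z * deriv G z + of_real \<mu> * G z = of_real \<mu> * k z" if z: "norm z < 1" for z
  proof -
    have "summable (\<lambda>n. diffs c n * z ^ n)" using z c_sum by (rule termdiff_converges)
    then have "(\<lambda>n. of_nat n * c n * z ^ (n - Suc 0)) sums deriv G z"
      using diffs_equiv DERIV_imp_deriv[OF der[OF z]] by metis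
    then have "(\<lambda>n. z * (of_nat n * c n * z ^ (n - Suc 0)) + of_real \<mu> * (c n * z ^ n)) sums
        (z * deriv G z + of_real \<mu> * G z)"
      unfolding G_def by (intro sums_add sums_mult summable_sums c_sum z)
    moreover have "z * (of_nat n * c n * z ^ (n - Suc 0)) + of_real \<mu> * (c n * z ^ n)
        = of_real \<mu> * (b n * z ^ n)" for n
    proof -
      have "z * (of_nat n * c n * z ^ (n - Suc 0)) = of_nat n * c n * z ^ n"
        by (cases n) auto
      then have "z * (of_nat n * c n * z ^ (n - Suc 0)) + of_real \<mu> * (c n * z ^ n)
          = (of_nat n + of_real \<mu>) * c n * z ^ n" by (simp add: algebra_simps)
      also have "\<dots> = of_real \<mu> * (b n * z ^ n)" using pos[of n] by (simp add: c_def)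
      finally show ?thesis .
    qed
    ultimately have "(\<lambda>n. of_real \<mu> * (b n * z ^ n)) sums (z * deriv G z + of_real \<mu> * G z)"
      by simp
    moreover have "(\<lambda>n. of_real \<mu> * (b n * z ^ n)) sums (of_real \<mu> * k z)"
      by (intro sums_mult b_sums z)
    ultimately show ?thesis by (rule sums_unique2)
  qed
  show thesis
  proof (rule that[of G])
    show "G holomorphic_on ball 0 1"
      unfolding holomorphic_on_open[OF open_ball] by (intro ballI exI, rule der) simp
    show "z * deriv G z + of_real \<mu> * G z = of_real \<mu> * k z" if "z \<in> ball 0 1" for z
      by (rule ode) (use that in simp)
  qed
qed

text \<open>The function s^(c+1) z G(s z) is an antiderivative of c + 1 times the integrand on the
  open interval. Because c > -1, it is continuous and vanishes at s = 0, where the integrand itself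
  may be unbounded.\<close>

lemma bernardi_eq:
  fixes f g G :: "complex \<Rightarrow> complex"
  assumes c: "c > -1" and fg: "\<And>z. z \<in> ball 0 1 \<Longrightarrow> f z = z * g z"
    and G: "G holomorphic_on ball 0 1"
    and ode: "\<And>z. z \<in> ball 0 1 \<Longrightarrow>
      z * deriv G z + of_real (c + 1) * G z = of_real (c + 1) * g z"
    and z: "z \<in> ball 0 1"
  shows "bernardi c f z = z * G z"
proof -
  define \<phi> where "\<phi> = (\<lambda>s::real. of_real (s powr (c + 1)) * (z * G (of_real s * z)))"
  define \<phi>' where
    "\<phi>' = (\<lambda>s::real. of_real (c + 1) * (of_real (s powr (c - 1)) * f (of_real s * z)))"
  have inb: "of_real s * z \<in> ball 0 1" if "0 \<le> s" "s \<le> 1" for s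
    using z that mult_left_le_one_le[of "norm z" s] by (simp add: norm_mult le_less_trans)
  have "(\<phi>' has_integral \<phi> 1 - \<phi> 0) {0..1}"
  proof (rule fundamental_theorem_of_calculus_interior)
    have "continuous_on {0..1} (\<lambda>s::real. s powr (c + 1))"
      using c by (intro continuous_on_powr' continuous_intros) auto
    moreover have "continuous_on {0..1} (\<lambda>s::real. G (of_real s * z))"
      by (rule continuous_on_compose2[OF holomorphic_on_imp_continuous_on[OF G]])
         (use inb in \<open>auto intro!: continuous_intros\<close>)
    ultimately show "continuous_on {0..1} \<phi>"
      unfolding \<phi>_def by (intro continuous_on_mult continuous_on_of_real continuous_on_const)
    fix s :: real assume s: "s \<in> {0<..<1}"
    let ?u = "of_real s * z"
    have u: "?u \<in> ball 0 1" using inb s by auto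
    have "(G has_field_derivative deriv G ?u) (at (of_real s * z))"
      by (rule holomorphic_derivI[OF G open_ball u])
    moreover have "((\<lambda>t. t * z) has_field_derivative z) (at (of_real s))"
      by (auto intro!: derivative_eq_intros)
    ultimately have "((\<lambda>t. G (t * z)) has_field_derivative deriv G ?u * z) (at (of_real s))"
      by (rule DERIV_chain2)
    then have "((\<lambda>t. z * G (t * z)) has_field_derivative z * (deriv G ?u * z)) (at (of_real s))"
      by (rule DERIV_cmult)
    then have d1: "((\<lambda>t. z * G (of_real t * z)) has_vector_derivative z * (deriv G ?u * z)) (at s)"
      by (rule has_vector_derivative_real_field)
    have "((\<lambda>t. t powr (c + 1)) has_field_derivative (c + 1) * s powr c) (at s)"
      using s by (auto intro!: derivative_eq_intros)
    then have d2: "((\<lambda>t. of_real (t powr (c + 1)) :: complex) has_vector_derivative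
        of_real ((c + 1) * s powr c)) (at s)"
      by (rule has_vector_derivative_of_real)
    have p1: "s powr (c + 1) = s powr c * s" and p2: "s powr c = s powr (c - 1) * s"
      using s by (simp_all add: powr_add powr_diff)
    have "of_real (s powr (c + 1)) * (z * (deriv G ?u * z)) + of_real ((c + 1) * s powr c) * (z * G ?u)
      = of_real (s powr c) * z * (?u * deriv G ?u + of_real (c + 1) * G ?u)"
      unfolding p1 by (simp add: algebra_simps)
    also have "\<dots> = \<phi>' s"
      unfolding ode[OF u] \<phi>'_def fg[OF u] p2 by (simp add: algebra_simps)
    finally show "(\<phi> has_vector_derivative \<phi>' s) (at s)"
      unfolding \<phi>_def using has_vector_derivative_mult[OF d2 d1] by simp
  qed simp
  then have "integral {0..1} \<phi>' = z * G z" by (simp add: integral_unique \<phi>_def)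
  then show ?thesis by (simp add: bernardi_def \<phi>'_def)
qed

lemma bernardi_factorization:
  assumes c: "c > -1" and f: "f \<in> class_A"
  obtains g G where "g holomorphic_on ball 0 1" "G holomorphic_on ball 0 1" "g 0 = 1" "G 0 = 1"
    "\<And>z. z \<in> ball 0 1 \<Longrightarrow> f z = z * g z" "\<And>z. z \<in> ball 0 1 \<Longrightarrow> bernardi c f z = z * G z"
    "\<And>z. z \<in> ball 0 1 \<Longrightarrow> z * deriv G z + of_real (c + 1) * G z = of_real (c + 1) * g z"
proof -
  have hf: "f holomorphic_on ball 0 1" and f0: "f 0 = 0" and f1: "deriv f 0 = 1"
    using f by (auto simp: class_A_def)
  define g where "g = (\<lambda>z. if z = 0 then deriv f 0 else (f z - f 0) / (z - 0))"
  have hg: "g holomorphic_on ball 0 1" unfolding g_def by (rule pole_lemma[OF hf]) simp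
  have g0: "g 0 = 1" by (simp add: g_def f1)
  have fg: "f z = z * g z" for z by (simp add: g_def f0)
  obtain G where G: "G holomorphic_on ball 0 1"
    "\<And>z. z \<in> ball 0 1 \<Longrightarrow> z * deriv G z + of_real (c + 1) * G z = of_real (c + 1) * g z"
    using euler_ode_solution[OF hg, of "c + 1"] c by auto
  have "of_real (c + 1) * G 0 = of_real (c + 1)" using G(2)[of 0] g0 by simp
  moreover have "of_real (c + 1) \<noteq> (0::complex)" using c of_real_eq_0_iff[of "c + 1"] by force
  ultimately have G0: "G 0 = 1" by simp
  have "bernardi c f z = z * G z" if "z \<in> ball 0 1" for z
    using bernardi_eq[OF c fg G that] .
  with that[OF hg G(1) g0 G0 fg _ G(2)] show thesis by blast
qed

lemma has_field_derivative_bernardi: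
  assumes "G holomorphic_on ball 0 1" "\<And>z. z \<in> ball 0 1 \<Longrightarrow> F z = z * G z" "z \<in> ball 0 1"
  shows "(F has_field_derivative G z + z * deriv G z) (at z)"
proof (rule has_field_derivative_transform_within_open[OF _ open_ball assms(3)])
  show "((\<lambda>z. z * G z) has_field_derivative G z + z * deriv G z) (at z)"
    by (auto intro!: derivative_eq_intros holomorphic_derivI[OF assms(1) open_ball assms(3)])
qed (use assms in auto)

lemma bernardi_class_A:
  assumes "c > -1" "f \<in> class_A"
  shows "bernardi c f \<in> class_A"
proof -
  obtain G where G: "G holomorphic_on ball 0 1" "G 0 = 1"
      "\<And>z. z \<in> ball 0 1 \<Longrightarrow> bernardi c f z = z * G z"
    using bernardi_factorization[OF assms] by metis
  have "(\<lambda>z. z * G z) holomorphic_on ball 0 1" by (intro holomorphic_intros G(1))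
  then have "bernardi c f holomorphic_on ball 0 1"
    by (rule holomorphic_transform) (use G(3) in auto)
  moreover have "deriv (bernardi c f) 0 = 1"
    using DERIV_imp_deriv[OF has_field_derivative_bernardi[OF G(1,3), of 0]] G(2) by simp
  moreover have "bernardi c f 0 = 0" using G(3)[of 0] by simp
  ultimately show ?thesis by (simp add: class_A_def)
qed

text \<open>This is the identity z F' + c F = (c + 1) f, differentiated once.\<close>

lemma bernardi_deriv_ode:
  assumes c: "c > -1" and f: "f \<in> class_A" and z: "z \<in> ball 0 1"
  shows "z * deriv (deriv (bernardi c f)) z + of_real (c + 1) * deriv (bernardi c f) z
    = of_real (c + 1) * deriv f z"
proof -
  let ?F = "bernardi c f"
  have hf: "f holomorphic_on ball 0 1" using f by (simp add: class_A_def)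
  have hF: "?F holomorphic_on ball 0 1" using bernardi_class_A[OF c f] by (simp add: class_A_def)
  obtain g G where G: "G holomorphic_on ball 0 1" "\<And>z. z \<in> ball 0 1 \<Longrightarrow> f z = z * g z"
      "\<And>z. z \<in> ball 0 1 \<Longrightarrow> ?F z = z * G z"
      "\<And>z. z \<in> ball 0 1 \<Longrightarrow> z * deriv G z + of_real (c + 1) * G z = of_real (c + 1) * g z"
    using bernardi_factorization[OF c f] by metis
  have first: "z * deriv ?F z + of_real c * ?F z = of_real (c + 1) * f z" if "z \<in> ball 0 1" for z
  proof -
    have "z * deriv ?F z + of_real c * ?F z = z * (z * deriv G z + of_real (c + 1) * G z)"
      using DERIV_imp_deriv[OF has_field_derivative_bernardi[OF G(1,3) that]] G(3)[OF that]
      by (simp add: algebra_simps)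
    also have "\<dots> = of_real (c + 1) * f z" unfolding G(4)[OF that] G(2)[OF that] by (simp only: mult_ac)
    finally show ?thesis .
  qed
  note dF = holomorphic_derivI[OF hF open_ball z]
  note dF' = holomorphic_derivI[OF holomorphic_deriv[OF hF open_ball] open_ball z]
  have "((\<lambda>z. z * deriv ?F z + of_real c * ?F z) has_field_derivative
      deriv ?F z + z * deriv (deriv ?F) z + of_real c * deriv ?F z) (at z)"
    by (auto intro!: derivative_eq_intros dF dF')
  moreover have "((\<lambda>z. z * deriv ?F z + of_real c * ?F z) has_field_derivative
      of_real (c + 1) * deriv f z) (at z)"
    by (rule has_field_derivative_transform_within_open
        [OF DERIV_cmult[OF holomorphic_derivI[OF hf open_ball z]] open_ball z]) (use first in auto)
  ultimately have "deriv ?F z + z * deriv (deriv ?F) z + of_real c * deriv ?F z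
      = of_real (c + 1) * deriv f z" by (rule DERIV_unique)
  then show ?thesis by (simp add: algebra_simps)
qed

section \<open>The Janowski map and part (ii)\<close>

lemma janowski_denom:
  fixes z :: complex
  assumes "\<bar>B\<bar> < 1" "norm z < 2 / (1 + \<bar>B\<bar>)"
  shows "1 + of_real B * z \<noteq> 0"
proof
  assume "1 + of_real B * z = 0"
  then have "norm (of_real B * z) = 1" by (metis add_eq_0_iff2 norm_minus_cancel norm_one)
  then have "1 = \<bar>B\<bar> * norm z" by (simp add: norm_mult)
  also have "\<dots> \<le> \<bar>B\<bar> * (2 / (1 + \<bar>B\<bar>))" using assms(2) by (intro mult_left_mono) auto
  also have "\<dots> < 1" using assms(1) by (simp add: field_simps)
  finally show False by simp
qed

lemma janowski_derivative:
  assumes "1 + of_real B * z \<noteq> 0"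
  shows "(janowski A B has_field_derivative of_real (A - B) / (1 + of_real B * z)\<^sup>2) (at z)"
proof -
  have "((\<lambda>z. (1 + of_real A * z) / (1 + of_real B * z)) has_field_derivative
      (of_real A * (1 + of_real B * z) - (1 + of_real A * z) * of_real B)
        / ((1 + of_real B * z) * (1 + of_real B * z))) (at z)"
    by (rule DERIV_divide) (use assms in \<open>auto intro!: derivative_eq_intros\<close>)
  then show ?thesis
    unfolding janowski_def by (simp add: power2_eq_square algebra_simps)
qed

text \<open>The radius is the harmonic mean of 1 and the modulus of the pole, written so that it
  makes sense for B = 0 as well. It exceeds 1, as \<open>Miller_Mocanu\<close> requires.\<close>

lemma janowski_univalent:
  fixes A B :: real
  assumes "\<bar>B\<bar> < 1" "A \<noteq> B"
  shows "janowski A B holomorphic_on ball 0 (2 / (1 + \<bar>B\<bar>))"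
    and "inj_on (janowski A B) (ball 0 (2 / (1 + \<bar>B\<bar>)))"
proof -
  show "janowski A B holomorphic_on ball 0 (2 / (1 + \<bar>B\<bar>))"
    unfolding holomorphic_on_open[OF open_ball]
  proof (intro ballI exI)
    fix z :: complex assume "z \<in> ball 0 (2 / (1 + \<bar>B\<bar>))"
    then have "1 + of_real B * z \<noteq> 0" by (intro janowski_denom[OF assms(1)]) simp
    then show "(janowski A B has_field_derivative of_real (A - B) / (1 + of_real B * z)\<^sup>2) (at z)"
      by (rule janowski_derivative)
  qed
  show "inj_on (janowski A B) (ball 0 (2 / (1 + \<bar>B\<bar>)))"
  proof (rule inj_onI)
    fix z w assume zw: "z \<in> ball 0 (2 / (1 + \<bar>B\<bar>))" "w \<in> ball 0 (2 / (1 + \<bar>B\<bar>))"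
      and eq: "janowski A B z = janowski A B w"
    have "1 + of_real B * z \<noteq> 0" "1 + of_real B * w \<noteq> 0"
      using janowski_denom[OF assms(1)] zw by auto
    with eq have "(1 + of_real A * z) * (1 + of_real B * w) = (1 + of_real A * w) * (1 + of_real B * z)"
      by (simp add: janowski_def frac_eq_eq)
    then have "of_real (A - B) * (z - w) = 0" by (simp add: algebra_simps)
    then show "z = w" using assms(2) by simp
  qed
qed

text \<open>After multiplication by \<open>(1 + B \<zeta>)\<^sup>2 / \<zeta>\<close> the real part of the left-hand side and the
  right-hand side are both affine in \<open>Re \<zeta>\<close>, so the two conditions at \<open>\<zeta> = 1\<close> and \<open>\<zeta> = -1\<close> suffice.\<close>
lemma janowski_contact_norm:
  fixes A B \<mu> E m :: real
  assumes B: "\<bar>B\<bar> < 1" and \<zeta>: "norm \<zeta> = 1" and m: "m \<ge> 1" "\<mu> \<ge> 0"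
    and c1: "\<mu> \<ge> (1 - A) * (1 - B) + E * (1 - B)\<^sup>2"
    and c2: "\<mu> \<ge> E * (1 + B)\<^sup>2 - (1 + A) * (1 + B)"
  shows "norm (janowski A B \<zeta> + of_real (m * \<mu>) * \<zeta> / (1 + of_real B * \<zeta>)\<^sup>2) \<ge> E"
proof -
  define x where "x = Re \<zeta>"
  have x: "\<bar>x\<bar> \<le> 1" using abs_Re_le_cmod[of \<zeta>] \<zeta> by (simp add: x_def)
  have nz: "1 + of_real B * \<zeta> \<noteq> 0"
    by (rule janowski_denom[OF B]) (use B \<zeta> in \<open>simp add: field_simps\<close>)
  have cz: "\<zeta> * cnj \<zeta> = 1" using \<zeta> by (metis complex_norm_square of_real_1 power_one)
  define N where "N = (norm (1 + of_real B * \<zeta>))\<^sup>2"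
  have sq: "(Re \<zeta>)\<^sup>2 + (Im \<zeta>)\<^sup>2 = 1" using \<zeta> cmod_power2[of \<zeta>] by simp
  have N: "N = 1 + B\<^sup>2 + 2 * B * x"
  proof -
    have "N = 1 + 2 * B * Re \<zeta> + B\<^sup>2 * ((Re \<zeta>)\<^sup>2 + (Im \<zeta>)\<^sup>2)"
      unfolding N_def cmod_power2 by (simp add: power2_eq_square algebra_simps)
    then show ?thesis unfolding sq x_def by simp
  qed
  have Np: "N > 0" using nz by (simp add: N_def)
  define v where "v = janowski A B \<zeta> + of_real (m * \<mu>) * \<zeta> / (1 + of_real B * \<zeta>)\<^sup>2"
  define q where "q = (cnj \<zeta> + of_real A) * (1 + of_real B * \<zeta>) + of_real (m * \<mu>)"
  have "v * (1 + of_real B * \<zeta>)\<^sup>2 = (1 + of_real A * \<zeta>) * (1 + of_real B * \<zeta>) + of_real (m * \<mu>) * \<zeta>"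
  proof -
    have "(n / D + X / D\<^sup>2) * D\<^sup>2 = n * D + X" if "D \<noteq> 0" for n D X :: complex
      using that by (simp add: field_simps power2_eq_square)
    then show ?thesis using nz by (simp add: v_def janowski_def)
  qed
  also have "\<dots> = \<zeta> * q"
  proof -
    have "\<zeta> * q = (\<zeta> * cnj \<zeta> + of_real A * \<zeta>) * (1 + of_real B * \<zeta>) + of_real (m * \<mu>) * \<zeta>"
      unfolding q_def by (simp add: algebra_simps)
    then show ?thesis unfolding cz by simp
  qed
  finally have "norm v * N = norm q"
    unfolding N_def using \<zeta> by (metis mult_1 norm_mult norm_power)
  moreover have "Re q = (1 + A * B) * x + A + B + m * \<mu>"
  proof -
    have "q = cnj \<zeta> + of_real B * (\<zeta> * cnj \<zeta>) + of_real A + of_real (A * B) * \<zeta> + of_real (m * \<mu>)"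
      by (simp add: q_def algebra_simps)
    then show ?thesis unfolding cz by (simp add: x_def algebra_simps)
  qed
  moreover have "Re q \<le> norm q" by (rule complex_Re_le_cmod)
  moreover have "(1 + A * B) * x + A + B + m * \<mu> \<ge> E * N"
  proof -
    have "(1 + x) * (E * (1 + B)\<^sup>2 - (1 + A) * (1 + B)) + (1 - x) * ((1 - A) * (1 - B) + E * (1 - B)\<^sup>2)
        \<le> (1 + x) * \<mu> + (1 - x) * \<mu>"
      using x c1 c2 by (intro add_mono mult_left_mono) auto
    moreover have "1 * \<mu> \<le> m * \<mu>" using m by (intro mult_right_mono) auto
    ultimately show ?thesis unfolding N by (simp add: power2_eq_square algebra_simps)
  qed
  ultimately have "E * N \<le> norm v * N" by linarith
  then show ?thesis using Np unfolding v_def by (simp only: mult_le_cancel_right_pos)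
qed

lemma norm_exp_unit_disc:
  fixes w :: complex
  assumes "norm w < 1"
  shows "norm (exp w) < exp 1"
  using assms complex_Re_le_cmod[of w] by simp

theorem R_janowski_bernardi:
  fixes A B c :: real
  assumes AB: "-1 < B" "B < A" "A \<le> 1" and c: "c > -1" and f: "f \<in> class_A"
    and sub: "subordinate (deriv f) exp"
    and C1: "cond_C1 A B 0 (c + 1)"
  shows "bernardi c f \<in> R_janowski A B"
proof -
  define P where "P = deriv (bernardi c f)"
  have B: "\<bar>B\<bar> < 1" using AB by auto
  have FA: "bernardi c f \<in> class_A" by (rule bernardi_class_A[OF c f])
  have hP: "P holomorphic_on ball 0 1"
    unfolding P_def by (rule holomorphic_deriv[OF _ open_ball]) (use FA in \<open>simp add: class_A_def\<close>)
  have P0: "P 0 = 1" using FA by (simp add: P_def class_A_def)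
  \<comment> \<open>At a contact, z P' / (c + 1) equals m \<mu> \<zeta> / (1 + B \<zeta>)^2, and
    (C1) with \<beta> = 0 is a pair of lower bounds for this \<mu>.\<close>
  define \<mu> where "\<mu> = (A - B) / (c + 1)"
  have \<mu>: "\<mu> \<ge> 0" using AB c by (simp add: \<mu>_def)
  have c1: "\<mu> \<ge> (1 - A) * (1 - B) + exp 1 * (1 - B)\<^sup>2"
  proof -
    have "(1 - A) / (1 - B) + exp 1 \<le> \<mu> / (1 - B)\<^sup>2"
      using C1 by (simp add: cond_C1_def \<mu>_def power2_eq_square mult_ac)
    then have "((1 - A) / (1 - B) + exp 1) * (1 - B)\<^sup>2 \<le> \<mu>"
      using B by (subst (asm) pos_le_divide_eq) auto
    moreover have "1 - B \<noteq> 0" using B by auto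
    ultimately show ?thesis by (simp add: distrib_right power2_eq_square)
  qed
  have c2: "\<mu> \<ge> exp 1 * (1 + B)\<^sup>2 - (1 + A) * (1 + B)"
  proof -
    have "- ((1 + A) / (1 + B)) + exp 1 \<le> \<mu> / (1 + B)\<^sup>2"
      using C1 by (simp add: cond_C1_def \<mu>_def power2_eq_square mult_ac)
    then have "(- ((1 + A) / (1 + B)) + exp 1) * (1 + B)\<^sup>2 \<le> \<mu>"
      using AB by (subst (asm) pos_le_divide_eq) auto
    moreover have "(1 + A) / (1 + B) * (1 + B)\<^sup>2 = (1 + A) * (1 + B)"
      using AB by (simp add: power2_eq_square)
    ultimately show ?thesis by (simp only: distrib_right mult_minus_left)
  qed
  obtain w0 where w0: "w0 ` ball 0 1 \<subseteq> ball 0 1" "\<And>z. z \<in> ball 0 1 \<Longrightarrow> deriv f z = exp (w0 z)"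
    using sub unfolding subordinate_def by (elim conjE exE, intro that) (assumption, erule (1) bspec)
  have R: "2 / (1 + \<bar>B\<bar>) > 1" using B by simp
  have uni: "janowski A B holomorphic_on ball 0 (2 / (1 + \<bar>B\<bar>))"
      "inj_on (janowski A B) (ball 0 (2 / (1 + \<bar>B\<bar>)))"
    using janowski_univalent[OF B, of A] AB by auto
  obtain w where "w holomorphic_on ball 0 1" "w ` ball 0 1 \<subseteq> ball 0 1" "w 0 = 0"
    "\<And>z. z \<in> ball 0 1 \<Longrightarrow> P z = janowski A B (w z)"
  proof (rule Miller_Mocanu[OF R uni hP])
    show "P 0 = janowski A B 0" by (simp add: P0 janowski_def)
    fix z \<zeta> :: complex and m :: real
    assume z: "norm z < 1" and \<zeta>: "norm \<zeta> = 1" and m: "1 \<le> m" and contact: "P z = janowski A B \<zeta>"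
      "z * deriv P z = of_real m * (\<zeta> * deriv (janowski A B) \<zeta>)"
    have "1 + of_real B * \<zeta> \<noteq> 0" by (rule janowski_denom[OF B]) (use R \<zeta> in auto)
    note d = DERIV_imp_deriv[OF janowski_derivative[OF this, of A]]
    have c0: "of_real (c + 1) \<noteq> (0::complex)" using c of_real_eq_0_iff[of "c + 1"] by force
    have "deriv f z = P z + z * deriv P z / of_real (c + 1)"
      using bernardi_deriv_ode[OF c f, of z] z c0 by (simp add: P_def field_simps del: of_real_add)
    also have "\<dots> = janowski A B \<zeta> + of_real (m * \<mu>) * \<zeta> / (1 + of_real B * \<zeta>)\<^sup>2"
      unfolding contact d \<mu>_def by (simp add: mult_ac del: of_real_add of_real_diff)
    finally have "norm (deriv f z) \<ge> exp 1"
      using janowski_contact_norm[OF B \<zeta> m \<mu> c1 c2] by metis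
    moreover have "norm (w0 z) < 1" using w0(1) z by fastforce
    ultimately show False using norm_exp_unit_disc[of "w0 z"] w0(2)[of z] z by simp
  qed (rule that)
  moreover have "janowski A B holomorphic_on ball 0 1"
    by (rule holomorphic_on_subset[OF uni(1)], rule subset_ball) (use R in linarith)
  ultimately show ?thesis
    using FA hP unfolding R_janowski_def subordinate_def P_def by (intro CollectI conjI exI[of _ w]) auto
qed

subsection \<open>The exponential function and the dominant\<close>

text \<open>Up to the factor \<open>exp (cos t)\<close>, the derivative in t of the left-hand side
  is minus the sine of \<open>D t - D \<theta>\<close>, where \<open>D t = t + sin t\<close> is the
  angle of the outer normal to the curve exp (e^it). Since \<open>D\<close> never decreases and
  gains 2 pi per period, the component along the normal at \<theta> falls until \<open>D\<close> has
  advanced by pi and then climbs back to its initial value.\<close>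

lemma exp_cos_rotated_le:
  fixes \<theta> \<psi> :: real
  assumes "\<theta> \<le> \<psi>" "\<psi> \<le> \<theta> + 2 * pi"
  shows "exp (cos \<psi>) * cos (sin \<psi> - sin \<theta> - \<theta>) \<le> exp (cos \<theta>) * cos \<theta>"
proof -
  define D where "D = (\<lambda>t::real. t + sin t)"
  define f where "f = (\<lambda>t. exp (cos t) * cos (sin t - sin \<theta> - \<theta>))"
  have mono: "D s \<le> D t" if "s \<le> t" for s t
  proof (rule DERIV_nonneg_imp_nondecreasing[OF that])
    fix x assume "s \<le> x" "x \<le> t"
    have "0 \<le> 1 + cos x" using cos_ge_minus_one[of x] by linarith
    moreover have "(D has_real_derivative 1 + cos x) (at x)"
      unfolding D_def by (auto intro!: derivative_eq_intros)
    ultimately show "\<exists>y. (D has_real_derivative y) (at x) \<and> 0 \<le> y" by blast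
  qed
  have der: "(f has_real_derivative - exp (cos t) * sin (D t - D \<theta>)) (at t)" for t
  proof -
    have "D t - D \<theta> = t + (sin t - sin \<theta> - \<theta>)" by (simp add: D_def)
    then have "sin (D t - D \<theta>) = sin t * cos (sin t - sin \<theta> - \<theta>) + cos t * sin (sin t - sin \<theta> - \<theta>)"
      by (simp only: sin_add)
    then show ?thesis
      unfolding f_def by (auto intro!: derivative_eq_intros simp: algebra_simps)
  qed
  have D2: "D (\<theta> + 2 * pi) = D \<theta> + 2 * pi" by (simp add: D_def)
  have "f \<psi> \<le> f \<theta>"
  proof (cases "D \<psi> - D \<theta> \<le> pi")
    case True
    show ?thesis
    proof (rule DERIV_nonpos_imp_nonincreasing[OF assms(1)])
      fix t assume "\<theta> \<le> t" "t \<le> \<psi>"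
      then have "sin (D t - D \<theta>) \<ge> 0"
        using mono[of \<theta> t] mono[of t \<psi>] True by (intro sin_ge_zero) auto
      then show "\<exists>y. (f has_real_derivative y) (at t) \<and> y \<le> 0"
        using der[of t] by (intro exI[of _ "- exp (cos t) * sin (D t - D \<theta>)"]) auto
    qed
  next
    case False
    have "f \<psi> \<le> f (\<theta> + 2 * pi)"
    proof (rule DERIV_nonneg_imp_nondecreasing[OF assms(2)])
      fix t assume "\<psi> \<le> t" "t \<le> \<theta> + 2 * pi"
      then have "sin (D t - D \<theta>) \<le> 0"
        using mono[of \<psi> t] mono[of t "\<theta> + 2 * pi"] False D2
          sin_ge_zero[of "D t - D \<theta> - pi"] by (auto simp: sin_diff)
      then show "\<exists>y. (f has_real_derivative y) (at t) \<and> y \<ge> 0"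
        using der[of t] by (intro exI[of _ "- exp (cos t) * sin (D t - D \<theta>)"]) (auto simp: mult_nonneg_nonpos)
    qed
    then show ?thesis by (simp add: f_def)
  qed
  then show ?thesis by (simp add: f_def)
qed

text \<open>This is the convexity of the image of the unit disc under the exponential function: \<open>\<zeta> e\<^sup>\<zeta>\<close> is
  the outer normal at the boundary point \<open>e\<^sup>\<zeta>\<close>.\<close>
lemma exp_disc_supporting_line:
  fixes w \<zeta> :: complex
  assumes "norm \<zeta> = 1" "norm w < 1"
  shows "Re (cnj \<zeta> * exp (w - \<zeta>)) \<le> Re \<zeta>"
proof (rule maximum_real_frontier[where S = "ball 0 1" and f = "\<lambda>w. cnj \<zeta> * exp (w - \<zeta>)"])
  obtain \<theta> where \<theta>: "0 \<le> \<theta>" "\<theta> < 2 * pi" "\<zeta> = Complex (cos \<theta>) (sin \<theta>)"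
    using complex_unimodular_polar[OF assms(1)] by blast
  fix v :: complex assume "v \<in> frontier (ball 0 1)"
  then have "norm v = 1" by simp
  then obtain \<psi>0 where \<psi>0: "0 \<le> \<psi>0" "\<psi>0 < 2 * pi" "v = Complex (cos \<psi>0) (sin \<psi>0)"
    using complex_unimodular_polar by blast
  define \<psi> where "\<psi> = (if \<theta> \<le> \<psi>0 then \<psi>0 else \<psi>0 + 2 * pi)"
  have \<psi>: "\<theta> \<le> \<psi>" "\<psi> \<le> \<theta> + 2 * pi" "cos \<psi> = cos \<psi>0" "sin \<psi> = sin \<psi>0"
    using \<theta>(1,2) \<psi>0(1,2) by (auto simp: \<psi>_def)
  have "Re (cnj \<zeta> * exp (v - \<zeta>)) = exp (cos \<psi> - cos \<theta>) * cos (sin \<psi> - sin \<theta> - \<theta>)"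
    unfolding \<theta>(3) \<psi>0(3) \<psi>(3,4) cos_diff[of "sin \<psi>0 - sin \<theta>" \<theta>]
    by (simp add: Re_exp Im_exp algebra_simps)
  also have "\<dots> \<le> cos \<theta>"
    using exp_cos_rotated_le[OF \<psi>(1,2)] by (simp add: exp_diff divide_simps mult_ac)
  finally show "Re (cnj \<zeta> * exp (v - \<zeta>)) \<le> Re \<zeta>" by (simp add: \<theta>(3))
qed (use assms in \<open>auto intro!: holomorphic_intros continuous_intros\<close>)

section \<open>The integral \<open>ell\<close> and univalence of the dominant\<close>

definition ell_coeff :: "nat \<Rightarrow> complex" where
  "ell_coeff n = (if n = 0 then 0 else 1 / (of_nat n * fact n))"

text \<open>The function \<open>z \<mapsto> \<integral>\<^sub>0\<^sup>z (e\<^sup>t - 1) / t dt\<close>.\<close>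
definition ell :: "complex \<Rightarrow> complex" where
  "ell z = (\<Sum>n. ell_coeff n * z ^ n)"

lemma summable_ell: "summable (\<lambda>n. ell_coeff n * z ^ n)"
proof (rule summable_comparison_test')
  show "summable (\<lambda>n. norm (z ^ n /\<^sub>R fact n))" by (rule summable_norm_exp)
  fix n :: nat
  have "norm (ell_coeff n) \<le> inverse (fact n)"
    by (auto simp: ell_coeff_def norm_divide norm_mult divide_simps)
  then show "norm (ell_coeff n * z ^ n) \<le> norm (z ^ n /\<^sub>R fact n)"
    by (simp add: norm_mult mult_right_mono)
qed

lemma diffs_ell_coeff: "diffs ell_coeff n = 1 / fact (Suc n)"
  by (simp add: diffs_def ell_coeff_def del: fact_Suc of_nat_Suc)

lemma has_field_derivative_ell:
  "(ell has_field_derivative (\<Sum>n. 1 / fact (Suc n) * z ^ n)) (at z)"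
  using termdiffs_strong_converges_everywhere[OF summable_ell, of z]
  unfolding diffs_ell_coeff ell_def .

lemma summable_deriv_ell: "summable (\<lambda>n. 1 / fact (Suc n) * z ^ n :: complex)"
  using termdiff_converges_all[OF summable_ell, of z] unfolding diffs_ell_coeff .

lemma has_field_derivative_ell': "(ell has_field_derivative deriv ell z) (at z)"
  using has_field_derivative_ell DERIV_imp_deriv by metis

lemma ell_holomorphic: "ell holomorphic_on A"
  by (meson has_field_derivative_ell field_differentiable_at_within field_differentiable_def holomorphic_on_def)

lemma ell_0 [simp]: "ell 0 = 0"
  unfolding ell_def by (simp add: powser_zero ell_coeff_def)

lemma mult_deriv_ell: "z * deriv ell z = exp z - 1"
proof -
  have "(\<lambda>n. z * (1 / fact (Suc n) * z ^ n)) sums (z * deriv ell z)"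
    unfolding DERIV_imp_deriv[OF has_field_derivative_ell]
    by (intro sums_mult summable_sums summable_deriv_ell)
  then have "(\<lambda>n. z ^ Suc n /\<^sub>R fact (Suc n)) sums (z * deriv ell z)"
    by (simp add: scaleR_conv_of_real divide_inverse mult_ac)
  then have "(\<lambda>n. z ^ n /\<^sub>R fact n) sums (z * deriv ell z + 1)"
    by (subst (asm) sums_Suc_iff) simp
  then show ?thesis using exp_converges[of z] sums_unique2 by fastforce
qed

lemma fact_ge_2_mult_3_power: "fact (Suc (Suc n)) \<ge> (2 * 3 ^ n :: real)"
proof (induction n)
  case (Suc n)
  have "(2 * 3 ^ Suc n :: real) = 3 * (2 * 3 ^ n)" by simp
  also have "\<dots> \<le> real (Suc (Suc (Suc n))) * fact (Suc (Suc n))"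
    by (intro mult_mono Suc) auto
  finally show ?case by (simp only: fact_Suc)
qed simp

lemma norm_deriv_ell_minus_1:
  assumes "norm z \<le> 21 / 20"
  shows "norm (deriv ell z - 1) \<le> 9 / 10"
proof -
  have "(\<lambda>n. 1 / fact (Suc n) * z ^ n) sums deriv ell z"
    unfolding DERIV_imp_deriv[OF has_field_derivative_ell] by (intro summable_sums summable_deriv_ell)
  then have s: "(\<lambda>n. 1 / fact (Suc (Suc n)) * z ^ Suc n) sums (deriv ell z - 1)"
    using sums_Suc_iff[of "\<lambda>n. 1 / fact (Suc n) * z ^ n" "deriv ell z - 1"] by simp
  have g: "(\<lambda>n. 21 / 40 * (7 / 20) ^ n :: real) sums (21 / 40 * (1 / (1 - 7 / 20)))"
    by (intro sums_mult geometric_sums) simp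
  have "norm (deriv ell z - 1) \<le> 21 / 40 * (1 / (1 - 7 / 20))"
  proof (rule norm_sums_le[OF s g])
    fix n
    have "norm (1 / fact (Suc (Suc n)) * z ^ Suc n) = norm z ^ Suc n / fact (Suc (Suc n))"
      by (simp add: norm_mult norm_divide norm_power del: fact_Suc power_Suc)
    also have "\<dots> \<le> (21 / 20) ^ Suc n / (2 * 3 ^ n)"
      by (intro frac_le power_mono fact_ge_2_mult_3_power assms) auto
    also have "\<dots> = 21 / 40 * ((21 / 20) ^ n / 3 ^ n)" by simp
    also have "\<dots> = 21 / 40 * (7 / 20) ^ n" by (simp flip: power_divide)
    finally show "norm (1 / fact (Suc (Suc n)) * z ^ Suc n) \<le> 21 / 40 * (7 / 20) ^ n" .
  qed
  then show ?thesis by simp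
qed

text \<open>Any bound below pi / 2 serves both uses: injectivity of the exponential on the values of
  \<open>ell\<close>, and the restriction on the imaginary part in
  \<open>disc_fun_exp_scaled\<close>. The first two terms are kept exactly because a crude geometric
  bound would be too large.\<close>

lemma norm_ell_less:
  assumes "norm z \<le> 21 / 20"
  shows "norm (ell z) < 3 / 2"
proof -
  define a where "a = (\<lambda>n. ell_coeff n * z ^ n)"
  have "a sums ell z" unfolding a_def ell_def by (rule summable_sums[OF summable_ell])
  then have s: "(\<lambda>n. a (n + 3)) sums (ell z - (\<Sum>n<3. a n))" by (rule sums_split_initial_segment)
  have g: "(\<lambda>n. 9261 / 144000 * (21 / 80) ^ n :: real) sums (9261 / 144000 * (1 / (1 - 21 / 80)))"
    by (intro sums_mult geometric_sums) simp
  have fg: "real (n + 3) * fact (n + 3) \<ge> 18 * 4 ^ n" for n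
  proof (induction n)
    case 0 then show ?case by (simp add: fact_numeral)
  next
    case (Suc n)
    have "18 * 4 ^ Suc n = 4 * (18 * 4 ^ n :: real)" by simp
    also have "\<dots> \<le> real (n + 4) * (real (n + 3) * fact (n + 3))" by (intro mult_mono Suc) auto
    also have "\<dots> \<le> real (n + 4) * (real (n + 4) * fact (n + 3))"
      by (intro mult_left_mono mult_right_mono) auto
    also have "\<dots> = real (Suc n + 3) * fact (Suc n + 3)"
      using fact_Suc[of "n + 3", where ?'a = real] by (simp add: add.commute numeral_eq_Suc)
    finally show ?case .
  qed
  have "norm (ell z - (\<Sum>n<3. a n)) \<le> 9261 / 144000 * (1 / (1 - 21 / 80))"
  proof (rule norm_sums_le[OF s g])
    fix n
    have "norm (a (n + 3)) = norm z ^ (n + 3) / (real (n + 3) * fact (n + 3))"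
      by (simp add: a_def ell_coeff_def norm_mult norm_divide norm_power del: of_nat_add)
    also have "\<dots> \<le> (21 / 20) ^ (n + 3) / (18 * 4 ^ n)"
      by (intro frac_le power_mono fg assms) auto
    also have "\<dots> = 9261 / 144000 * (21 / 80) ^ n"
      by (simp add: power_divide power_add) (simp flip: power_mult_distrib)
    finally show "norm (a (n + 3)) \<le> 9261 / 144000 * (21 / 80) ^ n" .
  qed
  moreover have "(\<Sum>n<3. a n) = z + z\<^sup>2 / 4"
    by (simp add: a_def ell_coeff_def numeral_3_eq_3 power2_eq_square)
  moreover have "norm (z + z\<^sup>2 / 4) \<le> 21 / 20 + (21 / 20)\<^sup>2 / 4"
  proof -
    have "norm (z + z\<^sup>2 / 4) \<le> norm z + (norm z)\<^sup>2 / 4"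
      using norm_triangle_ineq[of z "z\<^sup>2 / 4"] by (simp add: norm_divide norm_power)
    also have "\<dots> \<le> 21 / 20 + (21 / 20)\<^sup>2 / 4" by (intro add_mono divide_right_mono power_mono assms) auto
    finally show ?thesis .
  qed
  moreover have "norm (ell z) \<le> norm (ell z - (z + z\<^sup>2 / 4)) + norm (z + z\<^sup>2 / 4)"
    using norm_triangle_ineq[of "ell z - (z + z\<^sup>2 / 4)" "z + z\<^sup>2 / 4"] by simp
  ultimately show ?thesis by (simp add: power2_eq_square)
qed

text \<open>The exponential is injective on the strip containing the scaled values of
  \<open>ell\<close>, and \<open>ell\<close> is injective because \<open>ell z - z\<close> has
  Lipschitz constant 9/10 < 1 on this disc of radius greater than 1.\<close>

lemma exp_ell_univalent:
  assumes "0 < \<kappa>" "\<kappa> \<le> 1"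
  shows "inj_on (\<lambda>z. exp (- of_real \<kappa> * ell z)) (ball 0 (21 / 20))"
proof (rule inj_onI)
  fix z w assume zw: "z \<in> ball 0 (21 / 20)" "w \<in> ball 0 (21 / 20)"
    and eq: "exp (- of_real \<kappa> * ell z) = exp (- of_real \<kappa> * ell w)"
  have im: "\<bar>Im (- of_real \<kappa> * ell z)\<bar> < 3 / 2" if "z \<in> ball 0 (21 / 20)" for z
  proof -
    have "\<bar>Im (- of_real \<kappa> * ell z)\<bar> \<le> norm (- of_real \<kappa> * ell z)" by (rule abs_Im_le_cmod)
    also have "\<dots> \<le> 1 * norm (ell z)" using assms by (simp add: norm_mult mult_left_le_one_le)
    also have "\<dots> < 3 / 2" using norm_ell_less[of z] that by simp
    finally show ?thesis .
  qed
  have "- of_real \<kappa> * ell z = - of_real \<kappa> * ell w"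
    by (rule exp_complex_eqI[OF _ eq]) (use im[OF zw(1)] im[OF zw(2)] pi_gt3 in linarith)
  then have "ell z = ell w" using assms by simp
  have "norm ((ell z - z) - (ell w - w)) \<le> 9 / 10 * norm (z - w)"
  proof (rule field_differentiable_bound[OF convex_ball _ _ zw])
    fix x :: complex assume "x \<in> ball 0 (21 / 20)"
    then show "norm (deriv ell x - 1) \<le> 9 / 10" by (intro norm_deriv_ell_minus_1) simp
    show "((\<lambda>z. ell z - z) has_field_derivative deriv ell x - 1) (at x within ball 0 (21 / 20))"
      by (rule has_field_derivative_at_within[OF DERIV_diff[OF has_field_derivative_ell' DERIV_ident]])
  qed
  moreover have "(ell z - z) - (ell w - w) = - (z - w)" unfolding \<open>ell z = ell w\<close> by algebra
  ultimately have "norm (z - w) \<le> 9 / 10 * norm (z - w)" by (simp only: norm_minus_cancel)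
  then have "norm (z - w) = 0" using norm_ge_zero[of "z - w"] by linarith
  then show "z = w" by simp
qed

subsection \<open>Integer polynomials on the unit square\<close>

fun peval :: "int list \<Rightarrow> real \<Rightarrow> real" where
  "peval [] x = 0"
| "peval (c # cs) x = of_int c + x * peval cs x"

fun padd :: "int list \<Rightarrow> int list \<Rightarrow> int list" where
  "padd [] ds = ds"
| "padd cs [] = cs"
| "padd (c # cs) (d # ds) = (c + d) # padd cs ds"

definition pscale :: "int \<Rightarrow> int list \<Rightarrow> int list" where
  "pscale c = map (\<lambda>d. c * d)"

fun pmul :: "int list \<Rightarrow> int list \<Rightarrow> int list" where
  "pmul [] ds = []"
| "pmul (c # cs) ds = padd (pscale c ds) (0 # pmul cs ds)"

lemma peval_padd: "peval (padd cs ds) x = peval cs x + peval ds x"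
  by (induction cs ds rule: padd.induct) (auto simp: algebra_simps)

lemma peval_pscale: "peval (pscale c ds) x = of_int c * peval ds x"
  by (induction ds) (auto simp: pscale_def algebra_simps)

lemma peval_pmul: "peval (pmul cs ds) x = peval cs x * peval ds x"
  by (induction cs) (auto simp: peval_padd peval_pscale algebra_simps)

fun pshift :: "int list \<Rightarrow> int list" where
  "pshift [] = []"
| "pshift (c # cs) = (let s = pshift cs in padd [c] (padd s (0 # s)))"

lemma peval_pshift: "peval (pshift cs) x = peval cs (x + 1)"
  by (induction cs) (auto simp: peval_padd Let_def algebra_simps)

text \<open>The factor \<open>2 ^ d\<close> keeps the coefficients integral and leaves signs
  unchanged. Subtraction on \<open>nat\<close> truncates, so the scaling is uniform only for lists
  of length at most \<open>Suc d\<close>; hence the length tests in \<open>pnonneg\<close>.\<close>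

fun phalve :: "nat \<Rightarrow> int list \<Rightarrow> int list" where
  "phalve d [] = []"
| "phalve d (c # cs) = 2 ^ d * c # phalve (d - 1) cs"

lemma peval_phalve: "length cs \<le> Suc d \<Longrightarrow> peval (phalve d cs) x = 2 ^ d * peval cs (x / 2)"
proof (induction cs arbitrary: d)
  case (Cons c cs)
  then show ?case by (cases d) (auto simp: algebra_simps)
qed simp

text \<open>Horner's scheme for a lower bound on [0, 1]: multiplying a quantity that is at least l
  by such an x leaves it at least \<open>min 0 l\<close>.\<close>

fun plow :: "int list \<Rightarrow> int" where
  "plow [] = 0"
| "plow (c # cs) = c + min 0 (plow cs)"

lemma mult_ge_min_0:
  fixes x l y :: real
  assumes "0 \<le> x" "x \<le> 1" "l \<le> y"
  shows "min 0 l \<le> x * y"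
proof (cases "y \<ge> 0")
  case True
  then show ?thesis using assms by (simp add: min.coboundedI1)
next
  case False
  then have "y \<le> x * y" using assms(1,2) mult_right_mono_neg[of x 1 y] by simp
  then show ?thesis using assms(3) by (simp add: min.coboundedI2)
qed

lemma plow_le: "0 \<le> x \<Longrightarrow> x \<le> 1 \<Longrightarrow> of_int (plow cs) \<le> peval cs x"
proof (induction cs)
  case (Cons c cs)
  then show ?case using mult_ge_min_0[of x "of_int (plow cs)" "peval cs x"] by (simp add: of_int_min)
qed simp

text \<open>Bivariate polynomials are lists (powers of \<open>t\<close>) of lists (powers of \<open>s\<close>).\<close>
fun peval2 :: "int list list \<Rightarrow> real \<Rightarrow> real \<Rightarrow> real" where
  "peval2 [] s t = 0"
| "peval2 (c # cs) s t = peval c s + t * peval2 cs s t"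

fun padd2 :: "int list list \<Rightarrow> int list list \<Rightarrow> int list list" where
  "padd2 [] ds = ds"
| "padd2 cs [] = cs"
| "padd2 (c # cs) (d # ds) = padd c d # padd2 cs ds"

lemma peval2_padd2: "peval2 (padd2 cs ds) s t = peval2 cs s t + peval2 ds s t"
  by (induction cs ds rule: padd2.induct) (auto simp: peval_padd algebra_simps)

fun pshift2 :: "int list list \<Rightarrow> int list list" where
  "pshift2 [] = []"
| "pshift2 (c # cs) = (let s = pshift2 cs in padd2 [c] (padd2 s ([] # s)))"

lemma peval2_pshift2: "peval2 (pshift2 cs) s t = peval2 cs s (t + 1)"
  by (induction cs) (auto simp: peval2_padd2 Let_def algebra_simps)

lemma peval2_map_pshift: "peval2 (map pshift cs) s t = peval2 cs (s + 1) t"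
  by (induction cs) (auto simp: peval_pshift)

fun phalve2 :: "nat \<Rightarrow> int list list \<Rightarrow> int list list" where
  "phalve2 d [] = []"
| "phalve2 d (c # cs) = pscale (2 ^ d) c # phalve2 (d - 1) cs"

lemma peval2_phalve2: "length cs \<le> Suc d \<Longrightarrow> peval2 (phalve2 d cs) s t = 2 ^ d * peval2 cs s (t / 2)"
proof (induction cs arbitrary: d)
  case (Cons c cs)
  then show ?case by (cases d) (auto simp: peval_pscale algebra_simps)
qed simp

lemma peval2_map_phalve:
  "list_all (\<lambda>c. length c \<le> Suc d) cs \<Longrightarrow> peval2 (map (phalve d) cs) s t = 2 ^ d * peval2 cs (s / 2) t"
  by (induction cs) (auto simp: peval_phalve algebra_simps)

fun plow2 :: "int list list \<Rightarrow> int" where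
  "plow2 [] = 0"
| "plow2 (c # cs) = plow c + min 0 (plow2 cs)"

lemma plow2_le:
  "0 \<le> s \<Longrightarrow> s \<le> 1 \<Longrightarrow> 0 \<le> t \<Longrightarrow> t \<le> 1 \<Longrightarrow> of_int (plow2 cs) \<le> peval2 cs s t"
proof (induction cs)
  case (Cons c cs)
  then show ?case
    using mult_ge_min_0[of t "of_int (plow2 cs)" "peval2 cs s t"] plow_le[of s c]
    by (simp add: of_int_min)
qed simp

text \<open>Nonnegativity on the unit square by bisection; the list of Booleans tells in which variable
  to split the square at each level.\<close>
fun pnonneg :: "nat \<Rightarrow> nat \<Rightarrow> bool list \<Rightarrow> int list list \<Rightarrow> bool" where
  "pnonneg d e [] cs = (0 \<le> plow2 cs)"
| "pnonneg d e (b # bs) cs = (if 0 \<le> plow2 cs then True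
     else if b then length cs \<le> Suc e \<and>
       (let h = phalve2 e cs in pnonneg d e bs h \<and> pnonneg d e bs (pshift2 h))
     else list_all (\<lambda>c. length c \<le> Suc d) cs \<and>
       (let h = map (phalve d) cs in pnonneg d e bs h \<and> pnonneg d e bs (map pshift h)))"

lemma pnonneg_sound:
  "pnonneg d e bs cs \<Longrightarrow> 0 \<le> s \<Longrightarrow> s \<le> 1 \<Longrightarrow> 0 \<le> t \<Longrightarrow> t \<le> 1 \<Longrightarrow> 0 \<le> peval2 cs s t"
proof (induction bs arbitrary: cs s t)
  case Nil
  then have "0 \<le> real_of_int (plow2 cs)" by simp
  also have "\<dots> \<le> peval2 cs s t" using Nil by (intro plow2_le) auto
  finally show ?case .
next
  case (Cons b bs)
  show ?case
  proof (cases "0 \<le> plow2 cs")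
    case True
    then have "0 \<le> real_of_int (plow2 cs)" by simp
    also have "\<dots> \<le> peval2 cs s t" using Cons.prems by (intro plow2_le) auto
    finally show ?thesis .
  next
    case False
    show ?thesis
    proof (cases b)
      case True
      define h where "h = phalve2 e cs"
      have h: "length cs \<le> Suc e" "pnonneg d e bs h" "pnonneg d e bs (pshift2 h)"
        using Cons.prems(1) False True by (auto simp: Let_def h_def)
      have eq: "peval2 h s (2 * t) = 2 ^ e * peval2 cs s t" using peval2_phalve2[OF h(1)] by (simp add: h_def)
      have "0 \<le> peval2 h s (2 * t)"
      proof (cases "2 * t \<le> 1")
        case True
        then show ?thesis using Cons.IH[OF h(2)] Cons.prems by simp
      next
        case False
        then have "0 \<le> peval2 (pshift2 h) s (2 * t - 1)" using Cons.IH[OF h(3)] Cons.prems by simp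
        then show ?thesis by (simp add: peval2_pshift2)
      qed
      then have "2 ^ e * 0 \<le> 2 ^ e * peval2 cs s t" unfolding eq by simp
      then show ?thesis by (rule mult_left_le_imp_le) simp
    next
      case b: False
      define h where "h = map (phalve d) cs"
      have h: "list_all (\<lambda>c. length c \<le> Suc d) cs" "pnonneg d e bs h" "pnonneg d e bs (map pshift h)"
        using Cons.prems(1) False b by (auto simp: Let_def h_def)
      have eq: "peval2 h (2 * s) t = 2 ^ d * peval2 cs s t" using peval2_map_phalve[OF h(1)] by (simp add: h_def)
      have "0 \<le> peval2 h (2 * s) t"
      proof (cases "2 * s \<le> 1")
        case True
        then show ?thesis using Cons.IH[OF h(2)] Cons.prems by simp
      next
        case False
        then have "0 \<le> peval2 (map pshift h) (2 * s - 1) t" using Cons.IH[OF h(3)] Cons.prems by simp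
        then show ?thesis by (simp add: peval2_map_pshift)
      qed
      then have "2 ^ d * 0 \<le> 2 ^ d * peval2 cs s t" unfolding eq by simp
      then show ?thesis by (rule mult_left_le_imp_le) simp
    qed
  qed
qed

definition pnonneg1 :: "nat \<Rightarrow> int list \<Rightarrow> bool" where
  "pnonneg1 n cs = pnonneg 0 (length cs) (replicate n True) (map (\<lambda>c. [c]) cs)"

lemma pnonneg1_sound:
  assumes "pnonneg1 n cs" "0 \<le> x" "x \<le> 1"
  shows "0 \<le> peval cs x"
proof -
  have "peval2 (map (\<lambda>c. [c]) cs) 0 x = peval cs x" for cs by (induction cs) auto
  then show ?thesis using pnonneg_sound[OF assms(1)[unfolded pnonneg1_def], of 0 x] assms by simp
qed

text \<open>\<open>X\<close> represents \<open>Re \<zeta>\<close> for \<open>\<zeta>\<close> on the unit circle; \<open>p\<close> and \<open>q\<close> are consecutive terms of a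
  sequence satisfying the three-term recurrence of \<open>\<zeta> ^ n\<close>.\<close>
fun pcheb :: "int list \<Rightarrow> int list list \<Rightarrow> int list \<Rightarrow> int list \<Rightarrow> int list list" where
  "pcheb X [] p q = []"
| "pcheb X (r # rs) p q = padd2 (map (\<lambda>c. pscale c r) p)
     (pcheb X rs q (padd (pmul (pscale 2 X) q) (pscale (-1) p)))"

lemma peval2_outer: "peval2 (map (\<lambda>c. pscale c r) p) s t = peval r s * peval p t"
  by (induction p) (auto simp: peval_pscale algebra_simps)

lemma peval2_pcheb:
  fixes f :: "nat \<Rightarrow> real"
  assumes "\<And>n. f (Suc (Suc n)) = 2 * peval X t * f (Suc n) - f n"
  shows "peval p t = f n \<Longrightarrow> peval q t = f (Suc n) \<Longrightarrow>
    peval2 (pcheb X rs p q) s t = (\<Sum>j<length rs. peval (rs ! j) s * f (n + j))"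
proof (induction rs arbitrary: p q n)
  case (Cons r rs)
  have "peval2 (pcheb X rs q (padd (pmul (pscale 2 X) q) (pscale (-1) p))) s t
      = (\<Sum>j<length rs. peval (rs ! j) s * f (Suc n + j))"
    by (rule Cons.IH) (use Cons.prems assms in \<open>auto simp: peval_padd peval_pmul peval_pscale\<close>)
  then show ?case
    using Cons.prems by (simp add: peval2_padd2 peval2_outer sum.lessThan_Suc_shift del: sum.lessThan_Suc)
qed simp

subsection \<open>The choice of the exponent\<close>

definition pade_num :: "real \<Rightarrow> real" where
  "pade_num x = 120 + 60 * x + 12 * x ^ 2 + x ^ 3"

definition pade_den :: "real \<Rightarrow> real" where
  "pade_den x = 120 - 60 * x + 12 * x ^ 2 - x ^ 3"

lemma pade_den_pos:
  assumes "0 \<le> x" "x \<le> 5 / 2"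
  shows "pade_den x > 0"
proof -
  have "pade_den x = (5 / 2 - x) * (x ^ 2 + 30) + 19 / 2 * x ^ 2 - 30 * x + 45"
    by (simp add: pade_den_def algebra_simps power2_eq_square power3_eq_cube)
  moreover have "19 / 2 * x ^ 2 - 30 * x + 45 = 19 / 2 * (x - 30 / 19) ^ 2 + 405 / 19"
    by (simp add: algebra_simps power2_eq_square)
  moreover have "(5 / 2 - x) * (x ^ 2 + 30) \<ge> 0" using assms by (intro mult_nonneg_nonneg) auto
  ultimately show ?thesis by (smt (verit) zero_le_power2 divide_pos_pos mult_nonneg_nonneg)
qed

lemma pade_num_pos: "0 \<le> x \<Longrightarrow> pade_num x > 0"
  by (simp add: pade_num_def add_pos_nonneg)

text \<open>The quotient agrees with the exponential through order 6, so the numerator of the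
  derivative of the logarithmic error is the single monomial \<open>t ^ 6\<close>, whose sign is
  evident.\<close>

lemma exp_less_pade:
  assumes "0 < x" "x \<le> 5 / 2"
  shows "exp x * pade_den x < pade_num x"
proof -
  define f where "f = (\<lambda>x. ln (pade_num x) - ln (pade_den x) - x)"
  have "f 0 < f x"
  proof (rule DERIV_pos_imp_increasing_open[OF assms(1)])
    fix t assume t: "0 < t" "t < x"
    have p: "pade_num t > 0" "pade_den t > 0"
      using pade_num_pos[of t] pade_den_pos[of t] t assms by auto
    have dn: "(pade_num has_real_derivative (60 + 24 * t + 3 * t ^ 2)) (at t)"
      unfolding pade_num_def by (auto intro!: derivative_eq_intros)
    have dd: "(pade_den has_real_derivative (- 60 + 24 * t - 3 * t ^ 2)) (at t)"
      unfolding pade_den_def by (auto intro!: derivative_eq_intros)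
    have df: "(f has_real_derivative ((60 + 24 * t + 3 * t ^ 2) / pade_num t
        - (- 60 + 24 * t - 3 * t ^ 2) / pade_den t - 1)) (at t)"
      unfolding f_def using p by (auto intro!: derivative_eq_intros dn dd)
    have "(60 + 24 * t + 3 * t ^ 2) / pade_num t - (- 60 + 24 * t - 3 * t ^ 2) / pade_den t - 1
        = t ^ 6 / (pade_num t * pade_den t)"
    proof -
      have "(60 + 24 * t + 3 * t ^ 2) * pade_den t - (- 60 + 24 * t - 3 * t ^ 2) * pade_num t
          - pade_num t * pade_den t = t ^ 6"
        unfolding pade_num_def pade_den_def by algebra
      then show ?thesis using p by (simp add: field_simps)
    qed
    also have "\<dots> > 0" using p t by simp
    finally show "\<exists>y. (f has_real_derivative y) (at t) \<and> 0 < y" using df by blast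
  next
    have p: "pade_num t \<noteq> 0 \<and> pade_den t \<noteq> 0" if "t \<in> {0..x}" for t
      using pade_num_pos[of t] pade_den_pos[of t] that assms by force
    have "continuous_on {0..x} pade_num" "continuous_on {0..x} pade_den"
      unfolding pade_num_def pade_den_def by (intro continuous_intros)+
    then show "continuous_on {0..x} f"
      unfolding f_def using p by (intro continuous_intros) auto
  qed
  moreover have "f 0 = 0" by (simp add: f_def pade_num_def pade_den_def)
  ultimately have "x + ln (pade_den x) < ln (pade_num x)" by (simp add: f_def)
  then have "exp (x + ln (pade_den x)) < pade_num x"
    using pade_num_pos[of x] assms by (metis exp_less_mono exp_ln less_imp_le)
  then show ?thesis using pade_den_pos[of x] assms by (simp add: exp_add)
qed

text \<open>Found numerically: slightly below the minimum over the unit circle of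
  \<open>Re (conj \<zeta> e\<^sup>-\<^sup>\<zeta> (exp (\<kappa> L(\<zeta>)) - 1)) / (\<kappa> Re (conj \<zeta> (1 - e\<^sup>-\<^sup>\<zeta>)))\<close> for \<open>11 / 25 \<le> \<kappa> \<le> 1\<close>.\<close>
definition rho :: "real \<Rightarrow> real" where
  "rho \<kappa> = 389 / 500 + 49 / 100 * \<kappa> - 41 / 100 * \<kappa> ^ 2"

text \<open>With \<open>a = (1 - \<kappa>) / (\<kappa> rho \<kappa>)\<close> and the Pade approximants \<open>Y1\<close> of \<open>1 / (1 - e\<^sup>-\<^sup>x)\<close> and \<open>Y2\<close> of
  \<open>1 / (e\<^sup>z - 1)\<close>, the next two functions are the denominator-free forms of
  \<open>2 (Y1 - 1) (3.718 Y1 - a) - (Y1 + Y2)\<close> and \<open>2 (Y2 + 1) (1.718 Y2 - a) - (Y1 + Y2)\<close>.\<close>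
definition ineq1 :: "real \<Rightarrow> real \<Rightarrow> real \<Rightarrow> real" where
  "ineq1 x z \<kappa> = (let d1 = pade_num x - pade_den x; d2 = pade_num z - pade_den z in
     2 * (pade_num x - d1) * (3.718 * pade_num x * (\<kappa> * rho \<kappa>) - (1 - \<kappa>) * d1) * d2
     - (pade_num x * d2 + pade_den z * d1) * d1 * (\<kappa> * rho \<kappa>))"

definition ineq2 :: "real \<Rightarrow> real \<Rightarrow> real \<Rightarrow> real" where
  "ineq2 x z \<kappa> = (let d1 = pade_num x - pade_den x; d2 = pade_num z - pade_den z in
     2 * (pade_den z + d2) * (1.718 * pade_den z * (\<kappa> * rho \<kappa>) - (1 - \<kappa>) * d2) * d1
     - (pade_num x * d2 + pade_den z * d1) * d2 * (\<kappa> * rho \<kappa>))"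

text \<open>Exponents l are given in thousandths and \<kappa> is scaled by 1000, so \<open>X\<close>
  stands for 10^6 times the argument and 10^18 clears all denominators. The sign \<open>s\<close>
  selects the numerator or the denominator.\<close>

definition pade_list :: "int \<Rightarrow> int list \<Rightarrow> int list" where
  "pade_list s X = padd [120 * 10 ^ 18] (padd (pscale (s * 60 * 10 ^ 12) X)
     (padd (pscale (12 * 10 ^ 6) (pmul X X)) (pscale s (pmul X (pmul X X)))))"

definition rho_list :: "int list \<Rightarrow> int list" where
  "rho_list K = padd [778 * 10 ^ 6] (padd (pscale (490 * 10 ^ 3) K) (pscale (- 410) (pmul K K)))"

definition ineq1_list :: "int \<Rightarrow> int \<Rightarrow> int list \<Rightarrow> int list" where
  "ineq1_list l1 l2 K = (let N1 = pade_list 1 (pscale l1 K); N2 = pade_list (-1) (pscale l2 K);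
     d1 = padd N1 (pscale (-1) (pade_list (-1) (pscale l1 K)));
     d2 = padd (pade_list 1 (pscale l2 K)) (pscale (-1) N2); kr = pmul K (rho_list K);
     m = pscale (10 ^ 9) (padd [1000] (pscale (-1) K)) in
     padd (pmul (pmul (pscale 2 (padd N1 (pscale (-1) d1)))
         (padd (pscale 3718 (pmul N1 kr)) (pscale (-1000) (pmul m d1)))) d2)
       (pscale (-1000) (pmul (padd (pmul N1 d2) (pmul N2 d1)) (pmul d1 kr))))"

definition ineq2_list :: "int \<Rightarrow> int \<Rightarrow> int list \<Rightarrow> int list" where
  "ineq2_list l1 l2 K = (let N1 = pade_list 1 (pscale l1 K); N2 = pade_list (-1) (pscale l2 K);
     d1 = padd N1 (pscale (-1) (pade_list (-1) (pscale l1 K)));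
     d2 = padd (pade_list 1 (pscale l2 K)) (pscale (-1) N2); kr = pmul K (rho_list K);
     m = pscale (10 ^ 9) (padd [1000] (pscale (-1) K)) in
     padd (pmul (pmul (pscale 2 (padd N2 d2))
         (padd (pscale 1718 (pmul N2 kr)) (pscale (-1000) (pmul m d2)))) d1)
       (pscale (-1000) (pmul (padd (pmul N1 d2) (pmul N2 d1)) (pmul d2 kr))))"

lemma peval_pade_list:
  assumes "peval X s = 10 ^ 6 * x"
  shows "peval (pade_list 1 X) s = 10 ^ 18 * pade_num x" "peval (pade_list (-1) X) s = 10 ^ 18 * pade_den x"
  unfolding pade_list_def peval_padd peval_pscale peval_pmul assms pade_num_def pade_den_def
  by (simp_all add: algebra_simps power2_eq_square power3_eq_cube)

lemma peval_ineq_list: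
  assumes K: "peval K s = 1000 * \<kappa>"
  shows "peval (ineq1_list l1 l2 K) s = 10 ^ 69 * ineq1 (of_int l1 / 1000 * \<kappa>) (of_int l2 / 1000 * \<kappa>) \<kappa>"
    and "peval (ineq2_list l1 l2 K) s = 10 ^ 69 * ineq2 (of_int l1 / 1000 * \<kappa>) (of_int l2 / 1000 * \<kappa>) \<kappa>"
proof -
  have X: "peval (pscale l K) s = 10 ^ 6 * (of_int l / 1000 * \<kappa>)" for l
    by (simp add: peval_pscale K)
  have R: "peval (rho_list K) s = 10 ^ 9 * rho \<kappa>"
    unfolding rho_list_def peval_padd peval_pscale peval_pmul K rho_def by (simp add: algebra_simps power2_eq_square)
  note p = peval_padd peval_pscale peval_pmul peval_pade_list[OF X] R K Let_def
  show "peval (ineq1_list l1 l2 K) s = 10 ^ 69 * ineq1 (of_int l1 / 1000 * \<kappa>) (of_int l2 / 1000 * \<kappa>) \<kappa>"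
    unfolding ineq1_list_def ineq1_def p by (simp add: field_simps)
  show "peval (ineq2_list l1 l2 K) s = 10 ^ 69 * ineq2 (of_int l1 / 1000 * \<kappa>) (of_int l2 / 1000 * \<kappa>) \<kappa>"
    unfolding ineq2_list_def ineq2_def p by (simp add: field_simps)
qed

lemma ineq_nonneg:
  assumes "pnonneg1 9 (ineq1_list l1 l2 [k, w])" "pnonneg1 9 (ineq2_list l1 l2 [k, w])"
    and "w > 0" and \<kappa>: "of_int k \<le> 1000 * \<kappa>" "1000 * \<kappa> \<le> of_int (k + w)"
  shows "ineq1 (of_int l1 / 1000 * \<kappa>) (of_int l2 / 1000 * \<kappa>) \<kappa> \<ge> 0"
    and "ineq2 (of_int l1 / 1000 * \<kappa>) (of_int l2 / 1000 * \<kappa>) \<kappa> \<ge> 0"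
proof -
  define s where "s = (1000 * \<kappa> - of_int k) / of_int w"
  have s: "0 \<le> s" "s \<le> 1" using assms by (auto simp: s_def)
  have K: "peval [k, w] s = 1000 * \<kappa>" using \<open>w > 0\<close> by (simp add: s_def)
  show "ineq1 (of_int l1 / 1000 * \<kappa>) (of_int l2 / 1000 * \<kappa>) \<kappa> \<ge> 0"
    using pnonneg1_sound[OF assms(1) s] unfolding peval_ineq_list[OF K] by simp
  show "ineq2 (of_int l1 / 1000 * \<kappa>) (of_int l2 / 1000 * \<kappa>) \<kappa> \<ge> 0"
    using pnonneg1_sound[OF assms(2) s] unfolding peval_ineq_list[OF K] by simp
qed

text \<open>A list \<open>[k, w]\<close> stands for \<open>1000 * \<kappa>\<close> running from k to
  k + w, so the three rows cover \<kappa> from 0.44 to 1, each with its own pair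
  \<open>(l1, l2)\<close>.\<close>

lemma check_ineq_lists:
  "pnonneg1 9 (ineq1_list 1911 1382 [951, 49])" "pnonneg1 9 (ineq2_list 1911 1382 [951, 49])"
  "pnonneg1 9 (ineq1_list 1978 1377 [880, 71])" "pnonneg1 9 (ineq2_list 1978 1377 [880, 71])"
  "pnonneg1 9 (ineq1_list 2070 1372 [440, 440])" "pnonneg1 9 (ineq2_list 2070 1372 [440, 440])"
  by code_simp+

lemma sum_le_exp:
  assumes "0 \<le> (x::real)"
  shows "(\<Sum>k<n. x ^ k / fact k) \<le> exp x"
proof -
  have "(\<lambda>k. x ^ k / fact k) sums exp x"
    using exp_converges[of x] by (simp add: divide_inverse mult.commute)
  then show ?thesis
    using assms by (metis (no_types, lifting) sums_summable sums_unique sum_le_suminf divide_nonneg_pos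
        fact_gt_zero finite_lessThan zero_le_power)
qed

lemma exp_1_ge: "exp 1 \<ge> (2.718 :: real)"
proof -
  have "(2.718 :: real) \<le> (\<Sum>k<9. 1 ^ k / fact k)" by (simp add: eval_nat_numeral)
  then show ?thesis using sum_le_exp[of 1 9] by linarith
qed

text \<open>The assumptions say \<open>y2 \<ge> \<phi>\<^sub>1 y1\<close> and \<open>y1 \<ge> \<phi>\<^sub>2 y2\<close> for two convex quadratic functions, with
  the reverse inequalities at \<open>(Y1, Y2)\<close>.  Both functions have slope at least \<open>1\<close> there, so beyond that
  point the two constraints contradict each other.\<close>
lemma below_crossing_point:
  fixes y1 y2 Y1 Y2 E1 E2 a :: real
  assumes pos: "Y1 > 1" "Y2 > 0" and E: "E1 \<ge> 1" "E2 \<ge> 1"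
    and A1: "2 * (y1 - 1) * (E1 * y1 - a) \<le> y1 + y2" and A2: "2 * (y2 + 1) * (E2 * y2 - a) \<le> y1 + y2"
    and B1: "Y1 + Y2 \<le> 2 * (Y1 - 1) * (E1 * Y1 - a)" and B2: "Y1 + Y2 \<le> 2 * (Y2 + 1) * (E2 * Y2 - a)"
  shows "y1 \<le> Y1 \<and> y2 \<le> Y2"
proof -
  have slope1: "2 * (E1 * Y1 - a) + 2 * E1 * (Y1 - 1) - 1 \<ge> 1"
  proof -
    define u where "u = Y1 - 1"
    have u: "u > 0" using pos by (simp add: u_def)
    have "(1 + u) / u \<le> 2 * (E1 * Y1 - a)"
      using B1 pos u by (simp add: u_def field_simps)
    then have "1 / u + 1 \<le> 2 * (E1 * Y1 - a)" using u by (simp add: field_simps)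
    moreover have "1 / u + 2 * u \<ge> 1"
    proof (cases "u \<le> 1")
      case True
      then have "1 / u \<ge> 1" using u by simp
      then show ?thesis using u by linarith
    next
      case False
      have "1 / u > 0" using u by simp
      then show ?thesis using False by linarith
    qed
    moreover have "E1 * u \<ge> u" using E u by simp
    ultimately show ?thesis by (simp add: u_def[symmetric])
  qed
  have slope2: "2 * (E2 * Y2 - a) + 2 * E2 * (Y2 + 1) - 1 > 1"
  proof -
    have eq: "2 * (E2 * Y2 - a) * (Y2 + 1) = 2 * (Y2 + 1) * (E2 * Y2 - a)" by (simp add: algebra_simps)
    have "1 * (Y2 + 1) < 2 * (E2 * Y2 - a) * (Y2 + 1)"
      unfolding eq by (rule less_le_trans[OF _ B2]) (use pos in simp)
    then have "1 < 2 * (E2 * Y2 - a)" by (rule mult_right_less_imp_less) (use pos in simp)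
    moreover have "E2 * (Y2 + 1) \<ge> Y2 + 1" using E pos by simp
    ultimately show ?thesis using pos by linarith
  qed
  have aux1: "p \<le> z - Z" if "p * 1 \<le> q" "0 \<le> r" "F - y - (F0 - Y) = q + r" "F \<le> y + z" "Y + Z \<le> F0"
    for p q r F F0 y z Y Z :: real
    using that by linarith
  have aux2: "p < z - Z" if "p * 1 < q" "0 \<le> r" "F - y - (F0 - Y) = q + r" "F \<le> z + y" "Z + Y \<le> F0"
    for p q r F F0 y z Y Z :: real
    using that by linarith
  have up1: "y1 - Y1 \<le> y2 - Y2" if "y1 > Y1"
  proof (rule aux1[OF _ _ _ A1 B1])
    show "(y1 - Y1) * 1 \<le> (y1 - Y1) * (2 * (E1 * Y1 - a) + 2 * E1 * (Y1 - 1) - 1)"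
      using slope1 that by (intro mult_left_mono) auto
    show "0 \<le> 2 * E1 * (y1 - Y1) ^ 2" using E by simp
    show "2 * (y1 - 1) * (E1 * y1 - a) - y1 - (2 * (Y1 - 1) * (E1 * Y1 - a) - Y1)
        = (y1 - Y1) * (2 * (E1 * Y1 - a) + 2 * E1 * (Y1 - 1) - 1) + 2 * E1 * (y1 - Y1) ^ 2"
      by algebra
  qed
  have up2: "y2 - Y2 < y1 - Y1" if "y2 > Y2"
  proof (rule aux2[OF _ _ _ A2 B2])
    show "(y2 - Y2) * 1 < (y2 - Y2) * (2 * (E2 * Y2 - a) + 2 * E2 * (Y2 + 1) - 1)"
      using slope2 that by (intro mult_strict_left_mono) auto
    show "0 \<le> 2 * E2 * (y2 - Y2) ^ 2" using E by simp
    show "2 * (y2 + 1) * (E2 * y2 - a) - y2 - (2 * (Y2 + 1) * (E2 * Y2 - a) - Y2)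
        = (y2 - Y2) * (2 * (E2 * Y2 - a) + 2 * E2 * (Y2 + 1) - 1) + 2 * E2 * (y2 - Y2) ^ 2"
      by algebra
  qed
  show ?thesis using up1 up2 by force
qed

lemma rho_bounds:
  assumes "11 / 25 \<le> \<kappa>" "\<kappa> \<le> 1"
  shows "rho \<kappa> > 4 / 5" "rho \<kappa> < 1"
proof -
  have "rho \<kappa> - 4 / 5 = (1 - \<kappa>) * (41 / 100 * \<kappa> - 8 / 100) + 58 / 1000"
    by (simp add: rho_def field_simps power2_eq_square)
  moreover have "(1 - \<kappa>) * (41 / 100 * \<kappa> - 8 / 100) \<ge> 0" using assms by (intro mult_nonneg_nonneg) auto
  ultimately show "rho \<kappa> > 4 / 5" by linarith
  have "1 - rho \<kappa> = 41 / 100 * (\<kappa> - 49 / 82) ^ 2 + 222 / 1000 - 2401 / 16400"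
    by (simp add: rho_def field_simps power2_eq_square)
  moreover have "0 \<le> 41 / 100 * (\<kappa> - 49 / 82) ^ 2" by simp
  ultimately show "rho \<kappa> < 1" by linarith
qed

text \<open>With \<open>Y1 = N1 / (N1 - D1)\<close> and \<open>Y2 = D2 / (N2 - D2)\<close> one has
  \<open>1 - 1 / Y1 = D1 / N1\<close> and \<open>1 + 1 / Y2 = N2 / D2\<close>. The two polynomial
  inequalities place (Y1, Y2) beyond the crossing point, hence above (y1, y2), and the Pade quotient
  errs in the required direction at both ends.\<close>

lemma exp_bounds_of_ineqs:
  fixes x z \<kappa> y1 y2 a :: real
  assumes xz: "0 < x" "x \<le> 5 / 2" "0 < z" "z \<le> 5 / 2"
    and \<kappa>: "11 / 25 \<le> \<kappa>" "\<kappa> \<le> 1" "1 - \<kappa> = a * (\<kappa> * rho \<kappa>)"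
    and i1: "ineq1 x z \<kappa> \<ge> 0" and i2: "ineq2 x z \<kappa> \<ge> 0"
    and y: "y1 > 1" "y2 > 0"
    and A1: "2 * (y1 - 1) * (3.718 * y1 - a) \<le> y1 + y2" and A2: "2 * (y2 + 1) * (1.718 * y2 - a) \<le> y1 + y2"
  shows "1 - 1 / y1 < exp (- x)" "exp z < 1 + 1 / y2"
proof -
  define N1 D1 N2 D2 where N1: "N1 = pade_num x" and D1: "D1 = pade_den x"
    and N2: "N2 = pade_num z" and D2: "D2 = pade_den z"
  note defs = N1 D1 N2 D2
  have pos: "N1 > 0" "D1 > 0" "N2 > 0" "D2 > 0"
    unfolding defs using xz by (auto intro!: pade_num_pos pade_den_pos)
  have d1: "N1 - D1 > 0" and d2: "N2 - D2 > 0"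
    unfolding defs pade_num_def pade_den_def using xz by (simp_all add: add_pos_pos)
  define r where "r = \<kappa> * rho \<kappa>"
  have r: "r > 0" unfolding r_def using rho_bounds[OF \<kappa>(1,2)] \<kappa> by (intro mult_pos_pos) auto
  define Y1 Y2 where Y: "Y1 = N1 / (N1 - D1)" "Y2 = D2 / (N2 - D2)"
  have Yp: "Y1 > 1" "Y2 > 0" unfolding Y using pos d1 d2 by (auto simp: field_simps)
  define e1 e2 where e: "e1 = N1 - D1" "e2 = N2 - D2"
  have eqs: "N1 = Y1 * e1" "D1 = (Y1 - 1) * e1" "D2 = Y2 * e2"
    unfolding Y e using d1 d2 by (simp_all add: field_simps)
  have "ineq1 x z \<kappa> = (e1 * e1 * e2 * r) * (2 * (Y1 - 1) * (3.718 * Y1 - a) - (Y1 + Y2))"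
    unfolding ineq1_def Let_def defs[symmetric] \<kappa>(3) r_def[symmetric] e[symmetric]
    unfolding eqs by (simp add: algebra_simps)
  then have "(e1 * e1 * e2 * r) * 0 \<le> (e1 * e1 * e2 * r) * (2 * (Y1 - 1) * (3.718 * Y1 - a) - (Y1 + Y2))" using i1 by simp
  moreover have "e1 * e1 * e2 * r > 0" unfolding e using d1 d2 r by simp
  ultimately have B1: "Y1 + Y2 \<le> 2 * (Y1 - 1) * (3.718 * Y1 - a)"
    by (metis mult_left_le_imp_le diff_ge_0_iff_ge)
  have "ineq2 x z \<kappa> = (e2 * e2 * e1 * r) * (2 * (Y2 + 1) * (1.718 * Y2 - a) - (Y1 + Y2))"
    unfolding ineq2_def Let_def defs[symmetric] \<kappa>(3) r_def[symmetric] e[symmetric]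
    unfolding eqs by (simp add: algebra_simps)
  then have "(e2 * e2 * e1 * r) * 0 \<le> (e2 * e2 * e1 * r) * (2 * (Y2 + 1) * (1.718 * Y2 - a) - (Y1 + Y2))" using i2 by simp
  moreover have "e2 * e2 * e1 * r > 0" unfolding e using d1 d2 r by simp
  ultimately have B2: "Y1 + Y2 \<le> 2 * (Y2 + 1) * (1.718 * Y2 - a)"
    by (metis mult_left_le_imp_le diff_ge_0_iff_ge)
  have "y1 \<le> Y1 \<and> y2 \<le> Y2"
    by (rule below_crossing_point[OF Yp _ _ A1 A2 B1 B2]) auto
  then have le: "y1 \<le> Y1" "y2 \<le> Y2" by auto
  have "exp x < N1 / D1" using exp_less_pade[OF xz(1,2)] pos by (simp add: defs pos_less_divide_eq)
  then have "D1 / N1 < exp (- x)"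
    using pos by (simp add: exp_minus field_simps)
  moreover have "1 - 1 / Y1 = D1 / N1" unfolding Y using pos d1 by (simp add: field_simps)
  moreover have "1 / Y1 \<le> 1 / y1" using le y by (intro frac_le) auto
  ultimately show "1 - 1 / y1 < exp (- x)" by linarith
  have "exp z < N2 / D2" using exp_less_pade[OF xz(3,4)] pos by (simp add: defs pos_less_divide_eq)
  moreover have "1 + 1 / Y2 = N2 / D2" unfolding Y using pos d2 by (simp add: field_simps)
  moreover have "1 / Y2 \<le> 1 / y2" using le y by (intro frac_le) auto
  ultimately show "exp z < 1 + 1 / y2" by linarith
qed

text \<open>The pairs \<open>(l1, l2)\<close> are those for which \<open>exp \<circ> ell\<close> maps the unit disc into the disc with
  diameter \<open>[exp (- l1), exp l2]\<close>.  No single pair serves all \<open>\<kappa>\<close>, since shrinking the disc on one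
  side enlarges it on the other.\<close>
lemma dominant_exponent:
  fixes a y1 y2 :: real
  assumes a: "a > 0" "a \<le> y1" and y: "y1 > 1" "y2 > 0"
    and A1: "2 * (y1 - 1) * ((1 + exp 1) * y1 - a) \<le> y1 + y2"
    and A2: "2 * (y2 + 1) * ((exp 1 - 1) * y2 - a) \<le> y1 + y2"
  obtains \<kappa> l1 l2 where "11 / 25 \<le> \<kappa>" "\<kappa> \<le> 1" "1 - \<kappa> = a * (\<kappa> * rho \<kappa>)"
    "(l1, l2) \<in> {(1911 / 1000, 1382 / 1000), (1978 / 1000, 1377 / 1000), (2070 / 1000, 1372 / 1000)}"
    "1 - 1 / y1 < exp (- (l1 * \<kappa>))" "exp (l2 * \<kappa>) < 1 + 1 / y2"
proof -
  have "2 * (y1 - 1) * (3.718 * y1 - a) \<le> 2 * (y1 - 1) * ((1 + exp 1) * y1 - a)"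
    using exp_1_ge y by (intro mult_left_mono diff_right_mono mult_right_mono) auto
  with A1 have A1': "2 * (y1 - 1) * (3.718 * y1 - a) \<le> y1 + y2" by linarith
  have "2 * (y2 + 1) * (1.718 * y2 - a) \<le> 2 * (y2 + 1) * ((exp 1 - 1) * y2 - a)"
    using exp_1_ge y by (intro mult_left_mono diff_right_mono mult_right_mono) auto
  with A2 have A2': "2 * (y2 + 1) * (1.718 * y2 - a) \<le> y1 + y2" by linarith
  \<comment> \<open>The equation for \<kappa> has the solution 11/25 at a = 1.392..., so this bound
    keeps the root in the range where \<open>rho\<close> is valid. For larger a, the first
    inequality forces y2 to be almost as large as y1, and then the second fails.\<close>
  have a136: "a < 1.36"
  proof (rule ccontr)
    assume "\<not> a < 1.36"
    then have y1: "y1 \<ge> 1.36" using a by linarith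
    have "2 * (y1 - 1) * (2.718 * y1) \<le> 2 * (y1 - 1) * (3.718 * y1 - a)"
      using a y by (intro mult_left_mono) auto
    moreover have "2 * 0.36 * (2.718 * y1) \<le> 2 * (y1 - 1) * (2.718 * y1)"
      using y1 by (intro mult_right_mono) auto
    ultimately have "2 * 0.36 * (2.718 * y1) \<le> y1 + y2" using A1' by linarith
    then have y2: "0.956 * y1 \<le> y2" using y by simp
    have "2 * 2.3 * (0.671 * y2) \<le> 2 * (y2 + 1) * (1.718 * y2 - a)"
      using a y y1 y2 by (intro mult_mono) auto
    then have "2 * 2.3 * (0.671 * y2) \<le> y1 + y2" using A2' by linarith
    then show False using y y2 by simp
  qed
  define h where "h = (\<lambda>\<kappa>. \<kappa> - 1 + a * (\<kappa> * rho \<kappa>))"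
  have "\<exists>\<kappa>\<ge>11/25. \<kappa> \<le> 1 \<and> h \<kappa> = 0"
  proof (rule IVT')
    \<comment> \<open>The fraction \<open>11427800 / 12500000\<close> is
      \<open>rho (11 / 25)\<close>.\<close>
    have "h (11 / 25) = - 14 / 25 + a * (11 / 25 * (11427800 / 12500000))"
      by (simp add: h_def rho_def power2_eq_square)
    also have "\<dots> \<le> - 14 / 25 + 1.36 * (11 / 25 * (11427800 / 12500000))"
      using a136 by (intro add_left_mono mult_right_mono) auto
    finally show "h (11 / 25) \<le> 0" by simp
    show "0 \<le> h 1" using a by (simp add: h_def rho_def)
    show "continuous_on {11 / 25..1} h"
      unfolding h_def rho_def by (intro continuous_intros)
  qed auto
  then obtain \<kappa> where \<kappa>: "11 / 25 \<le> \<kappa>" "\<kappa> \<le> 1" "1 - \<kappa> = a * (\<kappa> * rho \<kappa>)"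
    by (auto simp: h_def algebra_simps)
  note main = that
  have fin: thesis
    if l: "(l1, l2) \<in> {(1911 / 1000, 1382 / 1000), (1978 / 1000, 1377 / 1000), (2070 / 1000, 1372 / 1000)}"
      and i: "ineq1 (l1 * \<kappa>) (l2 * \<kappa>) \<kappa> \<ge> 0" "ineq2 (l1 * \<kappa>) (l2 * \<kappa>) \<kappa> \<ge> 0" for l1 l2
  proof -
    have "0 < l1" "l1 \<le> 5 / 2" "0 < l2" "l2 \<le> 5 / 2" using l by auto
    then have "0 < l1 * \<kappa>" "l1 * \<kappa> \<le> 5 / 2" "0 < l2 * \<kappa>" "l2 * \<kappa> \<le> 5 / 2"
      using \<kappa>(1,2) mult_mono[of l1 "5 / 2" \<kappa> 1] mult_mono[of l2 "5 / 2" \<kappa> 1] by auto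
    from exp_bounds_of_ineqs[OF this \<kappa> i y A1' A2'] main[OF \<kappa> l] show thesis by blast
  qed
  consider "951 / 1000 \<le> \<kappa>" | "880 / 1000 \<le> \<kappa>" "\<kappa> \<le> 951 / 1000" | "\<kappa> \<le> 880 / 1000" by linarith
  then show thesis
  proof cases
    case 1
    show thesis
      by (rule fin[of "1911 / 1000" "1382 / 1000"])
         (use ineq_nonneg[OF check_ineq_lists(1,2), of \<kappa>] 1 \<kappa> in auto)
  next
    case 2
    show thesis
      by (rule fin[of "1978 / 1000" "1377 / 1000"])
         (use ineq_nonneg[OF check_ineq_lists(3,4), of \<kappa>] 2 \<kappa> in auto)
  next
    case 3
    show thesis
      by (rule fin[of "2070 / 1000" "1372 / 1000"])
         (use ineq_nonneg[OF check_ineq_lists(5,6), of \<kappa>] 3 \<kappa> in auto)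
  qed
qed

subsection \<open>Real powers of discs\<close>

lemma tanh_mult_le:
  fixes k t :: real
  assumes "0 \<le> k" "k \<le> 1" "0 \<le> t"
  shows "k * tanh t \<le> tanh (k * t)"
proof -
  define f where "f = (\<lambda>t. tanh (k * t) - k * tanh t)"
  have "f 0 \<le> f t"
  proof (rule DERIV_nonneg_imp_nondecreasing[OF assms(3)])
    fix x assume x: "0 \<le> x" "x \<le> t"
    have c: "cosh y \<noteq> 0" for y :: real using cosh_real_pos[of y] by simp
    have "(f has_real_derivative (1 - tanh (k * x) ^ 2) * k - k * (1 - tanh x ^ 2)) (at x)"
      unfolding f_def by (auto intro!: derivative_eq_intros simp: c)
    moreover have "tanh (k * x) ^ 2 \<le> tanh x ^ 2"
      using x assms by (intro power_mono) (auto simp: mult_left_le_one_le)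
    then have "0 \<le> (1 - tanh (k * x) ^ 2) * k - k * (1 - tanh x ^ 2)"
      using assms(1) mult_left_mono[of "tanh (k * x) ^ 2" "tanh x ^ 2" k] by (simp add: algebra_simps)
    ultimately show "\<exists>y. (f has_real_derivative y) (at x) \<and> 0 \<le> y" by blast
  qed
  then show ?thesis by (simp add: f_def)
qed

lemma tan_mult_le:
  fixes k t :: real
  assumes "0 \<le> k" "k \<le> 1" "0 \<le> t" "t < pi / 2"
  shows "tan (k * t) \<le> k * tan t"
proof -
  define f where "f = (\<lambda>t. k * tan t - tan (k * t))"
  have "f 0 \<le> f t"
  proof (rule DERIV_nonneg_imp_nondecreasing[OF assms(3)])
    fix x assume x: "0 \<le> x" "x \<le> t"
    have kx: "0 \<le> k * x" "k * x \<le> x" using x assms by (auto simp: mult_left_le_one_le)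
    have c: "cos x > 0" "cos (k * x) > 0"
      by (rule cos_gt_zero_pi; use kx x assms pi_gt_zero in linarith)+
    have "(f has_real_derivative k * inverse (cos x ^ 2) - inverse (cos (k * x) ^ 2) * k) (at x)"
      unfolding f_def using c by (auto intro!: derivative_eq_intros)
    moreover have "cos x ^ 2 \<le> cos (k * x) ^ 2"
      using c kx x assms by (intro power_mono cos_monotone_0_pi_le) auto
    then have "inverse (cos (k * x) ^ 2) \<le> inverse (cos x ^ 2)"
      using c by (intro le_imp_inverse_le) auto
    then have "0 \<le> k * inverse (cos x ^ 2) - inverse (cos (k * x) ^ 2) * k"
      using assms(1) by (simp add: mult.commute mult_left_mono)
    ultimately show "\<exists>y. (f has_real_derivative y) (at x) \<and> 0 \<le> y" by blast
  qed
  then show ?thesis by (simp add: f_def)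
qed

lemma ln_cosh_scaled_mono:
  fixes k x s :: real
  assumes k: "0 \<le> k" "k \<le> 1" and x: "0 \<le> x" "x \<le> s"
  shows "k\<^sup>2 * (ln (cosh s) - ln (cosh x)) \<le> ln (cosh (k * s)) - ln (cosh (k * x))"
proof -
  define f where "f = (\<lambda>t. ln (cosh (k * t)) - k\<^sup>2 * ln (cosh t))"
  have "f x \<le> f s"
  proof (rule DERIV_nonneg_imp_nondecreasing[OF x(2)])
    fix t assume t: "x \<le> t" "t \<le> s"
    have "(f has_real_derivative k * tanh (k * t) - k\<^sup>2 * tanh t) (at t)"
      unfolding f_def by (auto intro!: derivative_eq_intros simp: cosh_real_pos tanh_def mult_ac)
    moreover have "k * (k * tanh t) \<le> k * tanh (k * t)"
      using tanh_mult_le[OF k, of t] t x k by (intro mult_left_mono) auto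
    ultimately show "\<exists>y. (f has_real_derivative y) (at t) \<and> 0 \<le> y"
      by (intro exI[of _ "k * tanh (k * t) - k\<^sup>2 * tanh t"]) (auto simp: power2_eq_square mult_ac)
  qed
  then show ?thesis by (simp add: f_def algebra_simps)
qed

lemma ln_cos_scaled_ge:
  fixes k y :: real
  assumes k: "0 \<le> k" "k \<le> 1" and y: "0 \<le> y" "y < pi / 2"
  shows "k\<^sup>2 * ln (cos y) \<le> ln (cos (k * y))"
proof -
  define f where "f = (\<lambda>t. ln (cos (k * t)) - k\<^sup>2 * ln (cos t))"
  have "f 0 \<le> f y"
  proof (rule DERIV_nonneg_imp_nondecreasing[OF y(1)])
    fix t assume t: "0 \<le> t" "t \<le> y"
    have kt: "0 \<le> k * t" "k * t \<le> t" using t k by (auto simp: mult_left_le_one_le)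
    have c: "cos t > 0" "cos (k * t) > 0"
      by (rule cos_gt_zero_pi; use kt t y pi_gt_zero in linarith)+
    have "(f has_real_derivative k\<^sup>2 * tan t - k * tan (k * t)) (at t)"
      unfolding f_def using c by (auto intro!: derivative_eq_intros simp: tan_def mult_ac)
    moreover have "k * tan (k * t) \<le> k * (k * tan t)"
      using tan_mult_le[OF k, of t] t y k by (intro mult_left_mono) auto
    ultimately show "\<exists>z. (f has_real_derivative z) (at t) \<and> 0 \<le> z"
      by (intro exI[of _ "k\<^sup>2 * tan t - k * tan (k * t)"]) (auto simp: power2_eq_square mult_ac)
  qed
  then show ?thesis by (simp add: f_def)
qed

text \<open>After taking logarithms the hypothesis reads ln cosh s - ln cosh x + ln cos y \<ge> 0.
  Scaling the arguments by k keeps this sum at least k^2 times its old value, because k tanh t \<le>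
  tanh (k t) and tan (k t) \<le> k tan t.\<close>

lemma cosh_le_cosh_mult_cos_scaled:
  fixes k s x y :: real
  assumes k: "0 \<le> k" "k \<le> 1" and s: "0 \<le> s" and y: "\<bar>y\<bar> < pi / 2"
    and le: "cosh x \<le> cosh s * cos y"
  shows "cosh (k * x) \<le> cosh (k * s) * cos (k * y)"
proof -
  have cy: "cos \<bar>y\<bar> > 0" using y by (intro cos_gt_zero_pi) auto
  have ky: "\<bar>k * y\<bar> \<le> \<bar>y\<bar>" using k by (simp add: abs_mult mult_left_le_one_le)
  have cky: "cos \<bar>k * y\<bar> > 0" using ky y by (intro cos_gt_zero_pi) auto
  have "cosh x \<le> cosh s * 1"
    by (rule order_trans[OF le mult_left_mono]) (use cosh_real_pos[of s] in auto)
  moreover have "cosh \<bar>x\<bar> = cosh x" by (simp add: abs_if)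
  ultimately have xs: "\<bar>x\<bar> \<le> s" using s cosh_real_nonneg_le_iff[of "\<bar>x\<bar>" s] by simp
  have "cosh s * cos \<bar>y\<bar> > 0" using cy cosh_real_pos[of s] by (intro mult_pos_pos)
  then have "ln (cosh \<bar>x\<bar>) \<le> ln (cosh s * cos \<bar>y\<bar>)"
    using le \<open>cosh \<bar>x\<bar> = cosh x\<close> by (intro iffD2[OF ln_le_cancel_iff] cosh_real_pos) simp_all
  also have "\<dots> = ln (cosh s) + ln (cos \<bar>y\<bar>)" using cy cosh_real_pos[of s] by (intro ln_mult_pos)
  finally have "k\<^sup>2 * (ln (cosh s) - ln (cosh \<bar>x\<bar>) + ln (cos \<bar>y\<bar>)) \<ge> 0" by simp
  then have "ln (cosh (k * \<bar>x\<bar>)) \<le> ln (cosh (k * s)) + ln (cos (k * \<bar>y\<bar>))"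
    using ln_cosh_scaled_mono[OF k _ xs] ln_cos_scaled_ge[OF k, of "\<bar>y\<bar>"] y
    by (simp add: distrib_left)
  also have "\<dots> = ln (cosh (k * s) * cos (k * \<bar>y\<bar>))"
    using cky k cosh_real_pos[of "k * s"] by (intro ln_mult_pos[symmetric]) (auto simp: abs_mult)
  finally have "cosh (k * \<bar>x\<bar>) \<le> cosh (k * s) * cos (k * \<bar>y\<bar>)"
    using cky k cosh_real_pos[of "k * s"] cosh_real_pos[of "k * \<bar>x\<bar>"] by (simp add: abs_mult)
  moreover have "cosh (k * \<bar>x\<bar>) = cosh (k * x)" "cos (k * \<bar>y\<bar>) = cos (k * y)"
    by (auto simp: abs_if)
  ultimately show ?thesis by simp
qed

text \<open>Nonpositivity characterises the closed disc having the real segment from \<open>p\<close> to \<open>q\<close> as a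
  diameter.\<close>
definition disc_fun :: "real \<Rightarrow> real \<Rightarrow> complex \<Rightarrow> real" where
  "disc_fun p q G = (norm G)\<^sup>2 - (p + q) * Re G + p * q"

text \<open>In the coordinate \<open>L = x + i y\<close>, centred at the logarithm of the geometric mean of the end
  points, the disc becomes \<open>cosh x \<le> cosh s cos y\<close>; a real power of the disc is a scaling of \<open>L\<close>.\<close>
lemma disc_fun_exp:
  fixes \<alpha> \<beta> :: real
  shows "disc_fun (exp \<alpha>) (exp \<beta>) (exp L) = 2 * exp (Re L + (\<alpha> + \<beta>) / 2) *
     (cosh (Re L - (\<alpha> + \<beta>) / 2) - cosh ((\<beta> - \<alpha>) / 2) * cos (Im L))"
proof -
  define m s x where "m = (\<alpha> + \<beta>) / 2" "s = (\<beta> - \<alpha>) / 2" "x = Re L"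
  have ab: "\<alpha> = m - s" "\<beta> = m + s" by (simp_all add: m_s_x_def field_simps)
  have "2 * exp (x + m) * (cosh (x - m) - cosh s * cos (Im L))
      = exp (x + m) * exp (x - m) + exp (x + m) * exp (m - x)
        - (exp (x + m) * exp s + exp (x + m) * exp (- s)) * cos (Im L)"
    by (simp add: cosh_field_def field_simps)
  also have "\<dots> = exp x ^ 2 + exp (m + m) - (exp (m + s) + exp (m - s)) * (exp x * cos (Im L))"
  proof -
    have "exp (x + m) * exp (m - x) = exp (m + m)" by (simp flip: exp_add)
    moreover have "exp (x + m) * exp (x - m) = exp x ^ 2"
      "exp (x + m) * exp s = exp (m + s) * exp x" "exp (x + m) * exp (- s) = exp (m - s) * exp x"
      by (simp_all add: exp_add exp_diff exp_minus field_simps power2_eq_square)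
    ultimately show ?thesis by (simp add: algebra_simps)
  qed
  also have "\<dots> = disc_fun (exp \<alpha>) (exp \<beta>) (exp L)"
    unfolding disc_fun_def ab by (simp add: m_s_x_def(3) Re_exp algebra_simps flip: exp_add)
  finally show ?thesis unfolding m_s_x_def ..
qed

lemma disc_fun_exp_scaled:
  assumes k: "0 \<le> k" "k \<le> 1" and \<alpha>\<beta>: "\<alpha> \<le> \<beta>" and L: "\<bar>Im L\<bar> < pi / 2"
    and le: "disc_fun (exp \<alpha>) (exp \<beta>) (exp L) \<le> 0"
  shows "disc_fun (exp (k * \<alpha>)) (exp (k * \<beta>)) (exp (of_real k * L)) \<le> 0"
proof -
  have "cosh (Re L - (\<alpha> + \<beta>) / 2) \<le> cosh ((\<beta> - \<alpha>) / 2) * cos (Im L)"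
    using le unfolding disc_fun_exp by (simp add: mult_le_0_iff)
  then have "cosh (k * (Re L - (\<alpha> + \<beta>) / 2)) \<le> cosh (k * ((\<beta> - \<alpha>) / 2)) * cos (k * Im L)"
    using k \<alpha>\<beta> L by (intro cosh_le_cosh_mult_cos_scaled) auto
  then show ?thesis
    unfolding disc_fun_exp by (simp add: mult_le_0_iff algebra_simps add_divide_distrib diff_divide_distrib)
qed

lemma disc_fun_mono:
  assumes "disc_fun p q G \<le> 0" "p' < p" "p \<le> q" "q < q'"
  shows "disc_fun p' q' G < 0"
proof -
  have nG: "(norm G)\<^sup>2 = (Re G)\<^sup>2 + (Im G)\<^sup>2" by (rule cmod_power2)
  have "(Re G - p) * (Re G - q) \<le> 0"
  proof -
    have "(Re G - p) * (Re G - q) = disc_fun p q G - (Im G)\<^sup>2"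
      unfolding disc_fun_def nG by (simp add: power2_eq_square algebra_simps)
    then show ?thesis using assms(1) zero_le_power2[of "Im G"] by linarith
  qed
  then have R: "p \<le> Re G" "Re G \<le> q" using assms(3) by (auto simp: mult_le_0_iff)
  have "disc_fun p' q' G = disc_fun p q G - (p - p') * (q - Re G) - (q' - q) * (Re G - p')"
    unfolding disc_fun_def by (simp add: algebra_simps)
  moreover have "(p - p') * (q - Re G) \<ge> 0" "(q' - q) * (Re G - p') > 0" using R assms by auto
  ultimately show ?thesis using assms(1) by linarith
qed

subsection \<open>The image of the unit disc under \<open>exp \<circ> ell\<close>\<close>

text \<open>Turns a linear equation of Euler type into a recurrence, which gives exact Taylor
  coefficients of \<open>exp \<circ> ell\<close> and of \<open>contact_fun\<close>, and also bounds
  for their tails.\<close>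

lemma euler_ode_coeffs:
  fixes f R S :: "complex \<Rightarrow> complex"
  assumes f: "f holomorphic_on UNIV" and R: "R has_fps_expansion r" and S: "S has_fps_expansion s"
    and ode: "\<And>z. z * deriv f z = R z * f z + S z"
  defines "c \<equiv> fps_nth (fps_expansion f 0)"
  shows "of_nat n * c n = (\<Sum>k\<le>n. fps_nth r k * c (n - k)) + fps_nth s n"
proof -
  define F where "F = fps_expansion f 0"
  have F: "f has_fps_expansion F"
    unfolding F_def by (rule has_fps_expansion_fps_expansion[OF open_UNIV UNIV_I f])
  have "(\<lambda>z. z * deriv f z) has_fps_expansion fps_X * fps_deriv F"
    by (intro has_fps_expansion_mult has_fps_expansion_fps_X has_fps_expansion_deriv F)
  moreover have "(\<lambda>z. z * deriv f z) has_fps_expansion r * F + s"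
    unfolding ode by (intro has_fps_expansion_add has_fps_expansion_mult R S F)
  ultimately have "fps_X * fps_deriv F = r * F + s" by (rule fps_expansion_unique_complex)
  then have "fps_nth (fps_X * fps_deriv F) n = fps_nth (r * F + s) n" by simp
  moreover have "fps_nth (fps_X * fps_deriv F) n = of_nat n * fps_nth F n"
    by (cases n) auto
  ultimately show ?thesis
    by (simp add: c_def F_def fps_mult_nth atMost_atLeast0)
qed

lemma entire_power_series_sums:
  assumes "f holomorphic_on UNIV"
  shows "(\<lambda>n. fps_nth (fps_expansion f 0) n * z ^ n) sums f z"
  using holomorphic_power_series[of f 0 "norm z + 1" z] holomorphic_on_subset[OF assms]
  by (simp add: fps_expansion_def)

lemma power_series_tail:
  fixes c :: "nat \<Rightarrow> complex"
  assumes s: "(\<lambda>n. c n * z ^ n) sums S" and z: "norm z = 1" and \<theta>: "0 \<le> \<theta>" "\<theta> < 1"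
    and c: "\<And>n. n \<ge> N \<Longrightarrow> norm (c n) \<le> C * \<theta> ^ n"
  shows "norm (S - (\<Sum>n<N. c n * z ^ n)) \<le> C * \<theta> ^ N / (1 - \<theta>)"
proof -
  have "(\<lambda>n. c (n + N) * z ^ (n + N)) sums (S - (\<Sum>n<N. c n * z ^ n))"
    by (rule sums_split_initial_segment[OF s])
  moreover have "(\<lambda>n. C * \<theta> ^ N * \<theta> ^ n) sums (C * \<theta> ^ N * (1 / (1 - \<theta>)))"
    using \<theta> by (intro sums_mult geometric_sums) simp
  ultimately have "norm (S - (\<Sum>n<N. c n * z ^ n)) \<le> C * \<theta> ^ N * (1 / (1 - \<theta>))"
  proof (rule norm_sums_le)
    fix n
    show "norm (c (n + N) * z ^ (n + N)) \<le> C * \<theta> ^ N * \<theta> ^ n"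
      using c[of "n + N"] z by (simp add: norm_mult norm_power power_add mult_ac)
  qed
  then show ?thesis by simp
qed

lemma exp_5_2_less: "exp (5 / 2 :: real) < 123 / 10"
  using exp_less_pade[of "5 / 2"] by (simp add: pade_den_def pade_num_def eval_nat_numeral)

text \<open>Each summand is (2/5)^n times (5/2)^k / k!, so a geometric coefficient bound of ratio
  2/5 costs at most a factor exp (5/2) in the recurrences.\<close>

lemma sum_geometric_fact:
  "(\<Sum>k\<le>n. (2 / 5 :: real) ^ (n - k) / fact k) \<le> (2 / 5) ^ n * (123 / 10)"
proof -
  have "(\<Sum>k\<le>n. (2 / 5 :: real) ^ (n - k) / fact k) = (2 / 5) ^ n * (\<Sum>k<Suc n. (5 / 2) ^ k / fact k)"
    unfolding sum_distrib_left lessThan_Suc_atMost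
  proof (rule sum.cong[OF refl])
    fix k assume "k \<in> {..n}"
    then have "(2 / 5 :: real) ^ n = (2 / 5) ^ (n - k) * (2 / 5) ^ k" by (simp flip: power_add)
    then show "(2 / 5 :: real) ^ (n - k) / fact k = (2 / 5) ^ n * ((5 / 2) ^ k / fact k)"
      by (simp add: power_divide)
  qed
  also have "\<dots> \<le> (2 / 5) ^ n * (123 / 10)"
  proof (rule mult_left_mono)
    show "(\<Sum>k<Suc n. (5 / 2 :: real) ^ k / fact k) \<le> 123 / 10"
      using sum_le_exp[of "5 / 2" "Suc n"] exp_5_2_less by linarith
  qed simp
  finally show ?thesis .
qed

definition exp_ell_coeff :: "nat \<Rightarrow> complex" where
  "exp_ell_coeff = fps_nth (fps_expansion (\<lambda>z. exp (ell z)) 0)"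

lemma exp_ell_holomorphic: "(\<lambda>z. exp (of_real \<kappa> * ell z)) holomorphic_on A"
  by (intro holomorphic_intros ell_holomorphic)

lemma deriv_exp_ell: "z * deriv (\<lambda>z. exp (w * ell z)) z = w * (exp z - 1) * exp (w * ell z)"
proof -
  have "((\<lambda>z. exp (w * ell z)) has_field_derivative exp (w * ell z) * (w * deriv ell z)) (at z)"
    by (auto intro!: derivative_eq_intros has_field_derivative_ell')
  then have "z * deriv (\<lambda>z. exp (w * ell z)) z = w * (z * deriv ell z) * exp (w * ell z)"
    by (simp add: DERIV_imp_deriv)
  then show ?thesis by (simp only: mult_deriv_ell)
qed

lemma exp_ell_coeff_rec: "of_nat n * exp_ell_coeff n = (\<Sum>k\<le>n. (if k = 0 then 0 else 1 / fact k) * exp_ell_coeff (n - k))"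
proof -
  have "(\<lambda>z::complex. exp z - 1) has_fps_expansion fps_exp 1 - 1"
    by (intro has_fps_expansion_diff has_fps_expansion_exp1 has_fps_expansion_1)
  moreover have "(\<lambda>z::complex. 0) has_fps_expansion 0" by simp
  moreover have "(\<lambda>z. exp (ell z)) holomorphic_on UNIV" using exp_ell_holomorphic[of 1] by simp
  moreover have "z * deriv (\<lambda>z. exp (ell z)) z = (exp z - 1) * exp (ell z) + 0" for z
    using deriv_exp_ell[of z 1] by simp
  ultimately have "of_nat n * exp_ell_coeff n = (\<Sum>k\<le>n. fps_nth (fps_exp 1 - 1) k * exp_ell_coeff (n - k)) + fps_nth 0 n"
    unfolding exp_ell_coeff_def by (intro euler_ode_coeffs)
  also have "(\<Sum>k\<le>n. fps_nth (fps_exp 1 - 1) k * exp_ell_coeff (n - k))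
      = (\<Sum>k\<le>n. (if k = 0 then 0 else 1 / fact k) * exp_ell_coeff (n - k))"
    by (intro sum.cong) auto
  finally show ?thesis by simp
qed

lemma exp_ell_coeff_0: "exp_ell_coeff 0 = 1"
  by (simp add: exp_ell_coeff_def fps_expansion_def)

lemma exp_ell_coeff_values:
  "exp_ell_coeff (Suc 0) = 1"
  "exp_ell_coeff 2 = 3 / 4"
  "exp_ell_coeff 3 = 17 / 36"
  "exp_ell_coeff 4 = 19 / 72"
  "exp_ell_coeff 5 = 27 / 200"
  "exp_ell_coeff 6 = 8351 / 129600"
  "exp_ell_coeff 7 = 184553 / 6350400"
  "exp_ell_coeff 8 = 52907 / 4233600"
  "exp_ell_coeff 9 = 1768847 / 342921600"
  "exp_ell_coeff 10 = 70442753 / 34292160000"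
  "exp_ell_coeff 11 = 1096172081 / 1383117120000"
proof -
  show g1: "exp_ell_coeff (Suc 0) = 1"
    using arg_cong[OF exp_ell_coeff_rec[of 1], of "\<lambda>x. x / 1"] by (simp add: exp_ell_coeff_0 atMost_nat_numeral fact_numeral )
  show g2: "exp_ell_coeff 2 = 3 / 4"
    using arg_cong[OF exp_ell_coeff_rec[of 2], of "\<lambda>x. x / 2"] by (simp add: exp_ell_coeff_0 atMost_nat_numeral fact_numeral g1)
  show g3: "exp_ell_coeff 3 = 17 / 36"
    using arg_cong[OF exp_ell_coeff_rec[of 3], of "\<lambda>x. x / 3"] by (simp add: exp_ell_coeff_0 atMost_nat_numeral fact_numeral g1 g2)
  show g4: "exp_ell_coeff 4 = 19 / 72"
    using arg_cong[OF exp_ell_coeff_rec[of 4], of "\<lambda>x. x / 4"] by (simp add: exp_ell_coeff_0 atMost_nat_numeral fact_numeral g1 g2 g3)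
  show g5: "exp_ell_coeff 5 = 27 / 200"
    using arg_cong[OF exp_ell_coeff_rec[of 5], of "\<lambda>x. x / 5"] by (simp add: exp_ell_coeff_0 atMost_nat_numeral fact_numeral g1 g2 g3 g4)
  show g6: "exp_ell_coeff 6 = 8351 / 129600"
    using arg_cong[OF exp_ell_coeff_rec[of 6], of "\<lambda>x. x / 6"] by (simp add: exp_ell_coeff_0 atMost_nat_numeral fact_numeral g1 g2 g3 g4 g5)
  show g7: "exp_ell_coeff 7 = 184553 / 6350400"
    using arg_cong[OF exp_ell_coeff_rec[of 7], of "\<lambda>x. x / 7"] by (simp add: exp_ell_coeff_0 atMost_nat_numeral fact_numeral g1 g2 g3 g4 g5 g6)
  show g8: "exp_ell_coeff 8 = 52907 / 4233600"
    using arg_cong[OF exp_ell_coeff_rec[of 8], of "\<lambda>x. x / 8"] by (simp add: exp_ell_coeff_0 atMost_nat_numeral fact_numeral g1 g2 g3 g4 g5 g6 g7)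
  show g9: "exp_ell_coeff 9 = 1768847 / 342921600"
    using arg_cong[OF exp_ell_coeff_rec[of 9], of "\<lambda>x. x / 9"] by (simp add: exp_ell_coeff_0 atMost_nat_numeral fact_numeral g1 g2 g3 g4 g5 g6 g7 g8)
  show g10: "exp_ell_coeff 10 = 70442753 / 34292160000"
    using arg_cong[OF exp_ell_coeff_rec[of 10], of "\<lambda>x. x / 10"] by (simp add: exp_ell_coeff_0 atMost_nat_numeral fact_numeral g1 g2 g3 g4 g5 g6 g7 g8 g9)
  show g11: "exp_ell_coeff 11 = 1096172081 / 1383117120000"
    using arg_cong[OF exp_ell_coeff_rec[of 11], of "\<lambda>x. x / 11"] by (simp add: exp_ell_coeff_0 atMost_nat_numeral fact_numeral g1 g2 g3 g4 g5 g6 g7 g8 g9 g10)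
qed

text \<open>The recurrence has no term k = 0, so it loses a factor 12.3 - 1 = 11.3 and gains 1 / n:
  the induction closes from n = 12 on. The constant 21 is large enough for the twelve exact
  values.\<close>

lemma norm_exp_ell_coeff_le: "norm (exp_ell_coeff n) \<le> 21 * (2 / 5) ^ n"
proof (induction n rule: less_induct)
  case (less n)
  show ?case
  proof (cases "n < 12")
    case True
    then have "n = 0 \<or> n = Suc 0 \<or> n = 2 \<or> n = 3 \<or> n = 4 \<or> n = 5 \<or> n = 6 \<or> n = 7 \<or> n = 8 \<or> n = 9 \<or> n = 10 \<or> n = 11" by arith
    then show ?thesis by (auto simp: exp_ell_coeff_0 exp_ell_coeff_values norm_divide power_divide)
  next
    case False
    have "norm (of_nat n * exp_ell_coeff n) \<le> (\<Sum>k\<le>n. norm ((if k = 0 then 0 else 1 / fact k) * exp_ell_coeff (n - k)))"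
      unfolding exp_ell_coeff_rec by (rule norm_sum)
    also have "\<dots> \<le> (\<Sum>k\<le>n. 21 * ((2 / 5) ^ (n - k) / fact k) - (if k = 0 then 21 * (2 / 5) ^ n else 0))"
    proof (intro sum_mono)
      fix k assume "k \<in> {..n}"
      then show "norm ((if k = 0 then 0 else 1 / fact k) * exp_ell_coeff (n - k))
          \<le> 21 * ((2 / 5) ^ (n - k) / fact k) - (if k = 0 then 21 * (2 / 5) ^ n else 0)"
        using less.IH[of "n - k"] by (auto simp: norm_mult norm_divide divide_right_mono)
    qed
    also have "\<dots> = 21 * (\<Sum>k\<le>n. (2 / 5) ^ (n - k) / fact k) - 21 * (2 / 5) ^ n"
      by (simp add: sum_subtractf sum_distrib_left)
    also have "\<dots> \<le> 21 * ((2 / 5) ^ n * (123 / 10)) - 21 * (2 / 5) ^ n"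
      using sum_geometric_fact[of n] by linarith
    also have "\<dots> \<le> real n * (21 * (2 / 5) ^ n)"
    proof -
      have "12 * (21 * (2 / 5) ^ n) \<le> real n * (21 * (2 / 5 :: real) ^ n)"
        using False by (intro mult_right_mono) auto
      then show ?thesis by simp
    qed
    finally have "real n * norm (exp_ell_coeff n) \<le> real n * (21 * (2 / 5) ^ n)" by (simp add: norm_mult)
    then show ?thesis using False by (simp add: mult_le_cancel_left_pos)
  qed
qed

lemma Re_power_unit_circle:
  assumes "norm (z::complex) = 1"
  shows "Re (z ^ Suc (Suc n)) = 2 * Re z * Re (z ^ Suc n) - Re (z ^ n)"
    and "Im (z ^ Suc (Suc n)) = 2 * Re z * Im (z ^ Suc n) - Im (z ^ n)"
proof -
  have zc: "z * cnj z = 1" using assms by (simp add: complex_norm_square[symmetric])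
  have "of_real (2 * Re z) * z ^ Suc n = (z + cnj z) * z ^ Suc n"
    by (simp only: complex_add_cnj)
  also have "\<dots> = z ^ Suc (Suc n) + (z * cnj z) * z ^ n" by (simp add: algebra_simps)
  finally have "z ^ Suc (Suc n) = of_real (2 * Re z) * z ^ Suc n - z ^ n" using zc by simp
  then show "Re (z ^ Suc (Suc n)) = 2 * Re z * Re (z ^ Suc n) - Re (z ^ n)"
    and "Im (z ^ Suc (Suc n)) = 2 * Re z * Im (z ^ Suc n) - Im (z ^ n)"
    by (metis Re_complex_of_real Im_complex_of_real minus_complex.sel mult.assoc times_complex.sel
        diff_0_right mult_zero_left add_0_right)+
qed

text \<open>The Taylor coefficients of \<open>exp \<circ> ell\<close>, multiplied by \<open>10\<^sup>5\<close> and rounded.\<close>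
definition exp_ell_digits :: "int list" where
  "exp_ell_digits = [100000, 100000, 75000, 47222, 26389, 13500, 6444, 2906, 1250, 516, 205, 79]"

definition exp_ell_poly :: "complex \<Rightarrow> complex" where
  "exp_ell_poly z = (\<Sum>n<12. of_int (exp_ell_digits ! n) * z ^ n)"

text \<open>The tail contributes less than 6 / 10^4, and rounding twelve coefficients at most 6 /
  10^5.\<close>

lemma exp_ell_approx:
  assumes "norm z = 1"
  shows "norm (exp (ell z) - exp_ell_poly z / 10 ^ 5) \<le> 1 / 1000"
proof -
  have "(\<lambda>z. exp (ell z)) holomorphic_on UNIV" using exp_ell_holomorphic[of 1] by simp
  then have "(\<lambda>n. exp_ell_coeff n * z ^ n) sums exp (ell z)"
    unfolding exp_ell_coeff_def by (rule entire_power_series_sums)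
  then have 1: "norm (exp (ell z) - (\<Sum>n<12. exp_ell_coeff n * z ^ n)) \<le> 21 * (2 / 5) ^ 12 / (1 - 2 / 5)"
    using assms norm_exp_ell_coeff_le by (intro power_series_tail) auto
  have "(\<Sum>n<12. exp_ell_coeff n * z ^ n) - exp_ell_poly z / 10 ^ 5 = (\<Sum>n<12. (exp_ell_coeff n - of_int (exp_ell_digits ! n) / 10 ^ 5) * z ^ n)"
    by (simp add: exp_ell_poly_def sum_divide_distrib sum_subtractf left_diff_distrib)
  also have "norm \<dots> \<le> (\<Sum>n<12. norm (exp_ell_coeff n - of_int (exp_ell_digits ! n) / 10 ^ 5))"
    using assms by (intro order_trans[OF norm_sum]) (simp add: norm_mult norm_power)
  also have "\<dots> \<le> (\<Sum>n<12::nat. 5 / 10 ^ 6)"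
  proof (intro sum_mono)
    fix n :: nat assume "n \<in> {..<12}"
    then have "n < 12" by simp
    then have "n = 0 \<or> n = Suc 0 \<or> n = 2 \<or> n = 3 \<or> n = 4 \<or> n = 5 \<or> n = 6 \<or> n = 7 \<or> n = 8 \<or> n = 9 \<or> n = 10 \<or> n = 11" by arith
    then show "norm (exp_ell_coeff n - of_int (exp_ell_digits ! n) / 10 ^ 5) \<le> 5 / 10 ^ 6"
      by (auto simp: exp_ell_digits_def exp_ell_coeff_0 exp_ell_coeff_values norm_divide)
  qed
  finally have 2: "norm ((\<Sum>n<12. exp_ell_coeff n * z ^ n) - exp_ell_poly z / 10 ^ 5) \<le> 60 / 10 ^ 6" by simp
  have "norm (exp (ell z) - exp_ell_poly z / 10 ^ 5)
      \<le> norm (exp (ell z) - (\<Sum>n<12. exp_ell_coeff n * z ^ n)) + norm ((\<Sum>n<12. exp_ell_coeff n * z ^ n) - exp_ell_poly z / 10 ^ 5)"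
    using norm_triangle_ineq[of "exp (ell z) - (\<Sum>n<12. exp_ell_coeff n * z ^ n)" "(\<Sum>n<12. exp_ell_coeff n * z ^ n) - exp_ell_poly z / 10 ^ 5"]
    by simp
  also have "\<dots> \<le> 21 * (2 / 5) ^ 12 / (1 - 2 / 5) + 60 / 10 ^ 6" by (intro add_mono 1 2)
  also have "\<dots> \<le> 1 / 1000" by (simp add: power_divide)
  finally show ?thesis .
qed

text \<open>Chebyshev polynomials of the second kind with the index shifted by one: the n-th is
  U_(n-1), so that sin (n \<theta>) is sin \<theta> times its value at cos \<theta>.\<close>

fun cheb_u :: "real \<Rightarrow> nat \<Rightarrow> real" where
  "cheb_u x 0 = 0"
| "cheb_u x (Suc 0) = 1"
| "cheb_u x (Suc (Suc n)) = 2 * x * cheb_u x (Suc n) - cheb_u x n"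

lemma Im_power_unit_circle:
  assumes "norm (z::complex) = 1"
  shows "Im (z ^ n) = Im z * cheb_u (Re z) n"
proof (induction "Re z" n rule: cheb_u.induct)
  case (3 n)
  then show ?case
    unfolding Re_power_unit_circle(2)[OF assms] by (simp add: algebra_simps del: power_Suc)
qed auto

definition const_coeffs :: "int list list \<Rightarrow> int list" where
  "const_coeffs = map (\<lambda>c. case c of [] \<Rightarrow> 0 | d # ds \<Rightarrow> d)"

lemma peval_const_coeffs: "peval (const_coeffs cs) t = peval2 cs 0 t"
  unfolding const_coeffs_def by (induction cs) (auto split: list.split)

text \<open>For \<open>|z| = 1\<close> and \<open>t = (1 + Re z) / 2\<close> this is the polynomial \<open>r\<^sup>2 - |exp_ell_poly z - c|\<^sup>2\<close> in \<open>t\<close>.\<close>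
definition containment_list :: "int \<Rightarrow> int \<Rightarrow> int list" where
  "containment_list c r = (let g = map (\<lambda>r. [r]) exp_ell_digits;
      A = padd (const_coeffs (pcheb [-1, 2] g [1] [-1, 2])) [- c];
      U = const_coeffs (pcheb [-1, 2] g [] [1]) in
    padd [r ^ 2] (pscale (- 1) (padd (pmul A A) (pmul (pmul [0, 4, - 4] U) U))))"

text \<open>Centres and radii in units of 10^-5, for the discs with diameters [0.148, 3.982],
  [0.1384, 3.962] and [0.1262, 3.943]; each radius is reduced by 1/1000 to absorb the error of
  \<open>exp_ell_approx\<close>.\<close>

lemma check_containment:
  "pnonneg1 9 (containment_list 206500 191600)"
  "pnonneg1 9 (containment_list 205020 191080)"
  "pnonneg1 9 (containment_list 203460 190740)"
  by code_simp+

lemma norm_exp_ell_poly_diff_le: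
  assumes "pnonneg1 9 (containment_list c r)" and z: "norm z = 1" and r: "r \<ge> 0"
  shows "norm (exp_ell_poly z - of_int c) \<le> of_int r"
proof -
  define t where "t = (1 + Re z) / 2"
  have x: "\<bar>Re z\<bar> \<le> 1" using abs_Re_le_cmod[of z] z by simp
  then have t: "0 \<le> t" "t \<le> 1" by (auto simp: t_def)
  have X: "peval [-1, 2] t = Re z" by (simp add: t_def field_simps)
  have len: "length exp_ell_digits = 12" by (simp add: exp_ell_digits_def)
  have gn: "peval (map (\<lambda>r. [r]) exp_ell_digits ! n) 0 = of_int (exp_ell_digits ! n)" if "n < 12" for n
    using that len by simp
  have re: "peval2 (pcheb [-1, 2] (map (\<lambda>r. [r]) exp_ell_digits) [1] [-1, 2]) 0 t = Re (exp_ell_poly z)"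
  proof -
    have "peval2 (pcheb [-1, 2] (map (\<lambda>r. [r]) exp_ell_digits) [1] [-1, 2]) 0 t
        = (\<Sum>j<length (map (\<lambda>r. [r]) exp_ell_digits). peval (map (\<lambda>r. [r]) exp_ell_digits ! j) 0 * Re (z ^ (0 + j)))"
    proof (rule peval2_pcheb)
      show "Re (z ^ Suc (Suc n)) = 2 * peval [- 1, 2] t * Re (z ^ Suc n) - Re (z ^ n)" for n
        unfolding X by (rule Re_power_unit_circle(1)[OF z])
    qed (use X in simp_all)
    then show ?thesis using gn len by (simp add: exp_ell_poly_def)
  qed
  have im: "Im z * peval2 (pcheb [-1, 2] (map (\<lambda>r. [r]) exp_ell_digits) [] [1]) 0 t = Im (exp_ell_poly z)"
  proof -
    have "peval2 (pcheb [-1, 2] (map (\<lambda>r. [r]) exp_ell_digits) [] [1]) 0 t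
        = (\<Sum>j<length (map (\<lambda>r. [r]) exp_ell_digits). peval (map (\<lambda>r. [r]) exp_ell_digits ! j) 0 * cheb_u (Re z) (0 + j))"
      by (rule peval2_pcheb) (use X in simp_all)
    then show ?thesis
      using gn len by (simp add: exp_ell_poly_def Im_power_unit_circle[OF z] sum_distrib_left mult_ac)
  qed
  have im2: "peval [0, 4, - 4] t = (Im z)\<^sup>2"
  proof -
    have "(Re z)\<^sup>2 + (Im z)\<^sup>2 = 1" using z cmod_power2[of z] by simp
    then show ?thesis by (simp add: t_def field_simps power2_eq_square)
  qed
  have "0 \<le> peval (containment_list c r) t" using assms(1) t by (rule pnonneg1_sound)
  also have "peval (containment_list c r) t = (of_int r)\<^sup>2 - ((Re (exp_ell_poly z) - of_int c)\<^sup>2 + (Im (exp_ell_poly z))\<^sup>2)"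
    unfolding containment_list_def Let_def peval_padd peval_pscale peval_pmul peval_const_coeffs re im2 im[symmetric]
    by (simp add: power2_eq_square algebra_simps)
  also have "\<dots> = (of_int r)\<^sup>2 - (norm (exp_ell_poly z - of_int c))\<^sup>2" by (simp add: cmod_power2)
  finally have "(norm (exp_ell_poly z - of_int c))\<^sup>2 \<le> (of_int r)\<^sup>2" by linarith
  then show ?thesis by (rule power2_le_imp_le) (use r in simp)
qed

lemma disc_fun_eq: "disc_fun p q G = (norm (G - of_real ((p + q) / 2)))\<^sup>2 - ((q - p) / 2)\<^sup>2"
  unfolding disc_fun_def cmod_power2 by (simp add: power2_eq_square field_simps)

lemma disc_fun_exp_ell:
  assumes chk: "pnonneg1 9 (containment_list c r)" and r: "r \<ge> 0"
    and pq: "(p + q) / 2 = of_int c / 10 ^ 5" "of_int r / 10 ^ 5 + 1 / 1000 = (q - p) / 2"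
    and z: "norm z < 1"
  shows "disc_fun p q (exp (ell z)) \<le> 0"
proof -
  have "norm (exp (ell z) - of_real ((p + q) / 2)) \<le> (q - p) / 2"
  proof (rule maximum_modulus_frontier[where S = "ball 0 1" and f = "\<lambda>z. exp (ell z) - of_real ((p + q) / 2)"])
    have "(\<lambda>z. exp (ell z) - of_real ((p + q) / 2)) holomorphic_on A" for A
      by (intro holomorphic_intros ell_holomorphic)
    then show "(\<lambda>z. exp (ell z) - of_real ((p + q) / 2)) holomorphic_on interior (ball 0 1)"
      "continuous_on (closure (ball 0 1)) (\<lambda>z. exp (ell z) - of_real ((p + q) / 2))"
      by (auto intro: holomorphic_on_imp_continuous_on)
    fix v :: complex assume "v \<in> frontier (ball 0 1)"
    then have v: "norm v = 1" by simp
    have eq: "exp_ell_poly v / 10 ^ 5 - of_real ((p + q) / 2) = (exp_ell_poly v - of_int c) / 10 ^ 5"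
      unfolding pq(1) by (simp add: diff_divide_distrib)
    have "norm (exp (ell v) - of_real ((p + q) / 2))
        \<le> norm (exp (ell v) - exp_ell_poly v / 10 ^ 5) + norm (exp_ell_poly v / 10 ^ 5 - of_real ((p + q) / 2))"
      using norm_triangle_ineq[of "exp (ell v) - exp_ell_poly v / 10 ^ 5" "exp_ell_poly v / 10 ^ 5 - of_real ((p + q) / 2)"] by simp
    also have "norm (exp_ell_poly v / 10 ^ 5 - of_real ((p + q) / 2)) = norm (exp_ell_poly v - of_int c) / 10 ^ 5"
      unfolding eq norm_divide by simp
    also have "norm (exp (ell v) - exp_ell_poly v / 10 ^ 5) + norm (exp_ell_poly v - of_int c) / 10 ^ 5 \<le> 1 / 1000 + of_int r / 10 ^ 5"
      by (intro add_mono exp_ell_approx[OF v] divide_right_mono norm_exp_ell_poly_diff_le[OF chk v r]) simp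
    finally show "norm (exp (ell v) - of_real ((p + q) / 2)) \<le> (q - p) / 2" using pq(2) by simp
  qed (use z in auto)
  then have "(norm (exp (ell z) - of_real ((p + q) / 2)))\<^sup>2 \<le> ((q - p) / 2)\<^sup>2" by (intro power_mono) auto
  then show ?thesis unfolding disc_fun_eq by simp
qed

section \<open>Rational bounds for the exponential at the ends of the discs\<close>

fun exp_horner :: "nat \<Rightarrow> nat \<Rightarrow> real \<Rightarrow> real" where
  "exp_horner m 0 y = 1"
| "exp_horner m (Suc n) y = 1 + y / real (Suc m) * exp_horner (Suc m) n y"

lemma exp_horner_eq: "exp_horner m n y = (\<Sum>k\<le>n. fact m * y ^ k / fact (m + k))"
proof (induction n arbitrary: m)
  case (Suc n)
  have "y / real (Suc m) * exp_horner (Suc m) n y = (\<Sum>k\<le>n. fact m * y ^ Suc k / fact (m + Suc k))"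
    unfolding Suc.IH sum_distrib_left
  proof (intro sum.cong refl)
    fix k
    have "y / r * (r * f * p / g) = f * (y * p) / g" if "r \<noteq> 0" for r f g p :: real
      using that by simp
    from this[of "real (Suc m)"]
    show "y / real (Suc m) * (fact (Suc m) * y ^ k / fact (Suc m + k)) = fact m * y ^ Suc k / fact (m + Suc k)"
      unfolding fact_Suc[of m] power_Suc add_Suc add_Suc_right using of_nat_neq_0 by blast
  qed
  then show ?case unfolding sum.atMost_Suc_shift by simp
qed simp

lemma exp_horner_le_exp:
  assumes "0 \<le> y"
  shows "exp_horner 0 n y \<le> exp y"
  using sum_le_exp[OF assms, of "Suc n"] by (simp add: exp_horner_eq lessThan_Suc_atMost)

text \<open>Horner's scheme with an unreduced fraction, so that the checks need integer arithmetic
  only.\<close>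

fun exp_frac :: "int \<Rightarrow> nat \<Rightarrow> int \<Rightarrow> int \<times> int" where
  "exp_frac m 0 l = (1, 1)"
| "exp_frac m (Suc n) l = (case exp_frac (m + 1) n l of (a, b) \<Rightarrow>
     (1000 * (m + 1) * b + l * a, 1000 * (m + 1) * b))"

lemma exp_frac_eq:
  "m \<ge> 0 \<Longrightarrow> exp_frac m n l = (a, b) \<Longrightarrow>
    b > 0 \<and> exp_horner (nat m) n (of_int l / 1000) = of_int a / of_int b"
proof (induction n arbitrary: m a b)
  case (Suc n)
  obtain c d where cd: "exp_frac (m + 1) n l = (c, d)" by (cases "exp_frac (m + 1) n l")
  have IH: "d > 0" "exp_horner (Suc (nat m)) n (of_int l / 1000) = of_int c / of_int d"
    using Suc.IH[OF _ cd] Suc.prems(1) by (auto simp: nat_add_distrib)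
  have ab: "a = 1000 * (m + 1) * d + l * c" "b = 1000 * (m + 1) * d" using Suc.prems(2) cd by auto
  have m: "real (Suc (nat m)) = of_int (m + 1)" using Suc.prems(1) by simp
  have pos: "real_of_int (m + 1) > 0" "real_of_int d > 0" using Suc.prems(1) IH(1) by linarith+
  have "1 + x / 1000 / p * (y / q) = (1000 * p * q + x * y) / (1000 * p * q)" if "p > 0" "q > 0" for x y p q :: real
    using that by (simp add: field_simps)
  from this[OF pos] show ?case
    using IH(1) Suc.prems(1) unfolding exp_horner.simps m IH(2) ab by simp
qed simp

definition exp_above :: "int \<Rightarrow> int \<Rightarrow> int \<Rightarrow> bool" where
  "exp_above l x y = (case exp_frac 0 12 l of (a, b) \<Rightarrow> x * b < y * a)"

lemma exp_above:
  assumes "exp_above l x y" "l \<ge> 0" "y > 0"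
  shows "of_int x / of_int y < exp (of_int l / 1000 :: real)"
proof -
  obtain a b where ab: "exp_frac 0 12 l = (a, b)" by (cases "exp_frac 0 12 l")
  have b: "b > 0" "exp_horner 0 12 (of_int l / 1000) = of_int a / of_int b"
    using exp_frac_eq[OF _ ab] by auto
  have "x * b < y * a" using assms(1) ab by (simp add: exp_above_def)
  then have "real_of_int (x * b) < of_int (y * a)" by (simp only: of_int_less_iff)
  then have "of_int x / of_int y < (of_int a / of_int b :: real)"
    using b(1) assms(3) by (simp add: field_simps)
  also have "\<dots> \<le> exp (of_int l / 1000)"
    unfolding b(2)[symmetric] using assms(2) by (intro exp_horner_le_exp) simp
  finally show ?thesis .
qed

lemma check_exp_above:
  "exp_above 1911 1000 148" "exp_above 1382 3982 1000" "exp_above 1978 10000 1384"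
  "exp_above 1377 3962 1000" "exp_above 2070 10000 1262" "exp_above 1372 3943 1000"
  by code_simp+

text \<open>The rational diameters lie strictly inside the exponential ones, as
  \<open>disc_fun_mono\<close> requires. Only lower bounds for the exponential are needed, since exp
  (- x) is bounded through exp x.\<close>

lemma exp_bounds:
  "exp (- 1911 / 1000) < (148 / 1000 :: real)" "(3982 / 1000 :: real) < exp (1382 / 1000)"
  "exp (- 1978 / 1000) < (1384 / 10000 :: real)" "(3962 / 1000 :: real) < exp (1377 / 1000)"
  "exp (- 2070 / 1000) < (1262 / 10000 :: real)" "(3943 / 1000 :: real) < exp (1372 / 1000)"
proof -
  have neg: "exp (- x) < 1 / y" if "y < exp x" "y > 0" for x y :: real
    using that by (simp add: exp_minus inverse_eq_divide frac_less2)
  show "exp (- 1911 / 1000) < (148 / 1000 :: real)"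
    using neg[of "1000 / 148" "1911 / 1000"] exp_above[OF check_exp_above(1)] by simp
  show "exp (- 1978 / 1000) < (1384 / 10000 :: real)"
    using neg[of "10000 / 1384" "1978 / 1000"] exp_above[OF check_exp_above(3)] by simp
  show "exp (- 2070 / 1000) < (1262 / 10000 :: real)"
    using neg[of "10000 / 1262" "2070 / 1000"] exp_above[OF check_exp_above(5)] by simp
  show "(3982 / 1000 :: real) < exp (1382 / 1000)" using exp_above[OF check_exp_above(2)] by simp
  show "(3962 / 1000 :: real) < exp (1377 / 1000)" using exp_above[OF check_exp_above(4)] by simp
  show "(3943 / 1000 :: real) < exp (1372 / 1000)" using exp_above[OF check_exp_above(6)] by simp
qed

lemma exp_ell_in_disc:
  assumes l: "(l1, l2) \<in> {(1911 / 1000, 1382 / 1000), (1978 / 1000, 1377 / 1000), (2070 / 1000, 1372 / 1000)}"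
    and z: "norm z < 1"
  shows "disc_fun (exp (- l1)) (exp l2) (exp (ell z)) \<le> 0"
proof -
  consider "l1 = 1911 / 1000" "l2 = 1382 / 1000" | "l1 = 1978 / 1000" "l2 = 1377 / 1000"
    | "l1 = 2070 / 1000" "l2 = 1372 / 1000" using l by blast
  then show ?thesis
  proof cases
    case 1
    have "disc_fun (148 / 1000) (3982 / 1000) (exp (ell z)) \<le> 0"
      by (rule disc_fun_exp_ell[OF check_containment(1) _ _ _ z]) simp_all
    from disc_fun_mono[OF this, of "exp (- l1)" "exp l2"] show ?thesis using exp_bounds(1,2) by (simp add: 1)
  next
    case 2
    have "disc_fun (1384 / 10000) (3962 / 1000) (exp (ell z)) \<le> 0"
      by (rule disc_fun_exp_ell[OF check_containment(2) _ _ _ z]) simp_all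
    from disc_fun_mono[OF this, of "exp (- l1)" "exp l2"] show ?thesis using exp_bounds(3,4) by (simp add: 2)
  next
    case 3
    have "disc_fun (1262 / 10000) (3943 / 1000) (exp (ell z)) \<le> 0"
      by (rule disc_fun_exp_ell[OF check_containment(3) _ _ _ z]) simp_all
    from disc_fun_mono[OF this, of "exp (- l1)" "exp l2"] show ?thesis using exp_bounds(5,6) by (simp add: 3)
  qed
qed

subsection \<open>The contact inequality\<close>

text \<open>Dividing by \<kappa> makes the linear coefficient 1 and every Taylor coefficient a
  polynomial in \<kappa>.\<close>

definition contact_fun :: "real \<Rightarrow> complex \<Rightarrow> complex" where
  "contact_fun \<kappa> z = exp (- z) * (exp (of_real \<kappa> * ell z) - 1) / of_real \<kappa>"

definition contact_coeff :: "real \<Rightarrow> nat \<Rightarrow> complex" where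
  "contact_coeff \<kappa> = fps_nth (fps_expansion (contact_fun \<kappa>) 0)"

lemma contact_fun_holomorphic: "contact_fun \<kappa> holomorphic_on UNIV"
proof (cases "\<kappa> = 0")
  case False
  then show ?thesis unfolding contact_fun_def by (intro holomorphic_intros exp_ell_holomorphic) auto
next
  case True
  then have "contact_fun \<kappa> = (\<lambda>z. 0)" by (simp add: contact_fun_def fun_eq_iff)
  then show ?thesis by simp
qed

lemma contact_coeff_0: "contact_coeff \<kappa> 0 = 0"
  by (simp add: contact_coeff_def fps_expansion_def contact_fun_def)

lemma contact_coeff_rec:
  assumes "\<kappa> \<noteq> 0"
  shows "of_nat n * contact_coeff \<kappa> n = (\<Sum>k\<le>n. (of_real \<kappa> * (if k = 0 then 0 else 1 / fact k) - (if k = 1 then 1 else 0)) * contact_coeff \<kappa> (n - k))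
    + ((if n = 0 then 1 else 0) - (- 1) ^ n / fact n)"
proof -
  let ?k = "of_real \<kappa> :: complex"
  have R: "(\<lambda>z. ?k * (exp z - 1) - z) has_fps_expansion fps_const ?k * (fps_exp 1 - 1) - fps_X"
    by (intro has_fps_expansion_diff has_fps_expansion_cmult_left has_fps_expansion_exp1
        has_fps_expansion_1 has_fps_expansion_fps_X)
  have S: "(\<lambda>z::complex. 1 - exp (- z)) has_fps_expansion 1 - fps_exp (- 1)"
    by (intro has_fps_expansion_diff has_fps_expansion_exp_neg1 has_fps_expansion_1)
  have ode: "z * deriv (contact_fun \<kappa>) z = (?k * (exp z - 1) - z) * contact_fun \<kappa> z + (1 - exp (- z))" for z
  proof -
    let ?h = "\<lambda>z. exp (?k * ell z)"
    have dh: "(?h has_field_derivative deriv ?h z) (at z)"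
      by (rule holomorphic_derivI[OF exp_ell_holomorphic open_UNIV UNIV_I])
    have "(contact_fun \<kappa> has_field_derivative (exp (- z) * deriv ?h z - exp (- z) * (?h z - 1)) / ?k) (at z)"
      unfolding contact_fun_def by (rule derivative_eq_intros dh refl | use assms in simp)+
    then have "z * deriv (contact_fun \<kappa>) z = (exp (- z) * (z * deriv ?h z) - z * (exp (- z) * (?h z - 1))) / ?k"
      by (simp add: DERIV_imp_deriv algebra_simps)
    also have "\<dots> = (?k * (exp z - 1) - z) * contact_fun \<kappa> z + (1 - exp (- z))"
    proof -
      have e: "exp (- z) * exp z = 1" by (simp flip: exp_add)
      have "exp (- z) * (?k * (exp z - 1) * h) - z * (exp (- z) * (h - 1))
          = (?k * (exp z - 1) - z) * (exp (- z) * (h - 1)) + ?k * (exp (- z) * exp z - exp (- z))" for h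
        by (simp add: algebra_simps)
      then show ?thesis
        unfolding deriv_exp_ell e contact_fun_def using assms by (simp add: add_divide_distrib)
    qed
    finally show ?thesis .
  qed
  have "of_nat n * contact_coeff \<kappa> n = (\<Sum>k\<le>n. fps_nth (fps_const ?k * (fps_exp 1 - 1) - fps_X) k * contact_coeff \<kappa> (n - k))
      + fps_nth (1 - fps_exp (- 1)) n"
    unfolding contact_coeff_def by (rule euler_ode_coeffs[OF contact_fun_holomorphic R S ode])
  also have "(\<Sum>k\<le>n. fps_nth (fps_const ?k * (fps_exp 1 - 1) - fps_X) k * contact_coeff \<kappa> (n - k))
     = (\<Sum>k\<le>n. (?k * (if k = 0 then 0 else 1 / fact k) - (if k = 1 then 1 else 0)) * contact_coeff \<kappa> (n - k))"
    by (intro sum.cong) (auto simp: fps_X_nth)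
  finally show ?thesis by simp
qed

lemma contact_coeff_values:
  fixes \<kappa> :: real
  assumes "\<kappa> \<noteq> 0"
  shows "contact_coeff \<kappa> (Suc 0) = 1"
    "contact_coeff \<kappa> 2 = of_real ((-3 + 2 * \<kappa>) / 4)"
    "contact_coeff \<kappa> 3 = of_real ((11 - 9 * \<kappa> + 6 * \<kappa> ^ 2) / 36)"
    "contact_coeff \<kappa> 4 = of_real ((-25 + 25 * \<kappa> - 12 * \<kappa> ^ 2 + 12 * \<kappa> ^ 3) / 288)"
    "contact_coeff \<kappa> 5 = of_real ((137 - 150 * \<kappa> + 125 * \<kappa> ^ 2 + 60 * \<kappa> ^ 4) / 7200)"
    "contact_coeff \<kappa> 6 = of_real ((-882 + 1057 * \<kappa> - 675 * \<kappa> ^ 2 + 1050 * \<kappa> ^ 3 + 540 * \<kappa> ^ 4 + 360 * \<kappa> ^ 5) / 259200)"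
    "contact_coeff \<kappa> 7 = of_real ((6534 - 8281 * \<kappa> + 8134 * \<kappa> ^ 2 + 3675 * \<kappa> ^ 3 + 16170 * \<kappa> ^ 4 + 8820 * \<kappa> ^ 5 + 2520 * \<kappa> ^ 6) / 12700800)"
    "contact_coeff \<kappa> 8 = of_real ((-13698 + 18353 * \<kappa> - 12642 * \<kappa> ^ 2 + 40523 * \<kappa> ^ 3 + 70560 * \<kappa> ^ 4 + 76440 * \<kappa> ^ 5 + 30240 * \<kappa> ^ 6 + 5040 * \<kappa> ^ 7) / 203212800)"
proof -
  have rec: "contact_coeff \<kappa> n = ((\<Sum>k\<le>n. (of_real \<kappa> * (if k = 0 then 0 else 1 / fact k) - (if k = 1 then 1 else 0)) * contact_coeff \<kappa> (n - k))
    + ((if n = 0 then 1 else 0) - (- 1) ^ n / fact n)) / of_nat n" if "n > 0" for n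
    unfolding contact_coeff_rec[OF assms, symmetric] using that by simp
  show v1: "contact_coeff \<kappa> (Suc 0) = 1"
    by (subst rec) (simp_all add: contact_coeff_0)
  show v2: "contact_coeff \<kappa> 2 = of_real ((-3 + 2 * \<kappa>) / 4)"
    by (rule trans[OF rec], simp, simp add: contact_coeff_0 atMost_nat_numeral fact_numeral v1;
        (simp add: field_simps power_numeral_reduce)?)
  show v3: "contact_coeff \<kappa> 3 = of_real ((11 - 9 * \<kappa> + 6 * \<kappa> ^ 2) / 36)"
    by (rule trans[OF rec], simp, simp add: contact_coeff_0 atMost_nat_numeral fact_numeral v1 v2;
        (simp add: field_simps power_numeral_reduce)?)
  show v4: "contact_coeff \<kappa> 4 = of_real ((-25 + 25 * \<kappa> - 12 * \<kappa> ^ 2 + 12 * \<kappa> ^ 3) / 288)"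
    by (rule trans[OF rec], simp, simp add: contact_coeff_0 atMost_nat_numeral fact_numeral v1 v2 v3;
        (simp add: field_simps power_numeral_reduce)?)
  show v5: "contact_coeff \<kappa> 5 = of_real ((137 - 150 * \<kappa> + 125 * \<kappa> ^ 2 + 60 * \<kappa> ^ 4) / 7200)"
    by (rule trans[OF rec], simp, simp add: contact_coeff_0 atMost_nat_numeral fact_numeral v1 v2 v3 v4;
        (simp add: field_simps power_numeral_reduce)?)
  show v6: "contact_coeff \<kappa> 6 = of_real ((-882 + 1057 * \<kappa> - 675 * \<kappa> ^ 2 + 1050 * \<kappa> ^ 3 + 540 * \<kappa> ^ 4 + 360 * \<kappa> ^ 5) / 259200)"
    by (rule trans[OF rec], simp, simp add: contact_coeff_0 atMost_nat_numeral fact_numeral v1 v2 v3 v4 v5;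
        (simp add: field_simps power_numeral_reduce)?)
  show v7: "contact_coeff \<kappa> 7 = of_real ((6534 - 8281 * \<kappa> + 8134 * \<kappa> ^ 2 + 3675 * \<kappa> ^ 3 + 16170 * \<kappa> ^ 4 + 8820 * \<kappa> ^ 5 + 2520 * \<kappa> ^ 6) / 12700800)"
    by (rule trans[OF rec], simp, simp add: contact_coeff_0 atMost_nat_numeral fact_numeral v1 v2 v3 v4 v5 v6;
        (simp add: field_simps power_numeral_reduce)?)
  show v8: "contact_coeff \<kappa> 8 = of_real ((-13698 + 18353 * \<kappa> - 12642 * \<kappa> ^ 2 + 40523 * \<kappa> ^ 3 + 70560 * \<kappa> ^ 4 + 76440 * \<kappa> ^ 5 + 30240 * \<kappa> ^ 6 + 5040 * \<kappa> ^ 7) / 203212800)"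
    by (rule trans[OF rec], simp, simp add: contact_coeff_0 atMost_nat_numeral fact_numeral v1 v2 v3 v4 v5 v6 v7;
        (simp add: field_simps power_numeral_reduce)?)
qed

lemma fact_ge_5_2_power: "n \<ge> 8 \<Longrightarrow> (5 / 2) ^ n \<le> (fact n :: real)"
proof (induction n rule: dec_induct)
  case base
  show ?case by (simp add: fact_numeral power_divide)
next
  case (step n)
  have "(5 / 2) * (5 / 2) ^ n \<le> real (Suc n) * fact n"
    using step by (intro mult_mono) auto
  then show ?case by simp
qed

lemma inverse_fact_le:
  assumes "n \<ge> 8"
  shows "1 / fact n \<le> (2 / 5 :: real) ^ n"
proof -
  have "1 / fact n \<le> 1 / (5 / 2 :: real) ^ n"
    using fact_ge_5_2_power[OF assms] by (intro divide_left_mono) auto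
  then show ?thesis by (simp add: power_divide)
qed

text \<open>In the recurrence the term k = 1 has coefficient \<kappa> - 1, of modulus 1 - \<kappa>
  instead of \<kappa>. With this gain the right-hand side is at most 45 (2/5)^n, so the induction
  already closes at n = 9, just after the explicit coefficients.\<close>

lemma norm_contact_coeff_le:
  assumes \<kappa>: "11 / 25 \<le> \<kappa>" "\<kappa> \<le> 1"
  shows "norm (contact_coeff \<kappa> n) \<le> 5 * (2 / 5) ^ n"
proof (induction n rule: less_induct)
  case (less n)
  have \<kappa>0: "\<kappa> \<noteq> 0" using \<kappa> by auto
  show ?case
  proof (cases "n < 9")
    case True
    \<comment> \<open>For the explicit coefficients it suffices to treat the powers of \<kappa> as
      independent numbers in [0, 1], apart from \<open>\<kappa> ^ 2 \<le> \<kappa>\<close>.\<close>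
    have p: "0 \<le> \<kappa> ^ i" "\<kappa> ^ i \<le> 1" for i using \<kappa> by (auto intro: power_le_one)
    have sq: "\<kappa> ^ 2 \<le> \<kappa>" using \<kappa> mult_left_le[of \<kappa> \<kappa>] by (simp add: power2_eq_square)
    note facts = p[of 2] p[of 3] p[of 4] p[of 5] p[of 6] p[of 7] sq \<kappa>
    have pw: "(2 / 5 :: real) ^ 2 = 4 / 25" "(2 / 5 :: real) ^ 3 = 8 / 125" "(2 / 5 :: real) ^ 4 = 16 / 625" "(2 / 5 :: real) ^ 5 = 32 / 3125" "(2 / 5 :: real) ^ 6 = 64 / 15625" "(2 / 5 :: real) ^ 7 = 128 / 78125" "(2 / 5 :: real) ^ 8 = 256 / 390625"
      by (simp_all add: power_divide)
    have "norm (contact_coeff \<kappa> 0) \<le> 5 * (2 / 5) ^ 0" "norm (contact_coeff \<kappa> (Suc 0)) \<le> 5 * (2 / 5) ^ Suc 0"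
      using contact_coeff_values(1)[OF \<kappa>0] by (simp_all add: contact_coeff_0)
    moreover have "norm (contact_coeff \<kappa> 2) \<le> 5 * (2 / 5) ^ 2"
      unfolding contact_coeff_values[OF \<kappa>0] norm_of_real abs_le_iff pw by (rule conjI; (simp add: field_simps)?; use facts in linarith)
    moreover have "norm (contact_coeff \<kappa> 3) \<le> 5 * (2 / 5) ^ 3"
      unfolding contact_coeff_values[OF \<kappa>0] norm_of_real abs_le_iff pw by (rule conjI; (simp add: field_simps)?; use facts in linarith)
    moreover have "norm (contact_coeff \<kappa> 4) \<le> 5 * (2 / 5) ^ 4"
      unfolding contact_coeff_values[OF \<kappa>0] norm_of_real abs_le_iff pw by (rule conjI; (simp add: field_simps)?; use facts in linarith)
    moreover have "norm (contact_coeff \<kappa> 5) \<le> 5 * (2 / 5) ^ 5"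
      unfolding contact_coeff_values[OF \<kappa>0] norm_of_real abs_le_iff pw by (rule conjI; (simp add: field_simps)?; use facts in linarith)
    moreover have "norm (contact_coeff \<kappa> 6) \<le> 5 * (2 / 5) ^ 6"
      unfolding contact_coeff_values[OF \<kappa>0] norm_of_real abs_le_iff pw by (rule conjI; (simp add: field_simps)?; use facts in linarith)
    moreover have "norm (contact_coeff \<kappa> 7) \<le> 5 * (2 / 5) ^ 7"
      unfolding contact_coeff_values[OF \<kappa>0] norm_of_real abs_le_iff pw by (rule conjI; (simp add: field_simps)?; use facts in linarith)
    moreover have "norm (contact_coeff \<kappa> 8) \<le> 5 * (2 / 5) ^ 8"
      unfolding contact_coeff_values[OF \<kappa>0] norm_of_real abs_le_iff pw by (rule conjI; (simp add: field_simps)?; use facts in linarith)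
    moreover have "n = 0 \<or> n = Suc 0 \<or> n = 2 \<or> n = 3 \<or> n = 4 \<or> n = 5 \<or> n = 6 \<or> n = 7 \<or> n = 8"
      using True by arith
    ultimately show ?thesis by metis
  next
    case False
    define c where "c = (\<lambda>k. of_real \<kappa> * (if k = 0 then 0 else 1 / fact k) - (if k = 1 then 1 else 0 :: complex))"
    define x where "x = (2 / 5 :: real) ^ n"
    have x1: "(2 / 5 :: real) ^ (n - 1) = 5 / 2 * x"
      using False by (cases n) (auto simp: x_def)
    have x0: "x \<ge> 0" by (simp add: x_def)
    have "of_nat n * contact_coeff \<kappa> n = (\<Sum>k\<le>n. c k * contact_coeff \<kappa> (n - k)) - (- 1) ^ n / fact n"
      using contact_coeff_rec[OF \<kappa>0, of n] False by (simp add: c_def)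
    then have "norm (of_nat n * contact_coeff \<kappa> n) \<le> norm (\<Sum>k\<le>n. c k * contact_coeff \<kappa> (n - k)) + norm ((- 1) ^ n / fact n :: complex)"
      by (simp only: norm_triangle_ineq4)
    moreover have "norm (\<Sum>k\<le>n. c k * contact_coeff \<kappa> (n - k)) \<le> (\<Sum>k\<le>n. norm (c k * contact_coeff \<kappa> (n - k)))"
      by (rule norm_sum)
    moreover have "(\<Sum>k\<le>n. norm (c k * contact_coeff \<kappa> (n - k))) \<le> (\<Sum>k\<le>n. 5 * \<kappa> * ((2 / 5) ^ (n - k) / fact k)
        - (if k = 0 then 5 * \<kappa> * x else 0) - (if k = 1 then (2 * \<kappa> - 1) * (25 / 2 * x) else 0))"
    proof (intro sum_mono)
      fix k assume k: "k \<in> {..n}"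
      consider "k = 0" | "k = 1" | "k > 1" by linarith
      then show "norm (c k * contact_coeff \<kappa> (n - k)) \<le> 5 * \<kappa> * ((2 / 5) ^ (n - k) / fact k)
        - (if k = 0 then 5 * \<kappa> * x else 0) - (if k = 1 then (2 * \<kappa> - 1) * (25 / 2 * x) else 0)"
      proof cases
        case 1
        then show ?thesis by (simp add: c_def x_def)
      next
        case 2
        have "c k = of_real (\<kappa> - 1)" using 2 by (simp add: c_def)
        then have "norm (c k) = 1 - \<kappa>" using \<kappa> by (simp only: norm_of_real)
        then have "norm (c k * contact_coeff \<kappa> (n - k)) \<le> (1 - \<kappa>) * (5 * (2 / 5) ^ (n - 1))"
          using less.IH[of "n - 1"] 2 \<kappa> False by (simp add: norm_mult mult_left_mono)
        then show ?thesis unfolding 2 x1 by (simp add: field_simps)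
      next
        case 3
        then have "norm (c k) = \<kappa> / fact k" using \<kappa> by (simp add: c_def norm_mult norm_divide)
        moreover have "norm (contact_coeff \<kappa> (n - k)) \<le> 5 * (2 / 5) ^ (n - k)" using less.IH[of "n - k"] 3 False by simp
        ultimately have "norm (c k * contact_coeff \<kappa> (n - k)) \<le> \<kappa> / fact k * (5 * (2 / 5) ^ (n - k))"
          unfolding norm_mult using \<kappa> by (simp only:) (intro mult_left_mono, auto)
        then show ?thesis using 3 by (simp add: mult_ac)
      qed
    qed
    moreover have "(\<Sum>k\<le>n. 5 * \<kappa> * ((2 / 5) ^ (n - k) / fact k)
        - (if k = 0 then 5 * \<kappa> * x else 0) - (if k = 1 then (2 * \<kappa> - 1) * (25 / 2 * x) else 0))
        = 5 * \<kappa> * (\<Sum>k\<le>n. (2 / 5) ^ (n - k) / fact k) - 5 * \<kappa> * x - (2 * \<kappa> - 1) * (25 / 2 * x)"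
      using False by (simp add: sum_subtractf sum_distrib_left)
    moreover have "5 * \<kappa> * (\<Sum>k\<le>n. (2 / 5) ^ (n - k) / fact k) \<le> 5 * \<kappa> * (x * (123 / 10))"
      unfolding x_def using \<kappa> by (intro mult_left_mono sum_geometric_fact) auto
    moreover have "norm ((- 1) ^ n / fact n :: complex) \<le> x"
      unfolding x_def using inverse_fact_le[of n] False by (simp add: norm_divide norm_power)
    ultimately have le: "real n * norm (contact_coeff \<kappa> n) \<le> 5 * \<kappa> * (x * (123 / 10)) - 5 * \<kappa> * x - (2 * \<kappa> - 1) * (25 / 2 * x) + x"
      by (simp only: norm_mult norm_of_nat)
    have "5 * \<kappa> * (x * (123 / 10)) - 5 * \<kappa> * x - (2 * \<kappa> - 1) * (25 / 2 * x) + x = (63 / 2 * \<kappa> + 27 / 2) * x"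
      by (simp add: field_simps)
    also have "\<dots> \<le> 45 * x" using \<kappa> x0 by (intro mult_right_mono) auto
    also have "\<dots> \<le> real n * (5 * x)" using False x0 mult_right_mono[of 9 "real n" "5 * x"] by simp
    finally have "real n * norm (contact_coeff \<kappa> n) \<le> real n * (5 * x)" using le by linarith
    then show ?thesis using False by (simp add: x_def)
  qed
qed

fun paff :: "nat \<Rightarrow> int \<Rightarrow> int list \<Rightarrow> int list \<Rightarrow> int list" where
  "paff d D K [] = []"
| "paff d D K (c # cs) = padd [D ^ d * c] (pmul K (paff (d - 1) D K cs))"

lemma peval_paff:
  assumes "D \<noteq> 0"
  shows "length cs \<le> Suc d \<Longrightarrow> peval (paff d D K cs) s = of_int D ^ d * peval cs (peval K s / of_int D)"
proof (induction cs arbitrary: d)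
  case (Cons c cs)
  show ?case
  proof (cases d)
    case 0
    then show ?thesis using Cons.prems by (simp add: peval_padd peval_pmul)
  next
    case (Suc e)
    then have "peval (paff e D K cs) s = of_int D ^ e * peval cs (peval K s / of_int D)"
      using Cons.IH[of e] Cons.prems by simp
    then show ?thesis using assms by (simp add: Suc peval_padd peval_pmul field_simps)
  qed
qed simp

text \<open>Row \<open>j\<close> is \<open>317520000\<close> times the coefficient of \<open>z\<^sup>j\<^sup>+\<^sup>1\<close> in
  \<open>contact_fun \<kappa> z - rho \<kappa> * (1 - exp (- z))\<close>, as a polynomial in \<open>\<kappa>\<close>; the next definition
  substitutes \<open>\<kappa> = (11 + 14 s) / 25\<close>.\<close>
definition contact_list :: "int list list" where
  "contact_list = [[70489440, -155584800, 130183200],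
    [-114624720, 236552400, -65091600],
    [55848240, -105310800, 74617200],
    [-17269560, 34045200, -18654300, 13230000],
    [3983112, -7911540, 6597360, 0, 2646000],
    [-737352, 1510915, -1007685, 1286250, 661500, 441000],
    [114336, -237895, 229180, 91875, 404250, 220500, 63000]]"

definition contact_list_unit :: "int list list" where
  "contact_list_unit = map (paff 6 25 [11, 14]) contact_list"

text \<open>The subtracted integer is 7/1000 times 317520000 * 25^6, the scale of the rows. This
  margin absorbs the tail of the series from degree 8 on, which is below 0.0066.\<close>

lemma check_contact_list:
  "pnonneg 8 8 [True, False, True, False, True, False, True, False, True, False]
    (padd2 (pcheb [-1, 2] contact_list_unit [1] [-1, 2]) [[- 542636718750000]])"
  by code_simp

lemma contact_list_values:
  assumes \<kappa>0: "\<kappa> \<noteq> 0" and "j < 7"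
  shows "contact_coeff \<kappa> (Suc j) + of_real (rho \<kappa> * ((- 1) ^ Suc j / fact (Suc j))) = of_real (peval (contact_list ! j) \<kappa> / 317520000)"
proof -
  have "1 + rho \<kappa> * (-1 / 1) = peval (contact_list ! 0) \<kappa> / 317520000"
    unfolding rho_def by (simp add: contact_list_def field_simps power_numeral_reduce)
  then have j0: "contact_coeff \<kappa> (Suc 0) + of_real (rho \<kappa> * (-1 / 1)) = of_real (peval (contact_list ! 0) \<kappa> / 317520000)"
    unfolding contact_coeff_values[OF \<kappa>0] by (metis of_real_add of_real_1)
  have "(-3 + 2 * \<kappa>) / 4 + rho \<kappa> * (1 / 2) = peval (contact_list ! 1) \<kappa> / 317520000"
    unfolding rho_def by (simp add: contact_list_def field_simps power_numeral_reduce)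
  then have j1: "contact_coeff \<kappa> 2 + of_real (rho \<kappa> * (1 / 2)) = of_real (peval (contact_list ! 1) \<kappa> / 317520000)"
    unfolding contact_coeff_values[OF \<kappa>0] of_real_add[symmetric] by (simp only:)
  have "(11 - 9 * \<kappa> + 6 * \<kappa> ^ 2) / 36 + rho \<kappa> * (-1 / 6) = peval (contact_list ! 2) \<kappa> / 317520000"
    unfolding rho_def by (simp add: contact_list_def field_simps power_numeral_reduce)
  then have j2: "contact_coeff \<kappa> 3 + of_real (rho \<kappa> * (-1 / 6)) = of_real (peval (contact_list ! 2) \<kappa> / 317520000)"
    unfolding contact_coeff_values[OF \<kappa>0] of_real_add[symmetric] by (simp only:)
  have "(-25 + 25 * \<kappa> - 12 * \<kappa> ^ 2 + 12 * \<kappa> ^ 3) / 288 + rho \<kappa> * (1 / 24) = peval (contact_list ! 3) \<kappa> / 317520000"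
    unfolding rho_def by (simp add: contact_list_def field_simps power_numeral_reduce)
  then have j3: "contact_coeff \<kappa> 4 + of_real (rho \<kappa> * (1 / 24)) = of_real (peval (contact_list ! 3) \<kappa> / 317520000)"
    unfolding contact_coeff_values[OF \<kappa>0] of_real_add[symmetric] by (simp only:)
  have "(137 - 150 * \<kappa> + 125 * \<kappa> ^ 2 + 60 * \<kappa> ^ 4) / 7200 + rho \<kappa> * (-1 / 120) = peval (contact_list ! 4) \<kappa> / 317520000"
    unfolding rho_def by (simp add: contact_list_def field_simps power_numeral_reduce)
  then have j4: "contact_coeff \<kappa> 5 + of_real (rho \<kappa> * (-1 / 120)) = of_real (peval (contact_list ! 4) \<kappa> / 317520000)"
    unfolding contact_coeff_values[OF \<kappa>0] of_real_add[symmetric] by (simp only:)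
  have "(-882 + 1057 * \<kappa> - 675 * \<kappa> ^ 2 + 1050 * \<kappa> ^ 3 + 540 * \<kappa> ^ 4 + 360 * \<kappa> ^ 5) / 259200 + rho \<kappa> * (1 / 720) = peval (contact_list ! 5) \<kappa> / 317520000"
    unfolding rho_def by (simp add: contact_list_def field_simps power_numeral_reduce)
  then have j5: "contact_coeff \<kappa> 6 + of_real (rho \<kappa> * (1 / 720)) = of_real (peval (contact_list ! 5) \<kappa> / 317520000)"
    unfolding contact_coeff_values[OF \<kappa>0] of_real_add[symmetric] by (simp only:)
  have "(6534 - 8281 * \<kappa> + 8134 * \<kappa> ^ 2 + 3675 * \<kappa> ^ 3 + 16170 * \<kappa> ^ 4 + 8820 * \<kappa> ^ 5 + 2520 * \<kappa> ^ 6) / 12700800 + rho \<kappa> * (-1 / 5040) = peval (contact_list ! 6) \<kappa> / 317520000"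
    unfolding rho_def by (simp add: contact_list_def field_simps power_numeral_reduce)
  then have j6: "contact_coeff \<kappa> 7 + of_real (rho \<kappa> * (-1 / 5040)) = of_real (peval (contact_list ! 6) \<kappa> / 317520000)"
    unfolding contact_coeff_values[OF \<kappa>0] of_real_add[symmetric] by (simp only:)
  have "(- 1) ^ Suc 0 / fact (Suc 0) = (-1 / 1 :: real)" "contact_coeff \<kappa> (Suc 0) = contact_coeff \<kappa> (Suc 0)"
    by simp_all
  note p0 = j0[folded this(1)]
  have "(- 1) ^ Suc (Suc 0) / fact (Suc (Suc 0)) = (1 / 2 :: real)" "contact_coeff \<kappa> (Suc (Suc 0)) = contact_coeff \<kappa> 2"
    by (simp, unfold numeral_2_eq_2, rule refl)
  note p1 = j1[folded this(1,2)]
  have "(- 1) ^ Suc 2 / fact (Suc 2) = (-1 / 6 :: real)" "contact_coeff \<kappa> (Suc 2) = contact_coeff \<kappa> 3"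
    by (simp_all add: fact_numeral)
  note p2 = j2[folded this(1,2)]
  have "(- 1) ^ Suc 3 / fact (Suc 3) = (1 / 24 :: real)" "contact_coeff \<kappa> (Suc 3) = contact_coeff \<kappa> 4"
    by (simp_all add: fact_numeral)
  note p3 = j3[folded this(1,2)]
  have "(- 1) ^ Suc 4 / fact (Suc 4) = (-1 / 120 :: real)" "contact_coeff \<kappa> (Suc 4) = contact_coeff \<kappa> 5"
    by (simp_all add: fact_numeral)
  note p4 = j4[folded this(1,2)]
  have "(- 1) ^ Suc 5 / fact (Suc 5) = (1 / 720 :: real)" "contact_coeff \<kappa> (Suc 5) = contact_coeff \<kappa> 6"
    by (simp_all add: fact_numeral)
  note p5 = j5[folded this(1,2)]
  have "(- 1) ^ Suc 6 / fact (Suc 6) = (-1 / 5040 :: real)" "contact_coeff \<kappa> (Suc 6) = contact_coeff \<kappa> 7"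
    by (simp_all add: fact_numeral)
  note p6 = j6[folded this(1,2)]
  have "j = 0 \<or> j = Suc 0 \<or> j = 2 \<or> j = 3 \<or> j = 4 \<or> j = 5 \<or> j = 6" using \<open>j < 7\<close> by arith
  then show ?thesis
    by (elim disjE; hypsubst) (rule p0 p1[unfolded One_nat_def] p2 p3 p4 p5 p6)+
qed

lemma contact_list_unit_values:
  assumes "\<kappa> = (11 + 14 * s) / 25" "\<kappa> \<noteq> 0" "j < 7"
  shows "contact_coeff \<kappa> (Suc j) + of_real (rho \<kappa> * ((- 1) ^ Suc j / fact (Suc j))) = of_real (peval (contact_list_unit ! j) s / 77519531250000000)"
proof -
  have len: "length contact_list = 7" "list_all (\<lambda>c. length c \<le> 7) contact_list" by (simp_all add: contact_list_def)
  then have "length (contact_list ! j) \<le> Suc 6" using assms(3) by (simp add: list_all_length)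
  moreover have "peval [11, 14] s / of_int 25 = \<kappa>" using assms(1) by (simp add: mult.commute)
  ultimately have "peval (contact_list_unit ! j) s = 25 ^ 6 * peval (contact_list ! j) \<kappa>"
    using peval_paff[of 25 "contact_list ! j" 6 "[11, 14]" s] assms(3) len by (simp add: contact_list_unit_def)
  then show ?thesis using contact_list_values[OF assms(2,3)] by simp
qed

text \<open>On the unit circle \<open>conj \<zeta> = 1 / \<zeta>\<close>, so that both sides are real parts of functions that are
  holomorphic in \<open>\<zeta>\<close>; the power series coefficients of the difference are polynomials in \<open>\<kappa>\<close>.\<close>
lemma contact_inequality:
  assumes \<kappa>: "11 / 25 \<le> \<kappa>" "\<kappa> \<le> 1" and z: "norm z = 1"
  shows "\<kappa> * rho \<kappa> * Re (cnj z * (1 - exp (- z))) < Re (cnj z * (exp (- z) * (exp (of_real \<kappa> * ell z) - 1)))"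
proof -
  have \<kappa>0: "\<kappa> \<noteq> 0" using \<kappa> by auto
  define s where "s = (25 * \<kappa> - 11) / 14"
  have s: "0 \<le> s" "s \<le> 1" "\<kappa> = (11 + 14 * s) / 25" using \<kappa> by (auto simp: s_def field_simps)
  define t where "t = (1 + Re z) / 2"
  have "\<bar>Re z\<bar> \<le> 1" using abs_Re_le_cmod[of z] z by simp
  then have t: "0 \<le> t" "t \<le> 1" by (auto simp: t_def)
  have X: "peval [-1, 2] t = Re z" by (simp add: t_def field_simps)
  have zc: "cnj z * z = 1" using z by (simp add: mult.commute complex_norm_square[symmetric])
  define e where "e = (\<lambda>n::nat. (if n = 0 then 1 else 0) - (- 1) ^ n / fact n :: complex)"
  define x where "x = (\<lambda>n. contact_coeff \<kappa> n - of_real (rho \<kappa>) * e n)"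
  define F where "F = contact_fun \<kappa> z - of_real (rho \<kappa>) * (1 - exp (- z))"
  have "(\<lambda>n. e n * z ^ n) sums (1 - exp (- z))"
  proof -
    have "(\<lambda>n. (- z) ^ n /\<^sub>R fact n) sums exp (- z)" by (rule exp_converges)
    then have "(\<lambda>n. (if n = 0 then 1 else 0) - (- z) ^ n /\<^sub>R fact n) sums (1 - exp (- z))"
      by (intro sums_diff) (use sums_If_finite_set[of "{0::nat}" "\<lambda>n. 1::complex"] in simp_all)
    moreover have "(if n = 0 then 1 else 0) - (- z) ^ n /\<^sub>R fact n = e n * z ^ n" for n
      by (auto simp: e_def power_minus[of z] scaleR_conv_of_real field_simps)
    ultimately show ?thesis by simp
  qed
  moreover have "(\<lambda>n. contact_coeff \<kappa> n * z ^ n) sums contact_fun \<kappa> z"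
    unfolding contact_coeff_def by (rule entire_power_series_sums[OF contact_fun_holomorphic])
  ultimately have "(\<lambda>n. contact_coeff \<kappa> n * z ^ n - of_real (rho \<kappa>) * (e n * z ^ n)) sums F"
    unfolding F_def by (intro sums_diff sums_mult)
  then have F: "(\<lambda>n. x n * z ^ n) sums F" by (simp add: x_def algebra_simps)
  have "norm (F - (\<Sum>n<8. x n * z ^ n)) \<le> 6 * (2 / 5) ^ 8 / (1 - 2 / 5)"
  proof (rule power_series_tail[OF F z])
    fix n :: nat assume n: "n \<ge> 8"
    have "norm (e n) = 1 / fact n" using n by (simp add: e_def norm_divide norm_power)
    then have "norm (of_real (rho \<kappa>) * e n) \<le> 1 * (2 / 5) ^ n"
      unfolding norm_mult using rho_bounds[OF \<kappa>] inverse_fact_le[OF n] by (intro mult_mono) auto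
    then show "norm (x n) \<le> 6 * (2 / 5) ^ n"
      unfolding x_def using norm_contact_coeff_le[OF \<kappa>, of n] norm_triangle_ineq4[of "contact_coeff \<kappa> n" "of_real (rho \<kappa>) * e n"] by linarith
  qed auto
  then have tail: "norm (cnj z * (F - (\<Sum>n<8. x n * z ^ n))) < 7 / 1000"
    using z by (simp add: norm_mult power_divide)
  have x0: "x 0 = 0" by (simp add: x_def e_def contact_coeff_0)
  have xv: "x (Suc j) = of_real (peval (contact_list_unit ! j) s / 77519531250000000)" if "j < 7" for j
    using contact_list_unit_values[OF s(3) \<kappa>0 that] by (simp add: x_def e_def)
  \<comment> \<open>The coefficient \<open>x 0\<close> vanishes, so multiplying by conj z = 1 / z
    only lowers the degrees by one.\<close>
  have "cnj z * (\<Sum>n<8. x n * z ^ n) = (\<Sum>j<7. x (Suc j) * z ^ j)"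
  proof -
    have "(\<Sum>n<Suc 7. x n * z ^ n) = (\<Sum>j<7. x (Suc j) * z ^ Suc j)"
      unfolding sum.lessThan_Suc_shift by (simp add: x0)
    moreover have "cnj z * (x (Suc j) * z ^ Suc j) = x (Suc j) * z ^ j" for j
    proof -
      have "cnj z * (x (Suc j) * z ^ Suc j) = (cnj z * z) * (x (Suc j) * z ^ j)" by (simp add: mult_ac)
      then show ?thesis unfolding zc by simp
    qed
    ultimately have "cnj z * (\<Sum>n<Suc 7. x n * z ^ n) = (\<Sum>j<7. x (Suc j) * z ^ j)"
      by (simp only: sum_distrib_left)
    then show ?thesis by simp
  qed
  then have "Re (cnj z * (\<Sum>n<8. x n * z ^ n)) = (\<Sum>j<7. peval (contact_list_unit ! j) s / 77519531250000000 * Re (z ^ j))"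
    by (simp add: xv)
  also have "\<dots> = (\<Sum>j<7. peval (contact_list_unit ! j) s * Re (z ^ j)) / 77519531250000000" by (simp add: sum_divide_distrib)
  also have "\<dots> \<ge> 7 / 1000"
  proof -
    have len: "length contact_list_unit = 7" by (simp add: contact_list_unit_def contact_list_def)
    have "peval2 (pcheb [-1, 2] contact_list_unit [1] [-1, 2]) s t = (\<Sum>j<length contact_list_unit. peval (contact_list_unit ! j) s * Re (z ^ (0 + j)))"
    proof (rule peval2_pcheb)
      show "Re (z ^ Suc (Suc n)) = 2 * peval [- 1, 2] t * Re (z ^ Suc n) - Re (z ^ n)" for n
        unfolding X by (rule Re_power_unit_circle(1)[OF z])
    qed (use X in simp_all)
    then have "0 \<le> (\<Sum>j<7. peval (contact_list_unit ! j) s * Re (z ^ j)) - 542636718750000"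
      using pnonneg_sound[OF check_contact_list s(1,2) t] len by (simp add: peval2_padd2)
    then show ?thesis by (simp add: field_simps)
  qed
  finally have main: "Re (cnj z * (\<Sum>n<8. x n * z ^ n)) \<ge> 7 / 1000" .
  have "Re (cnj z * F) = Re (cnj z * (\<Sum>n<8. x n * z ^ n)) + Re (cnj z * (F - (\<Sum>n<8. x n * z ^ n)))"
    by (simp add: algebra_simps)
  moreover have "\<bar>Re (cnj z * (F - (\<Sum>n<8. x n * z ^ n)))\<bar> < 7 / 1000"
    using tail abs_Re_le_cmod le_less_trans by blast
  ultimately have "0 < Re (cnj z * F)" using main by linarith
  then have "0 < \<kappa> * Re (cnj z * F)" using \<kappa> by simp
  also have "\<kappa> * Re (cnj z * F) = Re (cnj z * (of_real \<kappa> * F))" by (simp add: algebra_simps)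
  also have "of_real \<kappa> * F = exp (- z) * (exp (of_real \<kappa> * ell z) - 1) - of_real (\<kappa> * rho \<kappa>) * (1 - exp (- z))"
  proof -
    have "of_real \<kappa> * contact_fun \<kappa> z = exp (- z) * (exp (of_real \<kappa> * ell z) - 1)"
      using \<kappa>0 by (simp add: contact_fun_def)
    then show ?thesis by (simp only: F_def right_diff_distrib of_real_mult mult.assoc)
  qed
  finally show ?thesis by (simp add: algebra_simps)
qed

subsection \<open>Starlikeness of Bernardi transforms\<close>

text \<open>In the notation of the proof, the supporting line demands a N2 \<le> (1 - m \<kappa>) N1
  at a contact. The contact inequality and the choice of \<kappa> give a N2 > (1 - \<kappa>) N1,
  which is at least (1 - m \<kappa>) N1 because N1 \<ge> 0 and m \<ge> 1.\<close>

lemma dominated_quotient: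
  fixes Q H :: "complex \<Rightarrow> complex" and a \<kappa> :: real
  assumes a: "a > 0" and \<kappa>: "11 / 25 \<le> \<kappa>" "\<kappa> \<le> 1" "1 - \<kappa> = a * (\<kappa> * rho \<kappa>)"
    and Q: "Q holomorphic_on ball 0 1" "Q 0 = 1"
    and ode: "\<And>z. norm z < 1 \<Longrightarrow> z * deriv Q z = of_real a - of_real a * Q z - Q z * (exp (h z) - 1)"
    and h: "\<And>z. norm z < 1 \<Longrightarrow> norm (h z) < 1"
  obtains w where "\<And>z. norm z < 1 \<Longrightarrow> norm (w z) < 1"
    "\<And>z. norm z < 1 \<Longrightarrow> Q z = exp (- of_real \<kappa> * ell (w z))"
proof -
  have \<kappa>0: "0 < \<kappa>" using \<kappa> by auto
  have hol: "(\<lambda>z. exp (- of_real \<kappa> * ell z)) holomorphic_on ball 0 (21 / 20)"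
    by (intro holomorphic_intros ell_holomorphic)
  have R: "(1::real) < 21 / 20" by simp
  obtain w where w: "w ` ball 0 1 \<subseteq> ball 0 1"
      "\<And>z. z \<in> ball 0 1 \<Longrightarrow> Q z = exp (- of_real \<kappa> * ell (w z))"
  proof (rule Miller_Mocanu[OF R hol exp_ell_univalent[OF \<kappa>0 \<kappa>(2)] Q(1)])
    show "Q 0 = exp (- of_real \<kappa> * ell 0)" by (simp add: Q)
    fix z \<zeta> :: complex and m :: real
    assume z: "norm z < 1" and \<zeta>: "norm \<zeta> = 1" and m: "1 \<le> m"
      and contact: "Q z = exp (- of_real \<kappa> * ell \<zeta>)"
        "z * deriv Q z = of_real m * (\<zeta> * deriv (\<lambda>z. exp (- of_real \<kappa> * ell z)) \<zeta>)"
    define W where "W = exp (of_real \<kappa> * ell \<zeta>) - 1"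
    have QW: "Q z * (1 + W) = 1"
      unfolding contact(1) W_def by (simp flip: exp_add)
    have "of_real a - of_real a * Q z - Q z * (exp (h z) - 1)
        = of_real m * (- of_real \<kappa> * (exp \<zeta> - 1) * Q z)"
      using contact(2) unfolding deriv_exp_ell ode[OF z] contact(1) .
    moreover have "(\<alpha> - \<alpha> * q - q * x) * v = \<alpha> * v - \<alpha> * (q * v) - (q * v) * x"
        "(\<mu> * (k * x * q)) * v = \<mu> * (k * x * (q * v))" for \<alpha> \<mu> k q x v :: complex
      by algebra+
    ultimately have "of_real a * (1 + W) - of_real a * (Q z * (1 + W)) - (Q z * (1 + W)) * (exp (h z) - 1)
        = of_real m * (- of_real \<kappa> * (exp \<zeta> - 1) * (Q z * (1 + W)))"
      by metis
    then have H: "exp (h z) = 1 + of_real a * W + of_real (m * \<kappa>) * (exp \<zeta> - 1)"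
      unfolding QW by (simp add: algebra_simps)
    define N1 where "N1 = Re (cnj \<zeta> * (1 - exp (- \<zeta>)))"
    define N2 where "N2 = Re (cnj \<zeta> * (exp (- \<zeta>) * W))"
    have e: "exp (- \<zeta>) * exp \<zeta> = 1" by (simp flip: exp_add)
    have "exp (h z - \<zeta>) = exp (- \<zeta>) * exp (h z)" by (simp flip: exp_add)
    also have "\<dots> = 1 - (1 - exp (- \<zeta>)) + of_real a * (exp (- \<zeta>) * W)
        + of_real (m * \<kappa>) * (exp (- \<zeta>) * exp \<zeta> - exp (- \<zeta>))"
      unfolding H by (simp add: algebra_simps)
    finally have ex: "exp (h z - \<zeta>) = 1 - (1 - exp (- \<zeta>)) + of_real a * (exp (- \<zeta>) * W)
        + of_real (m * \<kappa>) * (exp (- \<zeta>) * exp \<zeta> - exp (- \<zeta>))" .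
    have "cnj \<zeta> * exp (h z - \<zeta>) = cnj \<zeta> - cnj \<zeta> * (1 - exp (- \<zeta>))
        + of_real a * (cnj \<zeta> * (exp (- \<zeta>) * W)) + of_real (m * \<kappa>) * (cnj \<zeta> * (1 - exp (- \<zeta>)))"
      unfolding ex e by (simp add: algebra_simps)
    then have "Re (cnj \<zeta> * exp (h z - \<zeta>)) = Re \<zeta> - N1 + a * N2 + (m * \<kappa>) * N1"
      unfolding N1_def N2_def by (simp only: plus_complex.sel minus_complex.sel Re_complex_of_real
        times_complex.sel Im_complex_of_real complex_cnj(1)) simp
    moreover have "Re (cnj \<zeta> * exp (h z - \<zeta>)) \<le> Re \<zeta>"
      by (rule exp_disc_supporting_line[OF \<zeta> h[OF z]])
    moreover have N1: "N1 \<ge> 0"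
      using exp_disc_supporting_line[OF \<zeta>, of 0] by (simp add: N1_def right_diff_distrib)
    moreover have "a * (\<kappa> * rho \<kappa> * N1) < a * N2"
      using contact_inequality[OF \<kappa>(1,2) \<zeta>] a unfolding N1_def N2_def W_def
      by (intro mult_strict_left_mono) auto
    moreover have "a * (\<kappa> * rho \<kappa> * N1) = (1 - \<kappa>) * N1" unfolding \<kappa>(3) by simp
    moreover have "1 * (\<kappa> * N1) \<le> m * (\<kappa> * N1)" using m \<kappa>0 N1 by (intro mult_right_mono) auto
    ultimately show False by (simp add: algebra_simps)
  qed (rule that)
  show thesis
    by (rule that[of w]) (use w in \<open>auto simp: image_subset_iff\<close>)
qed

text \<open>The Janowski disc meets the real axis between 1 - (A - B) / (1 - B) and 1 + (A - B) / (1
  + B); for a point 1 + a W, dividing the offsets by a gives - 1 / y1 and 1 / y2. Both inequalities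
  are the same quadratic in \<open>W\<close> up to a positive factor.\<close>

lemma disc_fun_janowski:
  fixes A B a y1 y2 :: real and W :: complex
  assumes M: "A - B > 0" and y: "y1 = a * (1 - B) / (A - B)" "y2 = a * (1 + B) / (A - B)" "y1 > 0" "y2 > 0"
    and lt: "disc_fun (1 - 1 / y1) (1 + 1 / y2) (1 + W) < 0"
  shows "norm (of_real a * W) < norm (of_real (A - B) - of_real B * (of_real a * W))"
proof -
  define M where "M = A - B"
  have M0: "M > 0" using M by (simp add: M_def)
  define n where "n = (norm W)\<^sup>2"
  have n: "n = (Re W)\<^sup>2 + (Im W)\<^sup>2" by (simp add: n_def cmod_power2)
  have "disc_fun (1 - 1 / y1) (1 + 1 / y2) (1 + W) = n - (1 / y2 - 1 / y1) * Re W - 1 / (y1 * y2)"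
    unfolding disc_fun_def cmod_power2 n using y(3,4) by (simp add: field_simps power2_eq_square)
  then have "(n - (1 / y2 - 1 / y1) * Re W - 1 / (y1 * y2)) * (y1 * y2) < 0"
    using lt y(3,4) by (simp add: mult_less_0_iff)
  moreover have "(n - (1 / y2 - 1 / y1) * Re W - 1 / (y1 * y2)) * (y1 * y2) = y1 * y2 * n - (y1 - y2) * Re W - 1"
    using y(3,4) by (simp add: field_simps)
  ultimately have "(y1 * y2 * n - (y1 - y2) * Re W - 1) * M\<^sup>2 < 0" using M0 by (simp add: mult_less_0_iff)
  moreover have "y1 * M = a * (1 - B)" "y2 * M = a * (1 + B)" using y M0 by (simp_all add: M_def)
  then have "y1 * y2 * M\<^sup>2 = a\<^sup>2 * (1 - B\<^sup>2)" "(y1 - y2) * M\<^sup>2 = - 2 * a * B * M"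
    by algebra+
  then have "(y1 * y2 * n - (y1 - y2) * Re W - 1) * M\<^sup>2 = a\<^sup>2 * (1 - B\<^sup>2) * n + 2 * a * B * M * Re W - M\<^sup>2"
    by algebra
  ultimately have "a\<^sup>2 * n < M\<^sup>2 - 2 * a * B * M * Re W + a\<^sup>2 * B\<^sup>2 * n" by (simp add: algebra_simps)
  also have "\<dots> = (norm (of_real M - of_real B * (of_real a * W)))\<^sup>2"
    unfolding cmod_power2 n by (simp add: power2_eq_square algebra_simps)
  also have "a\<^sup>2 * n = (norm (of_real a * W))\<^sup>2" by (simp add: n_def norm_mult power_mult_distrib)
  finally show ?thesis unfolding M_def by (rule power2_less_imp_less) simp
qed

text \<open>The Schwarz function is explicit: (p - 1) / (A - B p) inverts the Janowski map, and
  \<open>lt\<close> says that its modulus is below 1.\<close>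

lemma subordinate_janowskiI:
  fixes A B :: real
  assumes AB: "-1 < B" "B < A" "A \<le> 1" and p: "p holomorphic_on ball 0 1" "p 0 = 1"
    and lt: "\<And>z. norm z < 1 \<Longrightarrow> norm (p z - 1) < norm (of_real (A - B) - of_real B * (p z - 1))"
  shows "subordinate p (janowski A B)"
proof -
  have B: "\<bar>B\<bar> < 1" using AB by auto
  define w where "w = (\<lambda>z. (p z - 1) / (of_real (A - B) - of_real B * (p z - 1)))"
  have nz: "of_real (A - B) - of_real B * (p z - 1) \<noteq> 0" if "norm z < 1" for z
    using lt[OF that] by (metis norm_ge_zero norm_zero not_less)
  have hw: "w holomorphic_on ball 0 1"
    unfolding w_def using nz by (intro holomorphic_intros p(1)) auto
  have "w z \<in> ball 0 1" if "norm z < 1" for z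
    using lt[OF that] nz[OF that] by (simp add: w_def norm_divide divide_less_eq_1)
  moreover have "p z = janowski A B (w z)" if "norm z < 1" for z
  proof -
    define D where "D = of_real (A - B) - of_real B * (p z - 1)"
    have D: "D \<noteq> 0" using nz[OF that] by (simp add: D_def)
    have wz: "w z = (p z - 1) / D" by (simp only: w_def D_def)
    have "1 + of_real A * w z = (D + of_real A * (p z - 1)) / D"
      using D by (simp add: wz add_divide_distrib)
    also have "D + of_real A * (p z - 1) = of_real (A - B) * p z" by (simp add: D_def algebra_simps)
    finally have 1: "1 + of_real A * w z = of_real (A - B) * p z / D" .
    have "1 + of_real B * w z = (D + of_real B * (p z - 1)) / D"
      using D by (simp add: wz add_divide_distrib)
    also have "D + of_real B * (p z - 1) = of_real (A - B)" by (simp add: D_def)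
    finally have 2: "1 + of_real B * w z = of_real (A - B) / D" .
    have "of_real (A - B) \<noteq> (0::complex)" using AB by (simp del: of_real_diff)
    then show ?thesis unfolding janowski_def 1 2 using D by simp
  qed
  moreover have "janowski A B holomorphic_on ball 0 1"
    using janowski_univalent(1)[OF B, of A] AB
    by (rule_tac holomorphic_on_subset) (use B in \<open>auto intro!: subset_ball simp: field_simps\<close>)
  moreover have "w 0 = 0" by (simp add: w_def p)
  ultimately show ?thesis
    unfolding subordinate_def using p(1) hw by (intro conjI exI[of _ w]) auto
qed

theorem starlike_janowski_bernardi:
  fixes A B c :: real
  assumes AB: "-1 < B" "B < A" "A \<le> 1" and c: "c > -1" and f: "f \<in> starlike_exp"
    and C1: "cond_C1 A B 1 c" and C2: "cond_C2 A B 1 c"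
  shows "bernardi c f \<in> starlike_janowski A B"
proof -
  have fA: "f \<in> class_A" using f by (simp add: starlike_exp_def)
  define a where "a = c + 1"
  have a: "a > 0" using c by (simp add: a_def)
  define M where "M = A - B"
  have M: "M > 0" using AB by (simp add: M_def)
  define y1 y2 where y1: "y1 = a * (1 - B) / M" and y2: "y2 = a * (1 + B) / M"
  \<comment> \<open>These are the two factors of (C2) in terms of a and M. Their signs allow the
    denominators of (C1) to be cleared, and the first one gives y1 > 1, so the target disc lies in
    the right half-plane.\<close>
  have d1: "a * (1 - B) - M > 0" and d2: "a * (1 + B) + M > 0"
    using C2 by (simp_all add: cond_C2_def a_def M_def algebra_simps)
  have y: "y1 > 1" "y2 > 0"
    using d1 M by (simp add: y1 field_simps) (use a M AB in \<open>simp add: y2\<close>)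
  have ay: "a \<le> y1" using a AB M by (simp add: y1 M_def field_simps)
  have e1: "(a * (1 - B) - M) * ((1 + exp 1) * (1 - B) - M) \<le> M"
  proof -
    have "(1 - A) / (1 - B) + exp 1 \<le> M / ((1 - B) * (a * (1 - B) - M))"
      using C1 by (simp add: cond_C1_def M_def a_def algebra_simps)
    then have "((1 - A) / (1 - B) + exp 1) * ((1 - B) * (a * (1 - B) - M)) \<le> M"
      using d1 AB by (subst (asm) pos_le_divide_eq) auto
    moreover have "((1 - A) / (1 - B) + exp 1) * (1 - B) = (1 + exp 1) * (1 - B) - M"
      using AB by (simp add: M_def field_simps)
    ultimately show ?thesis by (metis mult.assoc mult.commute)
  qed
  have e2: "(a * (1 + B) + M) * ((exp 1 - 1) * (1 + B) - M) \<le> M"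
  proof -
    have "- ((1 + A) / (1 + B)) + exp 1 \<le> M / ((1 + B) * (a * (1 + B) + M))"
      using C1 by (simp add: cond_C1_def M_def a_def algebra_simps)
    then have "(- ((1 + A) / (1 + B)) + exp 1) * ((1 + B) * (a * (1 + B) + M)) \<le> M"
      using d2 AB by (subst (asm) pos_le_divide_eq) auto
    moreover have "(- ((1 + A) / (1 + B)) + exp 1) * (1 + B) = (exp 1 - 1) * (1 + B) - M"
      using AB by (simp add: M_def field_simps)
    ultimately show ?thesis by (metis mult.assoc mult.commute)
  qed
  \<comment> \<open>This removes the last occurrence of M: after scaling by 2 a / M, (C1) involves
    only y1, y2 and a.\<close>
  have sum: "y1 + y2 = 2 * (a / M)" 
  proof -
    have "y1 + y2 = (a * (1 - B) + a * (1 + B)) / M" by (simp only: y1 y2 add_divide_distrib)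
    then show ?thesis by (simp add: algebra_simps)
  qed
  have A1: "2 * (y1 - 1) * ((1 + exp 1) * y1 - a) \<le> y1 + y2"
  proof -
    have "2 * (y1 - 1) * ((1 + exp 1) * y1 - a)
        = 2 * (a / M) * ((a * (1 - B) - M) * ((1 + exp 1) * (1 - B) - M) / M)"
      using M by (simp add: y1 field_simps)
    also have "\<dots> \<le> 2 * (a / M) * 1" using e1 a M by (intro mult_left_mono) auto
    finally show ?thesis by (simp add: sum)
  qed
  have A2: "2 * (y2 + 1) * ((exp 1 - 1) * y2 - a) \<le> y1 + y2"
  proof -
    have "2 * (y2 + 1) * ((exp 1 - 1) * y2 - a)
        = 2 * (a / M) * ((a * (1 + B) + M) * ((exp 1 - 1) * (1 + B) - M) / M)"
      using M by (simp add: y2 field_simps)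
    also have "\<dots> \<le> 2 * (a / M) * 1" using e2 a M by (intro mult_left_mono) auto
    finally show ?thesis by (simp add: sum)
  qed
  obtain \<kappa> l1 l2 where \<kappa>: "11 / 25 \<le> \<kappa>" "\<kappa> \<le> 1" "1 - \<kappa> = a * (\<kappa> * rho \<kappa>)"
    and l: "(l1, l2) \<in> {(1911 / 1000, 1382 / 1000), (1978 / 1000, 1377 / 1000), (2070 / 1000, 1372 / 1000)}"
    and bounds: "1 - 1 / y1 < exp (- (l1 * \<kappa>))" "exp (l2 * \<kappa>) < 1 + 1 / y2"
    using dominant_exponent[OF a ay y A1 A2] by metis
  obtain g G where g: "g holomorphic_on ball 0 1" "g 0 = 1" "\<And>z. z \<in> ball 0 1 \<Longrightarrow> f z = z * g z"
    and G: "G holomorphic_on ball 0 1" "G 0 = 1" "\<And>z. z \<in> ball 0 1 \<Longrightarrow> bernardi c f z = z * G z"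
    and ode: "\<And>z. z \<in> ball 0 1 \<Longrightarrow> z * deriv G z + of_real a * G z = of_real a * g z"
    using bernardi_factorization[OF c fA] unfolding a_def by metis
  obtain h where h: "h ` ball 0 1 \<subseteq> ball 0 1" "\<And>z. z \<in> ball 0 1 \<Longrightarrow> starlike_quotient f z = exp (h z)"
    using f unfolding starlike_exp_def subordinate_def by auto
  \<comment> \<open>At a zero of \<open>g\<close> the quotient is a division by zero, with value 0,
    which the exponential never takes.\<close>
  have gnz: "g z \<noteq> 0" if z: "z \<in> ball 0 1" for z
  proof
    assume "g z = 0"
    then have "z \<noteq> 0" "f z = 0" using g(2) g(3)[OF z] by auto
    then have "exp (h z) = 0" using h(2)[OF z] by (simp add: starlike_quotient_def)
    then show False by simp
  qed
  have dg: "z * deriv g z = g z * (exp (h z) - 1)" if z: "z \<in> ball 0 1" for z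
  proof (cases "z = 0")
    case True
    then show ?thesis using h(2)[OF z] by (simp add: starlike_quotient_def)
  next
    case False
    have "deriv f z = g z + z * deriv g z"
      by (rule DERIV_imp_deriv[OF has_field_derivative_bernardi[OF g(1,3) z]])
    then have "exp (h z) = z * (g z + z * deriv g z) / (z * g z)"
      using h(2)[OF z] False g(3)[OF z] by (simp add: starlike_quotient_def)
    also have "\<dots> = (g z + z * deriv g z) / g z" using False by simp
    finally show ?thesis using gnz[OF z] by (simp add: field_simps)
  qed
  define Q where "Q = (\<lambda>z. G z / g z)"
  have hQ: "Q holomorphic_on ball 0 1" unfolding Q_def by (intro holomorphic_intros G g gnz) 
  have Q0: "Q 0 = 1" by (simp add: Q_def G g)
  have odeQ: "z * deriv Q z = of_real a - of_real a * Q z - Q z * (exp (h z) - 1)" if "norm z < 1" for z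
  proof -
    have z: "z \<in> ball 0 1" using that by simp
    have "(Q has_field_derivative (deriv G z * g z - G z * deriv g z) / (g z * g z)) (at z)"
      unfolding Q_def
      by (intro DERIV_divide gnz z holomorphic_derivI[OF G(1) open_ball z] holomorphic_derivI[OF g(1) open_ball z])
    then have "z * deriv Q z = ((z * deriv G z) * g z - G z * (z * deriv g z)) / (g z * g z)"
      by (simp add: DERIV_imp_deriv algebra_simps)
    also have "z * deriv G z = of_real a * g z - of_real a * G z" using ode[OF z] by (simp add: algebra_simps)
    finally show ?thesis unfolding dg[OF z] Q_def using gnz[OF z] by (simp add: field_simps)
  qed
  obtain w where w: "\<And>z. norm z < 1 \<Longrightarrow> norm (w z) < 1"
      "\<And>z. norm z < 1 \<Longrightarrow> Q z = exp (- of_real \<kappa> * ell (w z))"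
  proof (rule dominated_quotient[OF a \<kappa> hQ Q0 odeQ])
    show "norm (h z) < 1" if "norm z < 1" for z using h(1) that by (auto simp: image_subset_iff)
  qed (blast intro: that)+
  \<comment> \<open>That the transform has no zero besides the origin comes out of the domination:
    \<open>Q\<close> is an exponential.\<close>
  have Gnz: "G z \<noteq> 0" if "z \<in> ball 0 1" for z
    using w(2)[of z] that by (auto simp: Q_def)
  define p where "p = (\<lambda>z. 1 + of_real a * (g z / G z - 1))"
  have hp: "p holomorphic_on ball 0 1" unfolding p_def by (intro holomorphic_intros G g Gnz)
  have p_eq: "starlike_quotient (bernardi c f) z = p z" if z: "z \<in> ball 0 1" for z
  proof (cases "z = 0")
    case True
    then show ?thesis by (simp add: starlike_quotient_def p_def G g)
  next
    case False
    have "deriv (bernardi c f) z = G z + z * deriv G z"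
      by (rule DERIV_imp_deriv[OF has_field_derivative_bernardi[OF G(1,3) z]])
    also have "z * deriv G z = of_real a * g z - of_real a * G z" using ode[OF z] by (simp add: algebra_simps)
    finally show ?thesis
      using False Gnz[OF z] G(3)[OF z] by (simp add: starlike_quotient_def p_def field_simps)
  qed
  have lt: "norm (p z - 1) < norm (of_real (A - B) - of_real B * (p z - 1))" if "norm z < 1" for z
  proof -
    have z: "z \<in> ball 0 1" using that by simp
    have l0: "0 < l1" "0 < l2" using l by auto
    have "g z / G z = 1 / Q z" by (simp add: Q_def)
    also have "\<dots> = exp (of_real \<kappa> * ell (w z))"
      unfolding w(2)[OF that] by (simp add: exp_minus inverse_eq_divide)
    finally have gG: "g z / G z = exp (of_real \<kappa> * ell (w z))" .
    have "\<bar>Im (ell (w z))\<bar> \<le> norm (ell (w z))" by (rule abs_Im_le_cmod)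
    also have "\<dots> < pi / 2" using norm_ell_less[of "w z"] w(1)[OF that] pi_gt3 by simp
    finally have im: "\<bar>Im (ell (w z))\<bar> < pi / 2" .
    have "disc_fun (exp (\<kappa> * (- l1))) (exp (\<kappa> * l2)) (exp (of_real \<kappa> * ell (w z))) \<le> 0"
      using \<kappa>(1,2) l0 by (intro disc_fun_exp_scaled im exp_ell_in_disc[OF l w(1)[OF that]]) auto
    then have "disc_fun (1 - 1 / y1) (1 + 1 / y2) (exp (of_real \<kappa> * ell (w z))) < 0"
    proof (rule disc_fun_mono)
      have "\<kappa> * - l1 \<le> \<kappa> * l2" using \<kappa>(1) l0 by (intro mult_left_mono) auto
      then show "exp (\<kappa> * - l1) \<le> exp (\<kappa> * l2)" by simp
    qed (use bounds in \<open>simp_all add: mult.commute\<close>)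
    then have "disc_fun (1 - 1 / y1) (1 + 1 / y2) (1 + (g z / G z - 1)) < 0" by (simp add: gG)
    from disc_fun_janowski[OF _ _ _ _ _ this, of A B a] show ?thesis
      using M y by (simp add: p_def y1 y2 M_def)
  qed
  have "p 0 = 1" by (simp add: p_def G g)
  then have sub: "subordinate p (janowski A B)" by (intro subordinate_janowskiI AB hp lt)
  then have "subordinate (starlike_quotient (bernardi c f)) (janowski A B)"
    unfolding subordinate_def using p_eq holomorphic_transform[OF hp, of "starlike_quotient (bernardi c f)"]
    by auto
  then show ?thesis using bernardi_class_A[OF c fA] by (simp add: starlike_janowski_def)
qed

theorem corollary2p7:
  fixes A B c :: real and f :: "complex \<Rightarrow> complex"
  assumes "-1 < B" and "B < A" and "A \<le> 1"
    and "c > -1"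
    and "f \<in> class_A"
  shows "(f \<in> starlike_exp \<and> cond_C1 A B 1 c \<and> cond_C2 A B 1 c
            \<longrightarrow> bernardi c f \<in> starlike_janowski A B) \<and>
         (subordinate (deriv f) exp \<and> cond_C1 A B 0 (c + 1) \<and> cond_C2 A B 0 (c + 1)
            \<longrightarrow> bernardi c f \<in> R_janowski A B)"
  using starlike_janowski_bernardi R_janowski_bernardi assms by blast

end
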